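(* Let $\Omega\subset\mathbb R^N$ be a bounded Lipschitz domain, $K:L^2(\Omega)\to L^2(\Omega)$ bounded and linear, $y^\delta\in L^2(\Omega)$, and $\alpha>0$. For $s\in(0,1)$ define $\mathcal J_{\alpha,s}:L^2(\Omega)\to(-\infty,+\infty]$ by $$\mathcal J_{\alpha,s}(u)=\begin{cases}\frac12\|Ku-y^\delta\|_{L^2(\Omega)}^2+\frac\alpha2\left(\|u\|_{L^2(\Omega)}^2+\mathcal E_s(u,u)\right),&u\in H_0^s(\Omega),\\ +\infty,&u\notin H_0^s(\Omega),\end{cases}$$ and define $\mathcal J_{\alpha,1}:L^2(\Omega)\to(-\infty,+\infty]$ by $$\mathcal J_{\alpha,1}(u)=\begin{cases}\frac12\|Ku-y^\delta\|_{L^2(\Omega)}^2+\frac\alpha2\left(\|u\|_{L^2(\Omega)}^2+\|\nabla u\|_{L^2(\Omega)}^2\right),&u\in H_0^1(\Omega),\\ +\infty,&u\notin H_0^1(\Omega).\end{cases}$$ As $s\to1^-$, the functionals $\mathcal J_{\alpha,s}$ $\Gamma$-converge to $\mathcal J_{\alpha,1}$ with respect to the strong topology of $L^2(\Omega)$.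
   Context: $H_0^s(\Omega)$ is the space of functions $u\in H^s(\mathbb R^N)$ with $u=0$ a.e. in $\mathbb R^N\setminus\Omega$; functions on $\Omega$ are extended by zero to $\mathbb R^N$. The fractional energy is $$\mathcal E_s(u,u)=\frac{C_{N,s}}{2}\iint_{\mathbb R^{2N}}\frac{|u(x)-u(y)|^2}{|x-y|^{N+2s}}\,dx\,dy,$$ where the normalization constants $C_{N,s}>0$ are chosen (Bourgain--Brezis--Mironescu normalization) so that for every $u\in H_0^1(\Omega)$, $\lim_{s\to1^-}\mathcal E_s(u,u)=\int_\Omega|\nabla u|^2\,dx$; in particular $C_{N,s}\asymp1-s$ as $s\to1^-$. $\Gamma$-convergence as $s\to1^-$ in strong $L^2(\Omega)$ means: (liminf) whenever $s_n\to1^-$ and $u_n\to u$ strongly in $L^2(\Omega)$, $\mathcal J_{\alpha,1}(u)\le\liminf_n\mathcal J_{\alpha,s_n}(u_n)$; (limsup) for every $u\in L^2(\Omega)$ there are $u_s\to u$ strongly in $L^2(\Omega)$ as $s\to1^-$ with $\limsup_{s\to1^-}\mathcal J_{\alpha,s}(u_s)\le\mathcal J_{\alpha,1}(u)$. *)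

theory Defs
  imports "HOL-Analysis.Analysis"
begin

section \<open>Bounded Lipschitz domains\<close>

text \<open>
  Near every boundary point the set is, for some unit direction \<open>e\<close>, the strict epigraph in
  direction \<open>e\<close> of a Lipschitz function on the hyperplane orthogonal to \<open>e\<close>;
  \<open>x - (x \<bullet> e) *\<^sub>R e\<close> is the orthogonal projection of \<open>x\<close> to that hyperplane.
\<close>

definition lipschitz_boundary :: "(real ^ 'n) set \<Rightarrow> bool" where
  "lipschitz_boundary \<Omega> \<longleftrightarrow>
     (\<forall>p \<in> frontier \<Omega>. \<exists>e r L \<gamma>.
        norm e = 1 \<and> r > 0 \<and> L-lipschitz_on {z. z \<bullet> e = 0} \<gamma> \<and>
        \<Omega> \<inter> ball p r = {x \<in> ball p r. \<gamma> (x - (x \<bullet> e) *\<^sub>R e) < x \<bullet> e})"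

definition bounded_lipschitz_domain :: "(real ^ 'n) set \<Rightarrow> bool" where
  "bounded_lipschitz_domain \<Omega> \<longleftrightarrow>
     open \<Omega> \<and> connected \<Omega> \<and> \<Omega> \<noteq> {} \<and> bounded \<Omega> \<and> lipschitz_boundary \<Omega>"


section \<open>The space \<open>L\<^sup>2\<close>\<close>

text \<open>
  Elements of \<open>L\<^sup>2(\<Omega>)\<close> are represented by functions on the whole space of which only the
  restriction to \<open>\<Omega>\<close> matters. No quotient is taken: all notions below are invariant under
  changing a function on a null subset of \<open>\<Omega>\<close>.
\<close>

definition L2 :: "(real ^ 'n) set \<Rightarrow> (real ^ 'n \<Rightarrow> real) set" where
  "L2 \<Omega> = {u. u \<in> borel_measurable (lebesgue_on \<Omega>) \<and> integrable (lebesgue_on \<Omega>) (\<lambda>x. (u x)\<^sup>2)}"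

definition l2_norm :: "(real ^ 'n) set \<Rightarrow> (real ^ 'n \<Rightarrow> real) \<Rightarrow> real" where
  "l2_norm \<Omega> u = sqrt (LINT x|lebesgue_on \<Omega>. (u x)\<^sup>2)"

text \<open>
  A bounded linear operator on \<open>L\<^sup>2(\<Omega>)\<close>, acting on representatives. That it maps
  a.e. equal functions to a.e. equal functions follows from linearity and boundedness.
\<close>

definition L2_bounded_linear ::
    "(real ^ 'n) set \<Rightarrow> ((real ^ 'n \<Rightarrow> real) \<Rightarrow> real ^ 'n \<Rightarrow> real) \<Rightarrow> bool" where
  "L2_bounded_linear \<Omega> K \<longleftrightarrow>
     (\<forall>u \<in> L2 \<Omega>. K u \<in> L2 \<Omega>) \<and>
     (\<forall>u \<in> L2 \<Omega>. \<forall>v \<in> L2 \<Omega>. AE x in lebesgue_on \<Omega>. K (\<lambda>z. u z + v z) x = K u x + K v x) \<and>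
     (\<forall>c. \<forall>u \<in> L2 \<Omega>. AE x in lebesgue_on \<Omega>. K (\<lambda>z. c * u z) x = c * K u x) \<and>
     (\<exists>B. \<forall>u \<in> L2 \<Omega>. l2_norm \<Omega> (K u) \<le> B * l2_norm \<Omega> u)"

definition zero_ext :: "(real ^ 'n) set \<Rightarrow> (real ^ 'n \<Rightarrow> real) \<Rightarrow> real ^ 'n \<Rightarrow> real" where
  "zero_ext \<Omega> u = (\<lambda>x. if x \<in> \<Omega> then u x else 0)"


section \<open>The spaces \<open>H\<^sup>1(\<Omega>)\<close> and \<open>H\<^sub>0\<^sup>1(\<Omega>)\<close>\<close>

definition partial_deriv :: "'n \<Rightarrow> (real ^ 'n \<Rightarrow> real) \<Rightarrow> real ^ 'n \<Rightarrow> real" where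
  "partial_deriv i f = (\<lambda>x. frechet_derivative f (at x) (axis i 1))"

fun C_k :: "nat \<Rightarrow> (real ^ 'n \<Rightarrow> real) \<Rightarrow> bool" where
  "C_k 0 f \<longleftrightarrow> continuous_on UNIV f"
| "C_k (Suc k) f \<longleftrightarrow> (\<forall>x. f differentiable (at x)) \<and> (\<forall>i. C_k k (partial_deriv i f))"

definition test_functions :: "(real ^ 'n) set \<Rightarrow> (real ^ 'n \<Rightarrow> real) set" where
  "test_functions \<Omega> =
     {\<phi>. (\<forall>k. C_k k \<phi>) \<and> compact (closure {x. \<phi> x \<noteq> 0}) \<and> closure {x. \<phi> x \<noteq> 0} \<subseteq> \<Omega>}"

definition has_weak_gradient ::
    "(real ^ 'n) set \<Rightarrow> (real ^ 'n \<Rightarrow> real) \<Rightarrow> (real ^ 'n \<Rightarrow> real ^ 'n) \<Rightarrow> bool" where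
  "has_weak_gradient \<Omega> u g \<longleftrightarrow>
     (\<forall>\<phi> \<in> test_functions \<Omega>. \<forall>i.
        (LINT x|lebesgue_on \<Omega>. u x * partial_deriv i \<phi> x) = - (LINT x|lebesgue_on \<Omega>. g x $ i * \<phi> x))"

definition H1 :: "(real ^ 'n) set \<Rightarrow> (real ^ 'n \<Rightarrow> real) set" where
  "H1 \<Omega> = {u \<in> L2 \<Omega>. \<exists>g. (\<forall>i. (\<lambda>x. g x $ i) \<in> L2 \<Omega>) \<and> has_weak_gradient \<Omega> u g}"

text \<open>For \<open>u \<in> H1 \<Omega>\<close> this is unique up to a null subset of \<open>\<Omega>\<close>.\<close>

definition weak_grad :: "(real ^ 'n) set \<Rightarrow> (real ^ 'n \<Rightarrow> real) \<Rightarrow> real ^ 'n \<Rightarrow> real ^ 'n" where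
  "weak_grad \<Omega> u = (SOME g. (\<forall>i. (\<lambda>x. g x $ i) \<in> L2 \<Omega>) \<and> has_weak_gradient \<Omega> u g)"

definition grad_norm :: "(real ^ 'n) set \<Rightarrow> (real ^ 'n \<Rightarrow> real) \<Rightarrow> real" where
  "grad_norm \<Omega> u = sqrt (LINT x|lebesgue_on \<Omega>. (norm (weak_grad \<Omega> u x))\<^sup>2)"

definition h1_norm :: "(real ^ 'n) set \<Rightarrow> (real ^ 'n \<Rightarrow> real) \<Rightarrow> real" where
  "h1_norm \<Omega> u = sqrt ((l2_norm \<Omega> u)\<^sup>2 + (grad_norm \<Omega> u)\<^sup>2)"

definition H01 :: "(real ^ 'n) set \<Rightarrow> (real ^ 'n \<Rightarrow> real) set" where
  "H01 \<Omega> = {u \<in> H1 \<Omega>. \<exists>\<phi> :: nat \<Rightarrow> real ^ 'n \<Rightarrow> real.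
     (\<forall>n. \<phi> n \<in> test_functions \<Omega>) \<and> (\<lambda>n. h1_norm \<Omega> (\<lambda>x. \<phi> n x - u x)) \<longlonglongrightarrow> 0}"


section \<open>Fractional spaces and energy\<close>

definition gagliardo :: "real \<Rightarrow> (real ^ 'n \<Rightarrow> real) \<Rightarrow> ennreal" where
  "gagliardo s u =
     (\<integral>\<^sup>+ (x, y). ennreal (\<bar>u x - u y\<bar>\<^sup>2 / norm (x - y) powr (real CARD('n) + 2 * s))
        \<partial>(lebesgue \<Otimes>\<^sub>M lebesgue))"

definition Hs :: "real \<Rightarrow> (real ^ 'n \<Rightarrow> real) set" where
  "Hs s = {u \<in> L2 UNIV. gagliardo s u < \<infinity>}"

definition H0s :: "(real ^ 'n) set \<Rightarrow> real \<Rightarrow> (real ^ 'n \<Rightarrow> real) set" where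
  "H0s \<Omega> s = {u \<in> Hs s. AE x in lebesgue. x \<notin> \<Omega> \<longrightarrow> u x = 0}"

text \<open>
  \<open>C s\<close> is the normalization constant of order \<open>s\<close>; its dependence on the dimension is
  suppressed.
\<close>

definition frac_energy :: "(real \<Rightarrow> real) \<Rightarrow> real \<Rightarrow> (real ^ 'n \<Rightarrow> real) \<Rightarrow> ennreal" where
  "frac_energy C s u = ennreal (C s / 2) * gagliardo s u"

definition bbm_normalization :: "(real ^ 'n) set \<Rightarrow> (real \<Rightarrow> real) \<Rightarrow> bool" where
  "bbm_normalization \<Omega> C \<longleftrightarrow>
     (\<forall>s. 0 < s \<and> s < 1 \<longrightarrow> C s > 0) \<and>
     (\<forall>u \<in> H01 \<Omega>. ((\<lambda>s. frac_energy C s (zero_ext \<Omega> u)) \<longlongrightarrow> ennreal ((grad_norm \<Omega> u)\<^sup>2)) (at_left 1))"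


section \<open>The functionals and \<open>\<Gamma>\<close>-convergence\<close>

text \<open>On \<open>H0s \<Omega> s\<close> the energy is finite, so \<open>enn2real\<close> loses nothing there.\<close>

definition J_frac ::
    "(real ^ 'n) set \<Rightarrow> ((real ^ 'n \<Rightarrow> real) \<Rightarrow> real ^ 'n \<Rightarrow> real) \<Rightarrow> (real ^ 'n \<Rightarrow> real) \<Rightarrow>
     (real \<Rightarrow> real) \<Rightarrow> real \<Rightarrow> real \<Rightarrow> (real ^ 'n \<Rightarrow> real) \<Rightarrow> ereal" where
  "J_frac \<Omega> K y C \<alpha> s u =
     (if zero_ext \<Omega> u \<in> H0s \<Omega> s
      then ereal (1 / 2 * (l2_norm \<Omega> (\<lambda>x. K u x - y x))\<^sup>2
                  + \<alpha> / 2 * ((l2_norm \<Omega> u)\<^sup>2 + enn2real (frac_energy C s (zero_ext \<Omega> u))))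
      else \<infinity>)"

definition J_one ::
    "(real ^ 'n) set \<Rightarrow> ((real ^ 'n \<Rightarrow> real) \<Rightarrow> real ^ 'n \<Rightarrow> real) \<Rightarrow> (real ^ 'n \<Rightarrow> real) \<Rightarrow>
     real \<Rightarrow> (real ^ 'n \<Rightarrow> real) \<Rightarrow> ereal" where
  "J_one \<Omega> K y \<alpha> u =
     (if u \<in> H01 \<Omega>
      then ereal (1 / 2 * (l2_norm \<Omega> (\<lambda>x. K u x - y x))\<^sup>2
                  + \<alpha> / 2 * ((l2_norm \<Omega> u)\<^sup>2 + (grad_norm \<Omega> u)\<^sup>2))
      else \<infinity>)"

definition Gamma_converges_L2 ::
    "(real ^ 'n) set \<Rightarrow> (real \<Rightarrow> (real ^ 'n \<Rightarrow> real) \<Rightarrow> ereal) \<Rightarrow>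
     ((real ^ 'n \<Rightarrow> real) \<Rightarrow> ereal) \<Rightarrow> bool" where
  "Gamma_converges_L2 \<Omega> F F1 \<longleftrightarrow>
     (\<forall>(s :: nat \<Rightarrow> real) (v :: nat \<Rightarrow> real ^ 'n \<Rightarrow> real). \<forall>u \<in> L2 \<Omega>.
        (\<forall>n. 0 < s n \<and> s n < 1) \<longrightarrow> s \<longlonglongrightarrow> 1 \<longrightarrow>
        (\<forall>n. v n \<in> L2 \<Omega>) \<longrightarrow> (\<lambda>n. l2_norm \<Omega> (\<lambda>x. v n x - u x)) \<longlonglongrightarrow> 0 \<longrightarrow>
        F1 u \<le> liminf (\<lambda>n. F (s n) (v n))) \<and>
     (\<forall>u \<in> L2 \<Omega>. \<exists>v :: real \<Rightarrow> real ^ 'n \<Rightarrow> real.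
        (\<forall>s. 0 < s \<and> s < 1 \<longrightarrow> v s \<in> L2 \<Omega>) \<and>
        ((\<lambda>s. l2_norm \<Omega> (\<lambda>x. v s x - u x)) \<longlongrightarrow> 0) (at_left 1) \<and>
        Limsup (at_left 1) (\<lambda>s. F s (v s)) \<le> F1 u)"

end

theory Submission
  imports Defs "HOL-Computational_Algebra.Polynomial"
begin

text \<open>
  The recovery sequence is constant, by the normalization. For the lower bound let \<open>\<rho>\<close> be a
  mollifier. Since the fractional energy is convex and translation invariant,
  \<open>\<rho> * v\<^sub>n\<close> has at most the energy of \<open>v\<^sub>n\<close>, while the energy of
  \<open>\<rho> * (v\<^sub>n - u)\<close> is at most \<open>c\<parallel>v\<^sub>n - u\<parallel>\<^sup>2\<close> with \<open>c\<close> independent of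
  \<open>s\<close> near 1. Hence the Dirichlet energy of \<open>\<rho> * u\<close>, which by scaling into \<open>\<Omega>\<close> is the limit of
  its fractional energies, is bounded by the liminf, uniformly in \<open>\<rho>\<close>. So \<open>u\<close> has a weak
  gradient on the whole space, and as \<open>u\<close> vanishes outside \<open>\<Omega>\<close>, pushing it inwards locally near the
  Lipschitz boundary and mollifying shows \<open>u \<in> H\<^sub>0\<^sup>1(\<Omega>)\<close>.
\<close>

subsection \<open>Smooth functions\<close>

text \<open>The normalization controls \<open>C\<close> only through the energies of one fixed
  function at a time, while the lower bound concerns a varying sequence. All uniformity in s comes
  from one estimate: min(1, |h|^2) is dominated by the squared increments of finitely many test
  functions, so the normalized kernel has bounded integral against it as s tends to 1. Energies are
  therefore written as integrals over the increment h, and convexity, scaling and smoothing are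
  proved for each h separately. The bound on mollified functions controls their gradients only in
  norm. Weak compactness is avoided: approximations of nearly minimal Dirichlet energy have Cauchy
  gradients by the parallelogram law. This is used twice. With test functions of the whole space it
  yields the gradient of u with the sharp bound; with test functions supported in \<Omega> it yields
  membership in \<open>H01\<close>, for which any finite bound is enough. Equivalence classes never
  appear: functions are replaced by Borel representatives that vanish at every point off
  \<Omega>.\<close>

lemma partial_deriv_eq:
  "(f has_derivative f') (at x) \<Longrightarrow> partial_deriv i f x = f' (axis i 1)"
  by (simp add: partial_deriv_def flip: frechet_derivative_at)

lemma C_k_const: "C_k k (\<lambda>x::real ^ 'n. c)"
proof (induction k arbitrary: c)
  case (Suc k)
  have "partial_deriv i (\<lambda>x. c) = (\<lambda>x::real ^ 'n. 0)" for i
    using partial_deriv_eq[OF has_derivative_const] by blast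
  then show ?case
    using Suc by simp
qed simp

lemma C_k_Suc_imp: "C_k (Suc k) f \<Longrightarrow> C_k k f"
proof (induction k arbitrary: f)
  case 0
  then show ?case
    by (auto intro!: continuous_at_imp_continuous_on differentiable_imp_continuous_within)
qed (use C_k.simps(2) in blast)

lemma C_k_add:
  assumes "C_k k f" "C_k k g"
  shows "C_k k (\<lambda>x. f x + g x)"
  using assms
proof (induction k arbitrary: f g)
  case (Suc k)
  then have d: "f differentiable at x" "g differentiable at x" for x
    by auto
  have "partial_deriv i (\<lambda>x. f x + g x) = (\<lambda>x. partial_deriv i f x + partial_deriv i g x)" for i
    by (rule ext, subst partial_deriv_eq[OF has_derivative_add])
      (use d in \<open>auto simp: partial_deriv_def frechet_derivative_works[symmetric]\<close>)
  then show ?case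
    using Suc d by (auto intro!: differentiable_add)
qed (auto intro: continuous_intros)

lemma partial_deriv_mult:
  assumes "f differentiable at x" "g differentiable at x"
  shows "partial_deriv i (\<lambda>x. f x * g x) x = f x * partial_deriv i g x + partial_deriv i f x * g x"
  by (subst partial_deriv_eq[OF has_derivative_mult])
      (use assms in \<open>auto simp: partial_deriv_def frechet_derivative_works[symmetric]\<close>)

lemma C_k_mult:
  assumes "C_k k f" "C_k k g"
  shows "C_k k (\<lambda>x. f x * g x)"
  using assms
proof (induction k arbitrary: f g)
  case (Suc k)
  then have d: "f differentiable at x" "g differentiable at x" for x
    by auto
  have "partial_deriv i (\<lambda>x. f x * g x) = (\<lambda>x. f x * partial_deriv i g x + partial_deriv i f x * g x)" for i
    using d by (auto simp: partial_deriv_mult)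
  moreover have "C_k k f" "C_k k g"
    using Suc.prems C_k_Suc_imp by auto
  ultimately show ?case
    using Suc d by (auto intro!: differentiable_mult C_k_add)
qed (auto intro: continuous_intros)

lemma C_k_inverse:
  assumes "C_k k f" "\<And>x. f x \<noteq> 0"
  shows "C_k k (\<lambda>x. inverse (f x))"
  using assms
proof (induction k arbitrary: f)
  case 0
  then have "continuous_on UNIV f"
    by simp
  then have "continuous_on UNIV (\<lambda>x. inverse (f x))"
    using 0 by (intro continuous_on_inverse) auto
  then show ?case
    by simp
next
  case (Suc k)
  then have d: "f differentiable at x" for x
    by simp
  \<comment> \<open>The reciprocal reappears as a factor of its own derivative, so order
    \<open>k\<close> of the reciprocal yields order \<open>Suc k\<close>.\<close>
  have eq: "partial_deriv i (\<lambda>x. inverse (f x))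
      = (\<lambda>x. (-1) * (inverse (f x) * (partial_deriv i f x * inverse (f x))))" for i
    using partial_deriv_eq[OF Deriv.has_derivative_inverse[OF Suc.prems(2) iffD1[OF frechet_derivative_works d]]]
    by (intro ext) (simp add: partial_deriv_def)
  have inv: "C_k k (\<lambda>x. inverse (f x))"
    by (rule Suc.IH[OF C_k_Suc_imp[OF Suc.prems(1)] Suc.prems(2)])
  have pd: "C_k k (partial_deriv i f)" for i
    using Suc.prems by simp
  have "C_k k (partial_deriv i (\<lambda>x. inverse (f x)))" for i
    unfolding eq by (rule C_k_mult[OF C_k_const C_k_mult[OF inv C_k_mult[OF pd inv]]])
  moreover have "(\<lambda>x. inverse (f x)) differentiable at x" for x
    using d Suc.prems(2) by (rule differentiable_inverse)
  ultimately show ?case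
    by simp
qed

text \<open>A sequence \<open>G\<close> of successive derivatives replaces a notion of smoothness on
  the real line: differentiating the composition moves from \<open>G j\<close> to
  \<open>G (Suc j)\<close>, so the induction on the order keeps \<open>j\<close> arbitrary.\<close>

lemma C_k_compose_real:
  assumes "\<And>j t. (G j has_real_derivative G (Suc j) t) (at t)" "\<And>k. C_k k q"
  shows "C_k k (\<lambda>x. G j (q x))"
proof (induction k arbitrary: j)
  case 0
  have "continuous_on UNIV (G j)"
    using DERIV_isCont[OF assms(1)] by (simp add: continuous_at_imp_continuous_on)
  then have "continuous_on UNIV (\<lambda>x. G j (q x))"
    by (rule continuous_on_compose2) (use assms(2)[of 0] in simp_all)
  then show ?case
    by simp
next
  case (Suc k)
  have d: "q differentiable at x" for x
    using assms(2)[of "Suc 0"] by simp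
  have *: "((\<lambda>x. G j (q x)) has_derivative (\<lambda>h. frechet_derivative q (at x) h * G (Suc j) (q x))) (at x)"
    for x
    using DERIV_compose_FDERIV[OF assms(1), of q _ x UNIV] d[of x]
    by (simp add: frechet_derivative_works)
  have eq: "partial_deriv i (\<lambda>x. G j (q x)) = (\<lambda>x. partial_deriv i q x * G (Suc j) (q x))" for i
    using partial_deriv_eq[OF *] by (intro ext) (simp add: partial_deriv_def)
  have "C_k k (partial_deriv i q)" for i
    using assms(2)[of "Suc k"] by simp
  then have "C_k k (partial_deriv i (\<lambda>x. G j (q x)))" for i
    unfolding eq using Suc.IH by (rule C_k_mult)
  then show ?case
    using differentiableI[OF *] by simp
qed

lemma has_derivative_affine_compose:
  assumes "f differentiable at (c + a *\<^sub>R x)"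
  shows "((\<lambda>x. f (c + a *\<^sub>R x)) has_derivative
          (\<lambda>h. frechet_derivative f (at (c + a *\<^sub>R x)) (a *\<^sub>R h))) (at x)"
proof -
  have *: "((\<lambda>x. c + a *\<^sub>R x) has_derivative (\<lambda>h. a *\<^sub>R h)) (at x)"
    by (auto intro!: derivative_eq_intros)
  show ?thesis
    using has_derivative_compose[OF *] assms by (simp add: frechet_derivative_works)
qed

lemma partial_deriv_affine:
  assumes "f differentiable at (c + a *\<^sub>R x)"
  shows "partial_deriv i (\<lambda>x. f (c + a *\<^sub>R x)) x = a * partial_deriv i f (c + a *\<^sub>R x)"
proof -
  have "linear (frechet_derivative f (at (c + a *\<^sub>R x)))"
    using assms by (simp add: linear_frechet_derivative)
  then show ?thesis
    using partial_deriv_eq[OF has_derivative_affine_compose[OF assms]]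
    by (simp add: partial_deriv_def linear_cmul)
qed

lemma C_k_affine:
  assumes "C_k k f"
  shows "C_k k (\<lambda>x. f (c + a *\<^sub>R x))"
  using assms
proof (induction k arbitrary: f)
  case 0
  then have "continuous_on UNIV f"
    by simp
  then have "continuous_on UNIV (\<lambda>x. f (c + a *\<^sub>R x))"
    by (rule continuous_on_compose2) (intro continuous_intros subset_UNIV)+
  then show ?case
    by simp
next
  case (Suc k)
  then have d: "f differentiable at x" for x
    by auto
  have eq: "partial_deriv i (\<lambda>x. f (c + a *\<^sub>R x)) = (\<lambda>x. a * partial_deriv i f (c + a *\<^sub>R x))" for i
    using d by (intro ext partial_deriv_affine)
  have "C_k k (\<lambda>x. partial_deriv i f (c + a *\<^sub>R x))" for i
    by (rule Suc.IH) (use Suc.prems in simp)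
  then have "C_k k (partial_deriv i (\<lambda>x. f (c + a *\<^sub>R x)))" for i
    unfolding eq by (rule C_k_mult[OF C_k_const])
  then show ?case
    using differentiableI[OF has_derivative_affine_compose[OF d]] by simp
qed

definition smooth :: "(real ^ 'n \<Rightarrow> real) \<Rightarrow> bool" where
  "smooth f \<longleftrightarrow> (\<forall>k. C_k k f)"

lemma smooth_differentiable: "smooth f \<Longrightarrow> f differentiable at x"
  unfolding smooth_def by (drule spec[of _ "Suc 0"]) simp

lemma smooth_partial_deriv: "smooth f \<Longrightarrow> smooth (partial_deriv i f)"
  unfolding smooth_def
proof
  fix k assume "\<forall>k. C_k k f"
  then have "C_k (Suc k) f" ..
  then show "C_k k (partial_deriv i f)"
    by simp
qed

lemma smooth_continuous_on: "smooth f \<Longrightarrow> continuous_on S f"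
  unfolding smooth_def by (drule spec[of _ 0], rule continuous_on_subset[of UNIV]) simp_all

lemma smooth_borel_measurable [measurable_dest]: "smooth f \<Longrightarrow> f \<in> borel_measurable borel"
  by (simp add: borel_measurable_continuous_onI smooth_continuous_on)

lemma smooth_const: "smooth (\<lambda>x. c)"
  unfolding smooth_def using C_k_const by (rule allI)

lemma smooth_add: "smooth f \<Longrightarrow> smooth g \<Longrightarrow> smooth (\<lambda>x. f x + g x)"
  unfolding smooth_def by (rule allI, rule C_k_add) simp_all

lemma smooth_mult: "smooth f \<Longrightarrow> smooth g \<Longrightarrow> smooth (\<lambda>x. f x * g x)"
  unfolding smooth_def by (rule allI, rule C_k_mult) simp_all

lemma smooth_inverse: "smooth f \<Longrightarrow> (\<And>x. f x \<noteq> 0) \<Longrightarrow> smooth (\<lambda>x. inverse (f x))"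
  unfolding smooth_def by (rule allI, rule C_k_inverse) simp_all

lemma smooth_affine: "smooth f \<Longrightarrow> smooth (\<lambda>x. f (b + a *\<^sub>R x))"
  unfolding smooth_def by (rule allI, rule C_k_affine) simp_all

lemma smooth_diff: "smooth f \<Longrightarrow> smooth g \<Longrightarrow> smooth (\<lambda>x. f x - g x)"
  using smooth_add[of f "\<lambda>x. (-1) * g x"] smooth_mult[OF smooth_const, of g "-1"] by simp

lemma smooth_sum: "(\<And>i. i \<in> I \<Longrightarrow> smooth (f i)) \<Longrightarrow> smooth (\<lambda>x. \<Sum>i\<in>I. f i x)"
  by (induction I rule: infinite_finite_induct) (simp_all add: smooth_const smooth_add)

lemma smooth_component: "smooth (\<lambda>x::real ^ 'n. x $ i)"
proof -
  have *: "((\<lambda>x. x $ i) has_derivative (\<lambda>h. h $ i)) (at x)" for x :: "real ^ 'n"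
    by (rule bounded_linear_imp_has_derivative[OF bounded_linear_vec_nth])
  have eq: "partial_deriv j (\<lambda>x. x $ i) = (\<lambda>x::real ^ 'n. axis j 1 $ i)" for j
    by (rule ext, rule partial_deriv_eq[OF *])
  have "C_k k (partial_deriv j (\<lambda>x::real ^ 'n. x $ i))" for j k
    unfolding eq by (rule C_k_const)
  then have "C_k (Suc k) (\<lambda>x::real ^ 'n. x $ i)" for k
    using differentiableI[OF *] by simp
  then show ?thesis
    unfolding smooth_def by (rule allI[OF C_k_Suc_imp])
qed

lemma smooth_norm_diff_sq: "smooth (\<lambda>x. (norm (x - c))\<^sup>2)"
proof -
  have eq: "(norm (x - c))\<^sup>2 = (\<Sum>i\<in>UNIV. (x $ i - c $ i) * (x $ i - c $ i))" for x
    by (simp add: power2_norm_eq_inner inner_vec_def)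
  show ?thesis
    unfolding eq
    by (rule smooth_sum, rule smooth_mult; rule smooth_diff[OF smooth_component smooth_const])
qed

subsection \<open>Cutoff functions\<close>

text \<open>The functions p(1/t) exp(-1/t), extended by 0 to t \<le> 0. Admitting every polynomial p
  makes the class closed under differentiation; p = 1 gives the classical flat function.\<close>

definition flat :: "real poly \<Rightarrow> real \<Rightarrow> real" where
  "flat p t = (if t > 0 then poly p (1 / t) * exp (- (1 / t)) else 0)"

lemma tendsto_poly_exp_neg: "((\<lambda>x::real. poly p x * exp (- x)) \<longlongrightarrow> 0) at_top"
proof -
  have "((\<lambda>x::real. x ^ i / exp x) \<longlongrightarrow> 0) at_top" for i
    by (rule tendsto_power_div_exp_0)
  then have "((\<lambda>x::real. \<Sum>i\<le>degree p. coeff p i * (x ^ i / exp x)) \<longlongrightarrow> 0) at_top"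
    by (intro tendsto_null_sum tendsto_mult_right_zero)
  moreover have "(\<Sum>i\<le>degree p. coeff p i * (x ^ i / exp x)) = poly p x * exp (- x)" for x :: real
    by (simp add: poly_altdef exp_minus divide_inverse sum_distrib_right mult.assoc)
  ultimately show ?thesis
    by simp
qed

lemma flat_tendsto_0: "(flat p \<longlongrightarrow> 0) (at 0)"
proof -
  have "((\<lambda>t::real. poly p (inverse t) * exp (- inverse t)) \<longlongrightarrow> 0) (at_right 0)"
    using filterlim_compose[OF tendsto_poly_exp_neg filterlim_inverse_at_top_right] by simp
  then have "(flat p \<longlongrightarrow> 0) (at_right 0)"
    by (rule Lim_transform_eventually)
      (auto simp: eventually_at_filter flat_def divide_inverse)
  moreover have "(flat p \<longlongrightarrow> 0) (at_left 0)"
    by (rule tendsto_eventually) (auto simp: eventually_at_filter flat_def)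
  ultimately show ?thesis
    by (simp add: filterlim_at_split)
qed

text \<open>By the chain rule, p(1/t) exp(-1/t) has derivative t^(-2) (p(1/t) - p'(1/t)) exp(-1/t),
  and t^(-2) is the polynomial X^2 evaluated at 1/t.\<close>

definition flat_pderiv :: "real poly \<Rightarrow> real poly" where
  "flat_pderiv p = [:0, 0, 1:] * (p - pderiv p)"

lemma flat_has_real_derivative: "(flat p has_real_derivative flat (flat_pderiv p) t) (at t)"
proof -
  consider "t > 0" | "t < 0" | "t = 0"
    by linarith
  then show ?thesis
  proof cases
    case 1
    have "((\<lambda>t. poly p (1 / t) * exp (- (1 / t))) has_real_derivative flat (flat_pderiv p) t) (at t)"
      using 1 by (auto intro!: derivative_eq_intros DERIV_chain2[OF poly_DERIV]
          simp: flat_def flat_pderiv_def field_simps power2_eq_square)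
    then show ?thesis
      by (rule has_field_derivative_transform_within_open[of _ _ _ "{0<..}"])
        (use 1 in \<open>auto simp: flat_def\<close>)
  next
    case 2
    have "((\<lambda>t. 0) has_real_derivative 0) (at t)"
      by simp
    then have "(flat p has_real_derivative 0) (at t)"
      by (rule has_field_derivative_transform_within_open[of _ _ _ "{..<0}"])
        (use 2 in \<open>auto simp: flat_def\<close>)
    then show ?thesis
      using 2 by (simp add: flat_def)
  next
    case 3
    \<comment> \<open>Dividing by \<open>h\<close> multiplies the polynomial by its variable, so the
      difference quotient at 0 is again of the flat form and tends to 0.\<close>
    have "(\<lambda>h. (flat p h - flat p 0) / h) = flat ([:0, 1:] * p)"
      by (auto simp: flat_def)
    then show ?thesis
      using flat_tendsto_0[of "[:0, 1:] * p"] 3 unfolding DERIV_def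
      by (simp add: flat_def[of _ 0])
  qed
qed

definition bump :: "real \<Rightarrow> real" where
  "bump = flat 1"

lemma bump_pos: "t > 0 \<Longrightarrow> bump t > 0"
  and bump_eq_0: "t \<le> 0 \<Longrightarrow> bump t = 0"
  and bump_nonneg: "bump t \<ge> 0"
  by (auto simp: bump_def flat_def)

lemma smooth_bump:
  assumes "smooth q"
  shows "smooth (\<lambda>x. bump (q x))"
  unfolding smooth_def
proof
  fix k
  have "C_k k (\<lambda>x. flat ((flat_pderiv ^^ 0) 1) (q x))"
    by (rule C_k_compose_real[of "\<lambda>j. flat ((flat_pderiv ^^ j) 1)"])
      (use assms flat_has_real_derivative in \<open>auto simp: smooth_def\<close>)
  then show "C_k k (\<lambda>x. bump (q x))"
    by (simp add: bump_def)
qed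

text \<open>The squared distance is used because the norm is not differentiable at the centre. The
  value is 1 within distance \<open>r\<close> of \<open>c\<close>, where the second bump vanishes,
  and 0 beyond distance \<open>2 * r\<close>, where the first one does.\<close>

definition cutoff :: "real ^ 'n \<Rightarrow> real \<Rightarrow> real ^ 'n \<Rightarrow> real" where
  "cutoff c r x = bump (4 * r\<^sup>2 - (norm (x - c))\<^sup>2) *
     inverse (bump (4 * r\<^sup>2 - (norm (x - c))\<^sup>2) + bump ((norm (x - c))\<^sup>2 - r\<^sup>2))"

lemma cutoff_denom_pos:
  assumes "r > 0"
  shows "bump (4 * r\<^sup>2 - (norm (x - c))\<^sup>2) + bump ((norm (x - c))\<^sup>2 - r\<^sup>2) > 0"
proof -
  have "r\<^sup>2 > 0"
    using assms by simp
  then have "4 * r\<^sup>2 - (norm (x - c))\<^sup>2 > 0 \<or> (norm (x - c))\<^sup>2 - r\<^sup>2 > 0"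
    by linarith
  then show ?thesis
    using bump_nonneg[of "4 * r\<^sup>2 - (norm (x - c))\<^sup>2"] bump_nonneg[of "(norm (x - c))\<^sup>2 - r\<^sup>2"]
      bump_pos[of "4 * r\<^sup>2 - (norm (x - c))\<^sup>2"] bump_pos[of "(norm (x - c))\<^sup>2 - r\<^sup>2"]
    by linarith
qed

lemma smooth_cutoff:
  assumes "r > 0"
  shows "smooth (cutoff c r)"
  unfolding cutoff_def
proof (rule smooth_mult[OF _ smooth_inverse])
  show s: "smooth (\<lambda>x. bump (4 * r\<^sup>2 - (norm (x - c))\<^sup>2))"
    by (rule smooth_bump[OF smooth_diff[OF smooth_const smooth_norm_diff_sq]])
  show "smooth (\<lambda>x. bump (4 * r\<^sup>2 - (norm (x - c))\<^sup>2) + bump ((norm (x - c))\<^sup>2 - r\<^sup>2))"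
    by (rule smooth_add[OF s smooth_bump[OF smooth_diff[OF smooth_norm_diff_sq smooth_const]]])
  show "bump (4 * r\<^sup>2 - (norm (x - c))\<^sup>2) + bump ((norm (x - c))\<^sup>2 - r\<^sup>2) \<noteq> 0" for x
    using cutoff_denom_pos[OF assms, of x c] by linarith
qed

lemma cutoff_nonneg: "0 \<le> cutoff c r x"
  by (simp add: cutoff_def bump_nonneg)

lemma cutoff_le_1: "r > 0 \<Longrightarrow> cutoff c r x \<le> 1"
  using cutoff_denom_pos[of r x c] bump_nonneg
  by (simp add: cutoff_def flip: divide_inverse)

lemma cutoff_eq_1:
  assumes "r > 0" "dist x c \<le> r"
  shows "cutoff c r x = 1"
proof -
  have "(norm (x - c))\<^sup>2 \<le> r\<^sup>2"
    using assms by (intro power_mono) (auto simp: dist_norm)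
  then have "bump ((norm (x - c))\<^sup>2 - r\<^sup>2) = 0"
    by (simp add: bump_eq_0)
  then show ?thesis
    using cutoff_denom_pos[OF assms(1), of x c] by (simp add: cutoff_def)
qed

lemma cutoff_eq_0:
  assumes "dist x c \<ge> 2 * r" "r > 0"
  shows "cutoff c r x = 0"
proof -
  have "(2 * r)\<^sup>2 \<le> (norm (x - c))\<^sup>2"
    using assms by (intro power_mono) (auto simp: dist_norm)
  then show ?thesis
    by (simp add: cutoff_def bump_eq_0 power_mult_distrib)
qed

subsection \<open>Square-integrable functions\<close>

text \<open>The space L^2 over an arbitrary measure. The notions of the theorem refer to
  \<open>lebesgue_on\<close>, while Tonelli, translations and convolutions are handled over
  \<open>lborel\<close>; both are instances.\<close>

definition SqInt :: "'a measure \<Rightarrow> ('a \<Rightarrow> real) set" where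
  "SqInt M = {f. f \<in> borel_measurable M \<and> integrable M (\<lambda>x. (f x)\<^sup>2)}"

definition nrm :: "'a measure \<Rightarrow> ('a \<Rightarrow> real) \<Rightarrow> real" where
  "nrm M f = sqrt (LINT x|M. (f x)\<^sup>2)"

lemma SqInt_measurable [measurable_dest]: "f \<in> SqInt M \<Longrightarrow> f \<in> borel_measurable M"
  and SqInt_integrable_sq: "f \<in> SqInt M \<Longrightarrow> integrable M (\<lambda>x. (f x)\<^sup>2)"
  by (simp_all add: SqInt_def)

lemma SqInt_mult_integrable:
  assumes "f \<in> SqInt M" "g \<in> SqInt M"
  shows "integrable M (\<lambda>x. f x * g x)"
proof (rule Bochner_Integration.integrable_bound)
  show "integrable M (\<lambda>x. (f x)\<^sup>2 + (g x)\<^sup>2)"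
    using assms by (simp add: SqInt_integrable_sq)
  show "(\<lambda>x. f x * g x) \<in> borel_measurable M"
    using assms by (simp add: SqInt_measurable)
  have "\<bar>a * b\<bar> \<le> a\<^sup>2 + b\<^sup>2" for a b :: real
  proof -
    have "0 \<le> (\<bar>a\<bar> - \<bar>b\<bar>)\<^sup>2"
      by simp
    then have "2 * (\<bar>a\<bar> * \<bar>b\<bar>) \<le> a\<^sup>2 + b\<^sup>2"
      by (simp add: power2_diff)
    moreover have "0 \<le> \<bar>a\<bar> * \<bar>b\<bar>"
      by simp
    ultimately show ?thesis
      unfolding abs_mult by linarith
  qed
  then show "AE x in M. norm (f x * g x) \<le> norm ((f x)\<^sup>2 + (g x)\<^sup>2)"
    by (simp add: order_trans[OF _ abs_ge_self])
qed

lemma SqInt_cmult: "f \<in> SqInt M \<Longrightarrow> (\<lambda>x. c * f x) \<in> SqInt M"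
  by (auto simp: SqInt_def power_mult_distrib)

lemma SqInt_add:
  assumes "f \<in> SqInt M" "g \<in> SqInt M"
  shows "(\<lambda>x. f x + g x) \<in> SqInt M"
proof -
  have "integrable M (\<lambda>x. (f x)\<^sup>2 + (g x)\<^sup>2 + 2 * (f x * g x))"
    using assms SqInt_mult_integrable[OF assms] by (simp add: SqInt_integrable_sq)
  then have "integrable M (\<lambda>x. (f x + g x)\<^sup>2)"
    by (simp add: power2_sum mult.assoc)
  then show ?thesis
    using assms by (auto simp: SqInt_def)
qed

lemma SqInt_diff:
  assumes "f \<in> SqInt M" "g \<in> SqInt M"
  shows "(\<lambda>x. f x - g x) \<in> SqInt M"
  using SqInt_add[OF assms(1) SqInt_cmult[OF assms(2), of "-1"]] by simp

lemma nrm_nonneg: "0 \<le> nrm M f"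
  by (simp add: nrm_def)

lemma nrm_sq: "(nrm M f)\<^sup>2 = (LINT x|M. (f x)\<^sup>2)"
  by (simp add: nrm_def)

lemma nrm_cmult: "nrm M (\<lambda>x. c * f x) = \<bar>c\<bar> * nrm M f"
  by (simp add: nrm_def power_mult_distrib real_sqrt_mult)

lemma nrm_minus_commute: "nrm M (\<lambda>x. f x - g x) = nrm M (\<lambda>x. g x - f x)"
  by (simp add: nrm_def power2_commute)

lemma nrm_cong_AE:
  assumes "AE x in M. f x = g x" "f \<in> borel_measurable M" "g \<in> borel_measurable M"
  shows "nrm M f = nrm M g"
proof -
  have "(LINT x|M. (f x)\<^sup>2) = (LINT x|M. (g x)\<^sup>2)"
    using assms by (intro integral_cong_AE) auto
  then show ?thesis
    by (simp add: nrm_def)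
qed

lemma nn_integral_sq:
  assumes "f \<in> SqInt M"
  shows "(\<integral>\<^sup>+x. ennreal ((f x)\<^sup>2) \<partial>M) = ennreal ((nrm M f)\<^sup>2)"
  using assms by (simp add: nrm_sq SqInt_def nn_integral_eq_integral)

lemma SqIntI:
  assumes "f \<in> borel_measurable M" "(\<integral>\<^sup>+x. ennreal ((f x)\<^sup>2) \<partial>M) < \<infinity>"
  shows "f \<in> SqInt M"
proof -
  have "integrable M (\<lambda>x. (f x)\<^sup>2)"
    using assms by (intro integrableI_nonneg) auto
  then show ?thesis
    using assms by (simp add: SqInt_def)
qed

text \<open>The passage from extended nonnegative estimates, which presuppose no integrability, to
  membership in the space and a bound on the real norm.\<close>

lemma SqInt_bound:
  assumes "f \<in> borel_measurable M" "(\<integral>\<^sup>+x. ennreal ((f x)\<^sup>2) \<partial>M) \<le> ennreal (b\<^sup>2)" "0 \<le> b"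
  shows "f \<in> SqInt M" "nrm M f \<le> b"
proof -
  have "(\<integral>\<^sup>+x. ennreal ((f x)\<^sup>2) \<partial>M) < \<infinity>"
    using assms(2) by (rule le_less_trans) simp
  then show "f \<in> SqInt M"
    using assms by (intro SqIntI)
  then have "(nrm M f)\<^sup>2 \<le> b\<^sup>2"
    using assms(2) nn_integral_sq[of f M] by simp
  then show "nrm M f \<le> b"
    using assms(3) by (rule power2_le_imp_le)
qed

lemma Cauchy_Schwarz_SqInt:
  assumes "f \<in> SqInt M" "g \<in> SqInt M"
  shows "\<bar>LINT x|M. f x * g x\<bar> \<le> nrm M f * nrm M g"
proof -
  define A B C where "A = (LINT x|M. (f x)\<^sup>2)" and "B = (LINT x|M. f x * g x)"
    and "C = (LINT x|M. (g x)\<^sup>2)"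
  have quad: "0 \<le> A - 2 * t * B + t\<^sup>2 * C" for t
  proof -
    have "(f x - t * g x)\<^sup>2 = (f x)\<^sup>2 - (2 * t) * (f x * g x) + t\<^sup>2 * (g x)\<^sup>2" for x
      by (simp add: power2_diff power_mult_distrib)
    then have "(LINT x|M. (f x - t * g x)\<^sup>2) = A - 2 * t * B + t\<^sup>2 * C"
      using assms SqInt_mult_integrable[OF assms]
      by (simp add: A_def B_def C_def SqInt_integrable_sq)
    moreover have "0 \<le> (LINT x|M. (f x - t * g x)\<^sup>2)"
      by simp
    ultimately show ?thesis
      by simp
  qed
  have "0 \<le> C"
    by (simp add: C_def)
  have "B\<^sup>2 \<le> A * C"
  proof (cases "C = 0")
    case True
    have "B = 0"
    proof (rule ccontr)
      assume "B \<noteq> 0"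
      \<comment> \<open>With \<open>C = 0\<close> the quadratic is affine in t, and this t makes it
        equal to -1.\<close>
      then show False
        using quad[of "(A + 1) / (2 * B)"] True by simp
    qed
    then show ?thesis
      using True by simp
  next
    case False
    then have "C > 0"
      using \<open>0 \<le> C\<close> by simp
    then show ?thesis
      using quad[of "B / C"] by (simp add: field_simps power2_eq_square)
  qed
  then have "\<bar>B\<bar> \<le> sqrt (A * C)"
    by (rule real_le_rsqrt[of "\<bar>B\<bar>", unfolded power2_abs])
  then show ?thesis
    by (simp add: nrm_def A_def B_def C_def real_sqrt_mult)
qed

lemma nrm_sq_add:
  assumes "f \<in> SqInt M" "g \<in> SqInt M"
  shows "(nrm M (\<lambda>x. f x + g x))\<^sup>2 = (nrm M f)\<^sup>2 + (nrm M g)\<^sup>2 + 2 * (LINT x|M. f x * g x)"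
proof -
  have "(f x + g x)\<^sup>2 = (f x)\<^sup>2 + (g x)\<^sup>2 + 2 * (f x * g x)" for x
    by (simp add: power2_sum)
  then show ?thesis
    using assms SqInt_mult_integrable[OF assms] by (simp add: nrm_sq SqInt_integrable_sq)
qed

lemma nrm_triangle:
  assumes "f \<in> SqInt M" "g \<in> SqInt M"
  shows "nrm M (\<lambda>x. f x + g x) \<le> nrm M f + nrm M g"
proof (rule power2_le_imp_le)
  show "(nrm M (\<lambda>x. f x + g x))\<^sup>2 \<le> (nrm M f + nrm M g)\<^sup>2"
    using Cauchy_Schwarz_SqInt[OF assms] by (simp add: nrm_sq_add[OF assms] power2_sum)
qed (simp add: nrm_nonneg)

lemma nrm_triangle_diff:
  assumes "f \<in> SqInt M" "g \<in> SqInt M" "h \<in> SqInt M"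
  shows "nrm M (\<lambda>x. f x - h x) \<le> nrm M (\<lambda>x. f x - g x) + nrm M (\<lambda>x. g x - h x)"
  using nrm_triangle[OF SqInt_diff[OF assms(1,2)] SqInt_diff[OF assms(2,3)]] by simp

lemma nrm_diff_le:
  assumes "f \<in> SqInt M" "g \<in> SqInt M"
  shows "\<bar>nrm M f - nrm M g\<bar> \<le> nrm M (\<lambda>x. f x - g x)"
  using nrm_triangle[OF SqInt_diff[OF assms] assms(2)]
    nrm_triangle[OF SqInt_diff[OF assms(2,1)] assms(1)] nrm_minus_commute[of M f g]
  by simp

lemma nrm_tendsto:
  assumes "\<And>n. f n \<in> SqInt M" "g \<in> SqInt M" "((\<lambda>n. nrm M (\<lambda>x. f n x - g x)) \<longlongrightarrow> 0) F"
  shows "((\<lambda>n. nrm M (f n)) \<longlongrightarrow> nrm M g) F"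
proof -
  have "((\<lambda>n. nrm M (f n) - nrm M g) \<longlongrightarrow> 0) F"
    using nrm_diff_le[OF assms(1,2)]
    by (intro Lim_null_comparison[OF always_eventually assms(3)]) simp
  then show ?thesis
    by (simp add: LIM_zero_iff)
qed

lemma SqInt_inner_tendsto:
  assumes "\<And>n. f n \<in> SqInt M" "g \<in> SqInt M" "h \<in> SqInt M"
    and "((\<lambda>n. nrm M (\<lambda>x. f n x - g x)) \<longlongrightarrow> 0) F"
  shows "((\<lambda>n. LINT x|M. f n x * h x) \<longlongrightarrow> (LINT x|M. g x * h x)) F"
proof -
  have lim: "((\<lambda>n. nrm M (\<lambda>x. f n x - g x) * nrm M h) \<longlongrightarrow> 0) F"
    using assms(4) by (rule tendsto_mult_left_zero)
  have bound: "norm ((LINT x|M. f n x * h x) - (LINT x|M. g x * h x))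
      \<le> nrm M (\<lambda>x. f n x - g x) * nrm M h" for n
  proof -
    have "(LINT x|M. (f n x - g x) * h x) = (LINT x|M. f n x * h x) - (LINT x|M. g x * h x)"
      unfolding left_diff_distrib
      by (rule Bochner_Integration.integral_diff[OF SqInt_mult_integrable[OF assms(1,3)] SqInt_mult_integrable[OF assms(2,3)]])
    then show ?thesis
      using Cauchy_Schwarz_SqInt[OF SqInt_diff[OF assms(1,2)] assms(3), of n] by simp
  qed
  have "((\<lambda>n. (LINT x|M. f n x * h x) - (LINT x|M. g x * h x)) \<longlongrightarrow> 0) F"
    by (rule Lim_null_comparison[OF always_eventually[OF allI[OF bound]] lim])
  then show ?thesis
    by (rule LIM_zero_cancel)
qed

text \<open>The weights \<open>2 ^ k\<close> make the increments of the subsequence pointwise summable.\<close>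

lemma SqInt_rapid_Cauchy_convergent:
  assumes f: "\<And>k. f k \<in> SqInt M"
    and small: "\<And>k. (nrm M (\<lambda>x. f (Suc k) x - f k x))\<^sup>2 \<le> (1 / 4) ^ k"
  shows "AE x in M. convergent (\<lambda>k. f k x)"
proof -
  have [measurable]: "f k \<in> borel_measurable M" for k
    using f by (rule SqInt_measurable)
  have diff: "(\<lambda>x. f (Suc k) x - f k x) \<in> SqInt M" for k
    by (rule SqInt_diff[OF f f])
  have "(\<integral>\<^sup>+x. (\<Sum>k. ennreal (2 ^ k * (f (Suc k) x - f k x)\<^sup>2)) \<partial>M)
      = (\<Sum>k. \<integral>\<^sup>+x. ennreal (2 ^ k * (f (Suc k) x - f k x)\<^sup>2) \<partial>M)"
    by (intro nn_integral_suminf) measurable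
  also have "\<dots> = (\<Sum>k. ennreal (2 ^ k) * ennreal ((nrm M (\<lambda>x. f (Suc k) x - f k x))\<^sup>2))"
    by (simp add: ennreal_mult nn_integral_cmult nn_integral_sq[OF diff])
  also have "\<dots> \<le> (\<Sum>k. ennreal ((1 / 2) ^ k))"
  proof (intro suminf_le summableI)
    fix k
    have "2 ^ k * (nrm M (\<lambda>x. f (Suc k) x - f k x))\<^sup>2 \<le> 2 ^ k * (1 / 4) ^ k"
      using small by (intro mult_left_mono) auto
    also have "\<dots> = (1 / 2) ^ k"
      by (simp flip: power_mult_distrib)
    finally show "ennreal (2 ^ k) * ennreal ((nrm M (\<lambda>x. f (Suc k) x - f k x))\<^sup>2) \<le> ennreal ((1 / 2) ^ k)"
      by (simp flip: ennreal_mult add: ennreal_leI)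
  qed
  also have "\<dots> = ennreal (\<Sum>k. (1 / 2) ^ k)"
    by (intro suminf_ennreal2) (auto intro: summable_geometric)
  also have "\<dots> < \<infinity>"
    by simp
  finally have "(\<integral>\<^sup>+x. (\<Sum>k. ennreal (2 ^ k * (f (Suc k) x - f k x)\<^sup>2)) \<partial>M) \<noteq> \<infinity>"
    by simp
  then have "AE x in M. (\<Sum>k. ennreal (2 ^ k * (f (Suc k) x - f k x)\<^sup>2)) \<noteq> \<infinity>"
    by (intro nn_integral_PInf_AE) measurable
  then show ?thesis
  proof eventually_elim
    case (elim x)
    have "summable (\<lambda>k. 2 ^ k * (f (Suc k) x - f k x)\<^sup>2)"
      by (rule summable_suminf_not_top) (use elim in auto)
    \<comment> \<open>Only boundedness of the weighted terms is extracted: it makes the increments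
      decay like the powers of sqrt(1/2), hence absolutely summable.\<close>
    then have "Bseq (\<lambda>k. 2 ^ k * (f (Suc k) x - f k x)\<^sup>2)"
      by (intro convergent_imp_Bseq convergentI[OF summable_LIMSEQ_zero])
    then obtain B where B: "B > 0" "\<And>k. norm (2 ^ k * (f (Suc k) x - f k x)\<^sup>2) \<le> B"
      by (auto simp: Bseq_def)
    have "\<bar>f (Suc k) x - f k x\<bar> \<le> sqrt B * sqrt (1 / 2) ^ k" for k
    proof -
      have "(f (Suc k) x - f k x)\<^sup>2 \<le> B * (1 / 2) ^ k"
        using B(2)[of k] by (simp add: field_simps)
      then have "\<bar>f (Suc k) x - f k x\<bar> \<le> sqrt (B * (1 / 2) ^ k)"
        by (intro real_le_rsqrt) simp
      then show ?thesis
        by (simp add: real_sqrt_mult real_sqrt_power)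
    qed
    then have "norm (f (Suc k) x - f k x) \<le> sqrt B * sqrt (1 / 2) ^ k" for k
      by simp
    moreover have "summable (\<lambda>k. sqrt B * sqrt (1 / 2) ^ k)"
      by (rule summable_mult[OF summable_geometric]) simp
    ultimately have "summable (\<lambda>k. f (Suc k) x - f k x)"
      by (rule summable_comparison_test'[where N = 0, rotated])
    then have "convergent (\<lambda>n. \<Sum>k<n. f (Suc k) x - f k x)"
      by (simp add: summable_iff_convergent)
    then have "convergent (\<lambda>n. f n x - f 0 x)"
      by (simp add: sum_lessThan_telescope[of "\<lambda>n. f n x"])
    then have "convergent (\<lambda>n. (f n x - f 0 x) + f 0 x)"
      by (rule convergent_add[OF _ convergent_const])
    then show ?case
      by simp
  qed
qed

text \<open>Riesz-Fischer: a rapidly Cauchy subsequence converges almost everywhere, and Fatou's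
  lemma carries the Cauchy bound over to its pointwise limit.\<close>

lemma SqInt_complete:
  assumes f: "\<And>n. f n \<in> SqInt M"
    and Cauchy: "\<And>e. e > 0 \<Longrightarrow> \<exists>N. \<forall>m\<ge>N. \<forall>n\<ge>N. nrm M (\<lambda>x. f m x - f n x) < e"
  obtains g where "g \<in> SqInt M" "(\<lambda>n. nrm M (\<lambda>x. f n x - g x)) \<longlonglongrightarrow> 0"
proof -
  have [measurable]: "f k \<in> borel_measurable M" for k
    using f by (rule SqInt_measurable)
  have "\<forall>k. \<exists>N. \<forall>m\<ge>N. \<forall>n\<ge>N. nrm M (\<lambda>x. f m x - f n x) < (1 / 2) ^ k"
    by (intro allI Cauchy) simp
  then obtain N where N: "\<And>k m n. m \<ge> N k \<Longrightarrow> n \<ge> N k \<Longrightarrow> nrm M (\<lambda>x. f m x - f n x) < (1 / 2) ^ k"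
    by metis
  \<comment> \<open>Partial sums put both \<open>r k\<close> and \<open>r (Suc k)\<close> beyond
    \<open>N k\<close>, so consecutive members are close; the summand \<open>k\<close> makes the
    indices tend to infinity.\<close>
  define r where "r k = (\<Sum>j\<le>k. N j) + k" for k
  have r: "r k \<ge> N k" "r (Suc k) \<ge> N k" "r k \<ge> k" for k
    using member_le_sum[of k "{..k}" N] by (auto simp: r_def)
  define g where "g x = lim (\<lambda>k. f (r k) x)" for x
  have conv: "AE x in M. convergent (\<lambda>k. f (r k) x)"
  proof (rule SqInt_rapid_Cauchy_convergent)
    fix k
    have "(nrm M (\<lambda>x. f (r (Suc k)) x - f (r k) x))\<^sup>2 \<le> ((1 / 2) ^ k)\<^sup>2"
      using N[OF r(2,1)] by (intro power_mono) (auto simp: nrm_nonneg less_imp_le)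
    also have "((1 / 2) ^ k)\<^sup>2 = (1 / 4 :: real) ^ k"
      by (simp add: power2_eq_square flip: power_mult_distrib)
    finally show "(nrm M (\<lambda>x. f (r (Suc k)) x - f (r k) x))\<^sup>2 \<le> (1 / 4) ^ k" .
  qed (rule f)
  have [measurable]: "g \<in> borel_measurable M"
    unfolding g_def by measurable
  have bound: "(\<integral>\<^sup>+x. ennreal ((f n x - g x)\<^sup>2) \<partial>M) \<le> ennreal (e\<^sup>2)"
    if e: "e > 0" and m: "\<And>k. k \<ge> m \<Longrightarrow> nrm M (\<lambda>x. f n x - f k x) \<le> e" for n e m
  proof -
    have "(\<integral>\<^sup>+x. ennreal ((f n x - g x)\<^sup>2) \<partial>M)
        = (\<integral>\<^sup>+x. liminf (\<lambda>k. ennreal ((f n x - f (r k) x)\<^sup>2)) \<partial>M)"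
    proof (rule nn_integral_cong_AE, use conv in eventually_elim)
      case (elim x)
      then have "(\<lambda>k. f (r k) x) \<longlonglongrightarrow> g x"
        by (simp add: g_def convergent_LIMSEQ_iff)
      then have "(\<lambda>k. ennreal ((f n x - f (r k) x)\<^sup>2)) \<longlonglongrightarrow> ennreal ((f n x - g x)\<^sup>2)"
        by (intro tendsto_intros)
      from lim_imp_Liminf[OF _ this] show ?case
        by simp
    qed
    also have "\<dots> \<le> liminf (\<lambda>k. \<integral>\<^sup>+x. ennreal ((f n x - f (r k) x)\<^sup>2) \<partial>M)"
      by (intro nn_integral_liminf) measurable
    also have "\<dots> \<le> limsup (\<lambda>k. \<integral>\<^sup>+x. ennreal ((f n x - f (r k) x)\<^sup>2) \<partial>M)"
      by (simp add: Liminf_le_Limsup)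
    also have "\<dots> \<le> ennreal (e\<^sup>2)"
    proof (rule Limsup_bounded, rule eventually_sequentiallyI)
      fix k assume "k \<ge> m"
      then have "r k \<ge> m"
        using r(3)[of k] by linarith
      then have "(nrm M (\<lambda>x. f n x - f (r k) x))\<^sup>2 \<le> e\<^sup>2"
        using m by (intro power_mono) (auto simp: nrm_nonneg)
      then show "(\<integral>\<^sup>+x. ennreal ((f n x - f (r k) x)\<^sup>2) \<partial>M) \<le> ennreal (e\<^sup>2)"
        by (simp add: nn_integral_sq[OF SqInt_diff[OF f f]])
    qed
    finally show ?thesis .
  qed
  have close: "\<exists>N. \<forall>n\<ge>N. (\<lambda>x. f n x - g x) \<in> SqInt M \<and> nrm M (\<lambda>x. f n x - g x) \<le> e"
    if e: "e > 0" for e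
  proof -
    obtain N where N: "\<forall>m\<ge>N. \<forall>n\<ge>N. nrm M (\<lambda>x. f m x - f n x) < e"
      using Cauchy[OF e] by blast
    have "(\<integral>\<^sup>+x. ennreal ((f n x - g x)\<^sup>2) \<partial>M) \<le> ennreal (e\<^sup>2)" if "n \<ge> N" for n
      by (rule bound[OF e, of N]) (use N that in \<open>auto intro: less_imp_le\<close>)
    then have "(\<lambda>x. f n x - g x) \<in> SqInt M \<and> nrm M (\<lambda>x. f n x - g x) \<le> e" if "n \<ge> N" for n
      using that e by (intro conjI SqInt_bound) auto
    then show ?thesis
      by blast
  qed
  obtain n where "(\<lambda>x. f n x - g x) \<in> SqInt M"
    using close[of 1] by auto
  then have "g \<in> SqInt M"
    using SqInt_diff[OF f, of "\<lambda>x. f n x - g x" n] by simp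
  moreover have "(\<lambda>n. nrm M (\<lambda>x. f n x - g x)) \<longlonglongrightarrow> 0"
  proof (rule LIMSEQ_I)
    fix e :: real assume "e > 0"
    then obtain N where "\<forall>n\<ge>N. nrm M (\<lambda>x. f n x - g x) \<le> e / 2"
      using close[of "e / 2"] by auto
    then show "\<exists>N. \<forall>n\<ge>N. norm (nrm M (\<lambda>x. f n x - g x) - 0) < e"
      using \<open>e > 0\<close> by (intro exI[of _ N]) (auto simp: nrm_nonneg intro: le_less_trans)
  qed
  ultimately show thesis
    by (rule that)
qed

subsection \<open>Test functions\<close>

text \<open>Trades the closure of the support for an arbitrary compact set off which the function
  vanishes, which is easier to exhibit for sums, products and convolutions.\<close>

lemma test_functions_iff:
  "\<phi> \<in> test_functions \<Omega> \<longleftrightarrow> smooth \<phi> \<and> (\<exists>K. compact K \<and> K \<subseteq> \<Omega> \<and> (\<forall>x. x \<notin> K \<longrightarrow> \<phi> x = 0))"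
proof
  assume "\<phi> \<in> test_functions \<Omega>"
  then show "smooth \<phi> \<and> (\<exists>K. compact K \<and> K \<subseteq> \<Omega> \<and> (\<forall>x. x \<notin> K \<longrightarrow> \<phi> x = 0))"
    using closure_subset[of "{x. \<phi> x \<noteq> 0}"]
    by (auto simp: test_functions_def smooth_def intro!: exI[of _ "closure {x. \<phi> x \<noteq> 0}"])
next
  assume "smooth \<phi> \<and> (\<exists>K. compact K \<and> K \<subseteq> \<Omega> \<and> (\<forall>x. x \<notin> K \<longrightarrow> \<phi> x = 0))"
  then obtain K where "smooth \<phi>" and K: "compact K" "K \<subseteq> \<Omega>" "\<And>x. x \<notin> K \<Longrightarrow> \<phi> x = 0"
    by blast
  have "closure {x. \<phi> x \<noteq> 0} \<subseteq> K"
    using K by (intro closure_minimal) (auto intro: compact_imp_closed)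
  moreover from this have "compact (closure {x. \<phi> x \<noteq> 0})"
    using K(1) by (metis closed_closure compact_Int_closed inf.absorb2)
  ultimately show "\<phi> \<in> test_functions \<Omega>"
    using \<open>smooth \<phi>\<close> K(2) by (auto simp: test_functions_def smooth_def)
qed

lemma test_functionsE:
  assumes "\<phi> \<in> test_functions \<Omega>"
  obtains K where "compact K" "K \<subseteq> \<Omega>" "\<And>x. x \<notin> K \<Longrightarrow> \<phi> x = 0"
  using assms unfolding test_functions_iff by blast

lemma test_functionsI:
  "smooth \<phi> \<Longrightarrow> compact K \<Longrightarrow> K \<subseteq> \<Omega> \<Longrightarrow> (\<And>x. x \<notin> K \<Longrightarrow> \<phi> x = 0) \<Longrightarrow> \<phi> \<in> test_functions \<Omega>"
  unfolding test_functions_iff by blast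

lemma test_functions_smooth: "\<phi> \<in> test_functions \<Omega> \<Longrightarrow> smooth \<phi>"
  unfolding test_functions_iff by blast

lemma test_functions_eq_0: "\<phi> \<in> test_functions \<Omega> \<Longrightarrow> x \<notin> \<Omega> \<Longrightarrow> \<phi> x = 0"
  unfolding test_functions_iff by blast

lemma test_functions_mono: "\<phi> \<in> test_functions \<Omega> \<Longrightarrow> \<Omega> \<subseteq> \<Omega>' \<Longrightarrow> \<phi> \<in> test_functions \<Omega>'"
  unfolding test_functions_iff by blast

lemma test_functions_differentiable: "\<phi> \<in> test_functions \<Omega> \<Longrightarrow> \<phi> differentiable at x"
  by (rule smooth_differentiable[OF test_functions_smooth])

lemma test_functions_measurable [measurable_dest]: "\<phi> \<in> test_functions \<Omega> \<Longrightarrow> \<phi> \<in> borel_measurable borel"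
  by (rule smooth_borel_measurable[OF test_functions_smooth])

lemma test_functions_mult_smooth:
  assumes "\<phi> \<in> test_functions \<Omega>" "smooth \<eta>"
  shows "(\<lambda>x. \<eta> x * \<phi> x) \<in> test_functions \<Omega>"
proof -
  obtain K where "compact K" "K \<subseteq> \<Omega>" "\<And>x. x \<notin> K \<Longrightarrow> \<phi> x = 0"
    using test_functionsE[OF assms(1)] by blast
  then show ?thesis
    by (intro test_functionsI[OF smooth_mult[OF assms(2) test_functions_smooth[OF assms(1)]]]) auto
qed

lemma test_functions_cmult: "\<phi> \<in> test_functions \<Omega> \<Longrightarrow> (\<lambda>x. c * \<phi> x) \<in> test_functions \<Omega>"
  by (rule test_functions_mult_smooth[OF _ smooth_const])

lemma test_functions_add:
  assumes "\<phi> \<in> test_functions \<Omega>" "\<psi> \<in> test_functions \<Omega>"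
  shows "(\<lambda>x. \<phi> x + \<psi> x) \<in> test_functions \<Omega>"
proof -
  obtain K where "compact K" "K \<subseteq> \<Omega>" "\<And>x. x \<notin> K \<Longrightarrow> \<phi> x = 0"
    using test_functionsE[OF assms(1)] by blast
  moreover obtain L where "compact L" "L \<subseteq> \<Omega>" "\<And>x. x \<notin> L \<Longrightarrow> \<psi> x = 0"
    using test_functionsE[OF assms(2)] by blast
  ultimately show ?thesis
    by (intro test_functionsI[OF smooth_add[OF assms[THEN test_functions_smooth]], of "K \<union> L"]) auto
qed

lemma test_functions_zero: "(\<lambda>x. 0) \<in> test_functions \<Omega>"
  by (rule test_functionsI[OF smooth_const, of "{}"]) auto

lemma partial_deriv_const: "partial_deriv i (\<lambda>x::real ^ 'n. c) x = 0"
  using partial_deriv_eq[OF has_derivative_const] .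

lemma partial_deriv_cmult:
  "f differentiable at x \<Longrightarrow> partial_deriv i (\<lambda>x. c * f x) x = c * partial_deriv i f x"
  by (subst partial_deriv_mult) (simp_all add: partial_deriv_const)

lemma frechet_derivative_worksD:
  "f differentiable at x \<Longrightarrow> (f has_derivative frechet_derivative f (at x)) (at x)"
  by (simp add: frechet_derivative_works)

lemma partial_deriv_add:
  assumes "f differentiable at x" "g differentiable at x"
  shows "partial_deriv i (\<lambda>x. f x + g x) x = partial_deriv i f x + partial_deriv i g x"
  by (subst partial_deriv_eq[OF has_derivative_add[OF assms[THEN frechet_derivative_worksD]]])
    (simp add: partial_deriv_def)

lemma partial_deriv_diff:
  assumes "f differentiable at x" "g differentiable at x"
  shows "partial_deriv i (\<lambda>x. f x - g x) x = partial_deriv i f x - partial_deriv i g x"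
  by (subst partial_deriv_eq[OF has_derivative_diff[OF assms[THEN frechet_derivative_worksD]]])
    (simp add: partial_deriv_def)

lemma partial_deriv_eq_0_outside:
  assumes "closed K" "\<And>x. x \<notin> K \<Longrightarrow> \<phi> x = 0" "x \<notin> K"
  shows "partial_deriv i \<phi> x = 0"
proof -
  have "(\<phi> has_derivative (\<lambda>h. 0)) (at x)"
    by (rule has_derivative_transform_within_open[OF has_derivative_const[of 0], where s = "- K"])
      (use assms in auto)
  then show ?thesis
    by (rule partial_deriv_eq)
qed

lemma test_functions_partial_deriv:
  assumes "\<phi> \<in> test_functions \<Omega>"
  shows "partial_deriv i \<phi> \<in> test_functions \<Omega>"
proof -
  obtain K where "compact K" "K \<subseteq> \<Omega>" "\<And>x. x \<notin> K \<Longrightarrow> \<phi> x = 0"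
    using test_functionsE[OF assms] by blast
  then show ?thesis
    by (intro test_functionsI[OF smooth_partial_deriv[OF test_functions_smooth[OF assms]]])
      (auto intro: partial_deriv_eq_0_outside compact_imp_closed)
qed

lemma cutoff_test_function:
  assumes "r > 0" "cball c (2 * r) \<subseteq> \<Omega>"
  shows "cutoff c r \<in> test_functions \<Omega>"
  using assms by (intro test_functionsI[OF smooth_cutoff compact_cball]) (auto simp: cutoff_eq_0 dist_commute)

section \<open>Boundedness, integrability and Lipschitz continuity of test functions\<close>

lemma test_functions_bounded:
  assumes "\<phi> \<in> test_functions \<Omega>"
  obtains B where "B \<ge> 0" "\<And>x. \<bar>\<phi> x\<bar> \<le> B"
proof -
  obtain K where K: "compact K" "K \<subseteq> \<Omega>" "\<And>x. x \<notin> K \<Longrightarrow> \<phi> x = 0"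
    using test_functionsE[OF assms] by blast
  have "compact (\<phi> ` K)"
    using K(1) by (intro compact_continuous_image smooth_continuous_on[OF test_functions_smooth[OF assms]])
  then obtain B where "\<And>x. x \<in> K \<Longrightarrow> \<bar>\<phi> x\<bar> \<le> B"
    unfolding compact_eq_bounded_closed bounded_iff by fastforce
  then have "\<bar>\<phi> x\<bar> \<le> max 0 B" for x
    using K(3)[of x] by (cases "x \<in> K") (auto simp: le_max_iff_disj)
  then show thesis
    by (intro that[of "max 0 B"]) auto
qed

lemma test_functions_integrable:
  assumes "\<phi> \<in> test_functions \<Omega>"
  shows "integrable lborel \<phi>"
proof -
  obtain K where K: "compact K" "K \<subseteq> \<Omega>" "\<And>x. x \<notin> K \<Longrightarrow> \<phi> x = 0"
    using test_functionsE[OF assms] by blast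
  have "integrable lborel (\<lambda>x. indicator K x *\<^sub>R \<phi> x)"
    using K(1) by (intro borel_integrable_compact smooth_continuous_on[OF test_functions_smooth[OF assms]])
  moreover have "(\<lambda>x. indicator K x *\<^sub>R \<phi> x) = \<phi>"
    using K(3) by (fastforce simp: indicator_def)
  ultimately show ?thesis
    by simp
qed

lemma test_functions_SqInt:
  assumes "\<phi> \<in> test_functions \<Omega>"
  shows "\<phi> \<in> SqInt lborel"
  using test_functions_integrable[OF test_functions_mult_smooth[OF assms test_functions_smooth[OF assms]]]
    test_functions_measurable[OF assms]
  by (simp add: SqInt_def power2_eq_square)

lemma frechet_derivative_eq_sum:
  assumes "f differentiable at x"
  shows "frechet_derivative f (at x) h = (\<Sum>i\<in>UNIV. h $ i * partial_deriv i f x)"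
proof -
  have lin: "linear (frechet_derivative f (at x))"
    using assms by (rule linear_frechet_derivative)
  have "frechet_derivative f (at x) h = frechet_derivative f (at x) (\<Sum>i\<in>UNIV. h $ i *\<^sub>R axis i 1)"
    using basis_expansion[of h] by (simp add: scalar_mult_eq_scaleR)
  then show ?thesis
    by (simp add: linear_sum[OF lin] linear_cmul[OF lin] partial_deriv_def)
qed

text \<open>The partial derivatives are test functions and hence bounded; their bounds add up to a
  bound for the operator norm of the derivative, and the mean value inequality applies.\<close>

lemma test_functions_Lipschitz:
  assumes "\<phi> \<in> test_functions \<Omega>"
  obtains L where "L \<ge> 0" "\<And>x y. \<bar>\<phi> x - \<phi> y\<bar> \<le> L * norm (x - y)"
proof -
  have "\<exists>B. B \<ge> 0 \<and> (\<forall>x. \<bar>partial_deriv i \<phi> x\<bar> \<le> B)" for i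
    by (metis test_functions_bounded test_functions_partial_deriv[OF assms])
  then obtain B where B: "\<And>i. B i \<ge> 0" "\<And>i x. \<bar>partial_deriv i \<phi> x\<bar> \<le> B i"
    by metis
  have "\<bar>\<phi> x - \<phi> y\<bar> \<le> (\<Sum>i\<in>UNIV. B i) * norm (x - y)" for x y
  proof -
    have "norm (\<phi> x - \<phi> y) \<le> (\<Sum>i\<in>UNIV. B i) * norm (x - y)"
    proof (rule differentiable_bound[OF convex_UNIV])
      fix z
      show "(\<phi> has_derivative frechet_derivative \<phi> (at z)) (at z)"
        by (rule frechet_derivative_worksD[OF test_functions_differentiable[OF assms]])
      show "onorm (frechet_derivative \<phi> (at z)) \<le> (\<Sum>i\<in>UNIV. B i)"
      proof (rule onorm_bound)
        show "0 \<le> (\<Sum>i\<in>UNIV. B i)"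
          by (intro sum_nonneg B)
        fix h
        have "\<bar>h $ i * partial_deriv i \<phi> z\<bar> \<le> B i * norm h" for i
          using mult_mono[OF component_le_norm_cart B(2) norm_ge_zero abs_ge_zero, of h i i z]
          by (simp add: abs_mult mult.commute)
        then show "norm (frechet_derivative \<phi> (at z) h) \<le> (\<Sum>i\<in>UNIV. B i) * norm h"
          unfolding frechet_derivative_eq_sum[OF test_functions_differentiable[OF assms]] sum_distrib_right real_norm_def
          by (intro order_trans[OF sum_abs] sum_mono)
      qed
    qed auto
    then show ?thesis
      by simp
  qed
  then show thesis
    by (intro that[of "\<Sum>i\<in>UNIV. B i"] sum_nonneg B)
qed

section \<open>Smooth Urysohn functions\<close>

lemma smooth_prod:
  assumes "\<And>i. i \<in> I \<Longrightarrow> smooth (f i)"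
  shows "smooth (\<lambda>x. \<Prod>i\<in>I. f i x)"
  using assms
proof (induction I rule: infinite_finite_induct)
  case (insert i I)
  have "smooth (\<lambda>x. f i x * (\<Prod>i\<in>I. f i x))"
    by (rule smooth_mult) (use insert in auto)
  then show ?case
    using insert.hyps by simp
qed (simp_all add: smooth_const)

text \<open>\<open>K\<close> is covered by finitely many balls whose concentric doubles lie in
  \<open>U\<close>. One minus the product of the complementary cutoffs is 1 as soon as one cutoff is
  1 and is 0 where all of them are 0.\<close>

lemma smooth_Urysohn:
  fixes K :: "(real ^ 'n) set"
  assumes "compact K" "open U" "K \<subseteq> U"
  obtains \<eta> where "\<eta> \<in> test_functions U" "\<And>x. 0 \<le> \<eta> x" "\<And>x. \<eta> x \<le> 1" "\<And>x. x \<in> K \<Longrightarrow> \<eta> x = 1"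
proof -
  have "\<forall>x\<in>K. \<exists>r>0. cball x (2 * r) \<subseteq> U"
  proof
    fix x assume "x \<in> K"
    then obtain e where "e > 0" "cball x e \<subseteq> U"
      using assms open_contains_cball by blast
    then show "\<exists>r>0. cball x (2 * r) \<subseteq> U"
      by (intro exI[of _ "e / 2"]) auto
  qed
  then obtain r where r: "\<And>x. x \<in> K \<Longrightarrow> r x > 0" "\<And>x. x \<in> K \<Longrightarrow> cball x (2 * r x) \<subseteq> U"
    by metis
  obtain F where F: "F \<subseteq> K" "finite F" "K \<subseteq> (\<Union>x\<in>F. ball x (r x))"
    by (rule compactE_image[OF assms(1), of K "\<lambda>x. ball x (r x)"]) (use r(1) in auto)
  define \<eta> where "\<eta> x = 1 - (\<Prod>c\<in>F. 1 - cutoff c (r c) x)" for x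
  have le1: "cutoff c (r c) x \<le> 1" if "c \<in> F" for c x
    using that F(1) r(1) by (intro cutoff_le_1) auto
  have prod01: "0 \<le> (\<Prod>c\<in>F. 1 - cutoff c (r c) x)" "(\<Prod>c\<in>F. 1 - cutoff c (r c) x) \<le> 1" for x
    using le1 by (auto intro!: prod_nonneg prod_le_1 simp: cutoff_nonneg)
  show thesis
  proof
    have "smooth \<eta>"
      unfolding \<eta>_def
      by (rule smooth_diff[OF smooth_const smooth_prod], rule smooth_diff[OF smooth_const smooth_cutoff])
        (use F(1) r(1) in auto)
    then show "\<eta> \<in> test_functions U"
    proof (rule test_functionsI)
      show "compact (\<Union>c\<in>F. cball c (2 * r c))"
        using F(2) by (intro compact_UN) auto
      show "(\<Union>c\<in>F. cball c (2 * r c)) \<subseteq> U"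
        using F(1) r(2) by blast
      fix x assume x: "x \<notin> (\<Union>c\<in>F. cball c (2 * r c))"
      have "cutoff c (r c) x = 0" if "c \<in> F" for c
        using that x F(1) r(1) by (intro cutoff_eq_0) (auto simp: dist_commute)
      then show "\<eta> x = 0"
        by (simp add: \<eta>_def)
    qed
    show "0 \<le> \<eta> x" "\<eta> x \<le> 1" for x
      using prod01[of x] by (simp_all add: \<eta>_def)
    fix x assume "x \<in> K"
    then obtain c where c: "c \<in> F" "dist x c < r c"
      using F(3) by (auto simp: dist_commute)
    then have "1 - cutoff c (r c) x = 0"
      using F(1) r(1) by (subst cutoff_eq_1) auto
    then have "(\<Prod>c\<in>F. 1 - cutoff c (r c) x) = 0"
      using c(1) F(2) by (intro prod_zero) auto
    then show "\<eta> x = 1"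
      by (simp add: \<eta>_def)
  qed
qed

subsection \<open>Integration by parts and weak gradients\<close>

lemma nn_integral_translate:
  fixes f :: "'a::euclidean_space \<Rightarrow> ennreal"
  assumes "f \<in> borel_measurable borel"
  shows "(\<integral>\<^sup>+x. f (x + c) \<partial>lborel) = (\<integral>\<^sup>+x. f x \<partial>lborel)"
proof -
  have "(\<integral>\<^sup>+x. f x \<partial>lborel) = (\<integral>\<^sup>+x. f x \<partial>distr lborel borel ((+) c))"
    by (simp add: lborel_distr_plus)
  also have "\<dots> = (\<integral>\<^sup>+x. f (c + x) \<partial>lborel)"
    using assms by (subst nn_integral_distr) auto
  finally show ?thesis
    by (simp add: add.commute)
qed

lemma integral_translate:
  fixes f :: "'a::euclidean_space \<Rightarrow> real"
  assumes "f \<in> borel_measurable borel"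
  shows "(LINT x|lborel. f (x + c)) = (LINT x|lborel. f x)"
proof -
  have "(LINT x|lborel. f x) = (LINT x|distr lborel borel ((+) c). f x)"
    by (simp add: lborel_distr_plus)
  also have "\<dots> = (LINT x|lborel. f (c + x))"
    using assms by (subst integral_distr) auto
  finally show ?thesis
    by (simp add: add.commute)
qed

text \<open>Difference quotients have integral 0 by translation invariance, and dominated
  convergence passes this to the derivative. No iterated integrals along coordinate lines are
  needed.\<close>

lemma integral_partial_deriv_eq_0:
  assumes \<phi>: "\<phi> \<in> test_functions \<Omega>"
  shows "(LINT x|lborel. partial_deriv i \<phi> x) = 0"
proof -
  obtain L where L: "L \<ge> 0" "\<And>x y. \<bar>\<phi> x - \<phi> y\<bar> \<le> L * norm (x - y)"
    using test_functions_Lipschitz[OF \<phi>] by blast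
  obtain K where K: "compact K" "K \<subseteq> \<Omega>" "\<And>x. x \<notin> K \<Longrightarrow> \<phi> x = 0"
    using test_functionsE[OF \<phi>] by blast
  obtain R where R: "\<And>x. x \<in> K \<Longrightarrow> norm x \<le> R"
    using compact_imp_bounded[OF K(1)] unfolding bounded_iff by blast
  define t where "t n = inverse (real (Suc n))" for n
  have t: "0 < t n" "t n \<le> 1" for n
    by (simp_all add: t_def field_simps)
  have t0: "t \<longlonglongrightarrow> 0"
    unfolding t_def by (rule LIMSEQ_inverse_real_of_nat)
  define q where "q n x = (\<phi> (x + t n *\<^sub>R axis i 1) - \<phi> x) / t n" for n x
  have [measurable]: "\<phi> \<in> borel_measurable borel"
    using \<phi> by (rule test_functions_measurable)
  have int\<phi>: "integrable lborel \<phi>"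
    by (rule test_functions_integrable[OF \<phi>])
  have q0: "(LINT x|lborel. q n x) = 0" for n
  proof -
    have "integrable lborel (\<lambda>x. \<phi> (c + x))" for c
      using int\<phi> lborel_distr_plus[of c] integrable_distr_eq[of "(+) c" lborel borel \<phi>] by simp
    moreover have "(\<lambda>x. \<phi> (x + c)) = (\<lambda>x. \<phi> (c + x))" for c
      by (simp add: add.commute)
    ultimately have "integrable lborel (\<lambda>x. \<phi> (x + c))" for c
      by simp
    then show ?thesis
      using int\<phi> integral_translate[of \<phi>] by (simp add: q_def)
  qed
  have "(\<lambda>n. LINT x|lborel. q n x) \<longlonglongrightarrow> (LINT x|lborel. partial_deriv i \<phi> x)"
  proof (rule integral_dominated_convergence)
    show "partial_deriv i \<phi> \<in> borel_measurable lborel"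
      using test_functions_measurable[OF test_functions_partial_deriv[OF \<phi>]] by simp
    show "q n \<in> borel_measurable lborel" for n
      unfolding q_def by measurable
    \<comment> \<open>The Lipschitz constant bounds the quotients, and steps of length at most 1
      keep their supports in the ball of radius \<open>R + 1\<close>.\<close>
    show "integrable lborel (\<lambda>x. indicator (cball 0 (R + 1)) x *\<^sub>R L)"
      by (intro borel_integrable_compact) auto
    show "AE x in lborel. (\<lambda>n. q n x) \<longlonglongrightarrow> partial_deriv i \<phi> x"
    proof (rule AE_I2)
      fix x
      have "((\<lambda>s. \<phi> (x + s *\<^sub>R axis i 1)) has_derivative
          (\<lambda>s. frechet_derivative \<phi> (at (x + 0 *\<^sub>R axis i 1)) (s *\<^sub>R axis i 1))) (at 0)"
        by (rule has_derivative_compose[where f = "\<lambda>s. x + s *\<^sub>R axis i 1" and s = UNIV and g = \<phi>])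
          (auto intro!: derivative_eq_intros frechet_derivative_worksD test_functions_differentiable[OF \<phi>])
      moreover have "frechet_derivative \<phi> (at x) (s *\<^sub>R axis i 1) = s * partial_deriv i \<phi> x" for s
        using linear_cmul[OF linear_frechet_derivative[OF test_functions_differentiable[OF \<phi>, of x]]]
        by (simp add: partial_deriv_def)
      ultimately have "((\<lambda>s. \<phi> (x + s *\<^sub>R axis i 1)) has_real_derivative partial_deriv i \<phi> x) (at 0)"
        by (simp add: has_field_derivative_def mult_commute_abs)
      then have "((\<lambda>h. (\<phi> (x + h *\<^sub>R axis i 1) - \<phi> x) / h) \<longlongrightarrow> partial_deriv i \<phi> x) (at 0)"
        by (simp add: DERIV_def)
      then have "(\<lambda>n. (\<phi> (x + t n *\<^sub>R axis i 1) - \<phi> x) / t n) \<longlonglongrightarrow> partial_deriv i \<phi> x"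
        by (rule filterlim_compose) (use t t0 in \<open>auto simp: filterlim_at eventually_sequentially less_imp_neq[symmetric]\<close>)
      then show "(\<lambda>n. q n x) \<longlonglongrightarrow> partial_deriv i \<phi> x"
        by (simp add: q_def)
    qed
    show "AE x in lborel. norm (q n x) \<le> indicator (cball 0 (R + 1)) x *\<^sub>R L" for n
    proof (rule AE_I2)
      fix x :: "real ^ 'a"
      show "norm (q n x) \<le> indicator (cball 0 (R + 1)) x *\<^sub>R L"
      proof (cases "norm x \<le> R + 1")
        case True
        have "\<bar>\<phi> (x + t n *\<^sub>R axis i 1) - \<phi> x\<bar> \<le> L * t n"
          using L(2)[of "x + t n *\<^sub>R axis i 1" x] t[of n] by simp
        then show ?thesis
          using True t[of n] by (simp add: q_def field_simps)
      next
        case False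
        have "norm (x + t n *\<^sub>R axis i 1) \<ge> norm x - t n"
          using norm_diff_ineq[of x "t n *\<^sub>R axis i 1"] t[of n] by simp
        then have "\<phi> (x + t n *\<^sub>R axis i 1) = 0" "\<phi> x = 0"
          using False t[of n] R[of x] R[of "x + t n *\<^sub>R axis i 1"] K(3) by force+
        then show ?thesis
          using L(1) by (simp add: q_def)
      qed
    qed
  qed
  then show ?thesis
    unfolding q0 by (simp add: LIMSEQ_const_iff)
qed

lemma integral_by_parts_test_functions:
  assumes "\<phi> \<in> test_functions \<Omega>" "\<psi> \<in> test_functions \<Omega>'"
  shows "(LINT x|lborel. \<phi> x * partial_deriv i \<psi> x) = - (LINT x|lborel. partial_deriv i \<phi> x * \<psi> x)"
proof -
  have "partial_deriv i (\<lambda>x. \<phi> x * \<psi> x) x = \<phi> x * partial_deriv i \<psi> x + partial_deriv i \<phi> x * \<psi> x" for x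
    by (rule partial_deriv_mult) (rule test_functions_differentiable assms)+
  moreover have "(\<lambda>x. \<phi> x * \<psi> x) \<in> test_functions \<Omega>'"
    by (rule test_functions_mult_smooth[OF assms(2) test_functions_smooth[OF assms(1)]])
  from integral_partial_deriv_eq_0[OF this]
  have "(LINT x|lborel. partial_deriv i (\<lambda>x. \<phi> x * \<psi> x) x) = 0" .
  moreover have "integrable lborel (\<lambda>x. \<phi> x * partial_deriv i \<psi> x)" "integrable lborel (\<lambda>x. partial_deriv i \<phi> x * \<psi> x)"
    by (rule SqInt_mult_integrable; rule test_functions_SqInt, rule assms test_functions_partial_deriv[OF assms(1)]
        test_functions_partial_deriv[OF assms(2)])+
  ultimately show ?thesis
    by simp
qed

section \<open>Comparison of Lebesgue measure on the domain with \<open>lborel\<close> on the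
  space\<close>

lemma L2_eq_SqInt: "L2 \<Omega> = SqInt (lebesgue_on \<Omega>)"
  by (simp add: L2_def SqInt_def)

lemma l2_norm_eq_nrm: "l2_norm \<Omega> = nrm (lebesgue_on \<Omega>)"
  by (simp add: l2_norm_def nrm_def fun_eq_iff)

lemma integral_lebesgue_on_eq_lborel:
  fixes f :: "'a::euclidean_space \<Rightarrow> real"
  assumes "f \<in> borel_measurable borel" "\<Omega> \<in> sets borel" "\<And>x. x \<notin> \<Omega> \<Longrightarrow> f x = 0"
  shows "(LINT x|lebesgue_on \<Omega>. f x) = (LINT x|lborel. f x)"
proof -
  have "(LINT x|lebesgue_on \<Omega>. f x) = (LINT x|lebesgue. indicator \<Omega> x *\<^sub>R f x)"
    using assms(2) by (intro integral_restrict_space) auto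
  also have "(\<lambda>x. indicator \<Omega> x *\<^sub>R f x) = f"
    using assms(3) by (fastforce simp: indicator_def)
  finally show ?thesis
    using assms(1) by (simp add: integral_completion)
qed

lemma integrable_lebesgue_on_iff_lborel:
  fixes f :: "'a::euclidean_space \<Rightarrow> real"
  assumes "f \<in> borel_measurable borel" "\<Omega> \<in> sets borel" "\<And>x. x \<notin> \<Omega> \<Longrightarrow> f x = 0"
  shows "integrable (lebesgue_on \<Omega>) f \<longleftrightarrow> integrable lborel f"
proof -
  have eq: "(\<lambda>x. indicator \<Omega> x *\<^sub>R f x) = f"
    using assms(3) by (fastforce simp: indicator_def)
  have "integrable (lebesgue_on \<Omega>) f \<longleftrightarrow> integrable lebesgue (\<lambda>x. indicator \<Omega> x *\<^sub>R f x)"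
    using assms(2) by (intro integrable_restrict_space) auto
  then show ?thesis
    using assms(1) unfolding eq by (simp add: integrable_completion)
qed

lemma borel_measurable_lebesgue_on:
  "f \<in> borel_measurable borel \<Longrightarrow> f \<in> borel_measurable (lebesgue_on \<Omega>)"
  by (rule measurable_restrict_space1[OF measurable_completion]) simp

lemma L2_iff_SqInt_lborel:
  assumes "f \<in> borel_measurable borel" "\<Omega> \<in> sets borel" "\<And>x. x \<notin> \<Omega> \<Longrightarrow> f x = 0"
  shows "f \<in> L2 \<Omega> \<longleftrightarrow> f \<in> SqInt lborel"
  using assms borel_measurable_lebesgue_on[OF assms(1)] integrable_lebesgue_on_iff_lborel[of "\<lambda>x. (f x)\<^sup>2" \<Omega>]
  by (simp add: L2_eq_SqInt SqInt_def)

lemma nrm_lebesgue_on_eq_lborel: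
  assumes "f \<in> borel_measurable borel" "\<Omega> \<in> sets borel" "\<And>x. x \<notin> \<Omega> \<Longrightarrow> f x = 0"
  shows "nrm (lebesgue_on \<Omega>) f = nrm lborel f"
  using assms integral_lebesgue_on_eq_lborel[of "\<lambda>x. (f x)\<^sup>2" \<Omega>] by (simp add: nrm_def)

lemma SqInt_lborel_restrict:
  assumes f: "f \<in> SqInt lborel" and \<Omega>: "\<Omega> \<in> sets borel"
  shows "f \<in> L2 \<Omega>" "nrm (lebesgue_on \<Omega>) f \<le> nrm lborel f"
proof -
  have [measurable]: "f \<in> borel_measurable borel"
    using SqInt_measurable[OF f] by simp
  define g where "g x = indicator \<Omega> x * f x" for x
  have [measurable]: "g \<in> borel_measurable borel"
    using \<Omega> unfolding g_def by measurable
  have "(\<integral>\<^sup>+x. ennreal ((g x)\<^sup>2) \<partial>lborel) \<le> (\<integral>\<^sup>+x. ennreal ((f x)\<^sup>2) \<partial>lborel)"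
    by (intro nn_integral_mono) (auto simp: g_def indicator_def)
  then have g: "g \<in> SqInt lborel" "nrm lborel g \<le> nrm lborel f"
    using SqInt_bound[of g lborel "nrm lborel f"] by (simp_all add: nn_integral_sq[OF f] nrm_nonneg)
  have g0: "x \<notin> \<Omega> \<Longrightarrow> g x = 0" and gf: "x \<in> \<Omega> \<Longrightarrow> g x = f x" for x
    by (simp_all add: g_def)
  have "g \<in> L2 \<Omega>"
    using L2_iff_SqInt_lborel[OF _ \<Omega> g0] g(1) by simp
  then have "integrable (lebesgue_on \<Omega>) (\<lambda>x. (g x)\<^sup>2)"
    by (simp add: L2_def)
  moreover have "integrable (lebesgue_on \<Omega>) (\<lambda>x. (g x)\<^sup>2) \<longleftrightarrow> integrable (lebesgue_on \<Omega>) (\<lambda>x. (f x)\<^sup>2)"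
    by (rule Bochner_Integration.integrable_cong) (simp_all add: gf)
  ultimately show "f \<in> L2 \<Omega>"
    by (simp add: L2_def borel_measurable_lebesgue_on)
  have "nrm (lebesgue_on \<Omega>) f = nrm (lebesgue_on \<Omega>) g"
    unfolding nrm_def by (intro arg_cong[of _ _ sqrt] Bochner_Integration.integral_cong) (simp_all add: gf)
  then show "nrm (lebesgue_on \<Omega>) f \<le> nrm lborel f"
    using g(2) nrm_lebesgue_on_eq_lborel[OF _ \<Omega> g0] by simp
qed

text \<open>The indicator of \<open>K\<close> is the pointwise limit of smooth functions that equal
  1 on \<open>K\<close>, take values in [0, 1] and live in ever smaller neighbourhoods, so
  orthogonality passes to it with \<open>\<bar>f\<bar>\<close> as majorant.\<close>

lemma set_integral_compact_eq_0:
  fixes \<Omega> :: "(real ^ 'n) set"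
  assumes \<Omega>: "open \<Omega>" and K: "compact K" "K \<subseteq> \<Omega>"
    and f: "integrable (lebesgue_on \<Omega>) f"
    and orth: "\<And>\<phi>. \<phi> \<in> test_functions \<Omega> \<Longrightarrow> (LINT x|lebesgue_on \<Omega>. f x * \<phi> x) = 0"
  shows "(LINT x|lebesgue_on \<Omega>. f x * indicator K x) = 0"
proof -
  define U where "U k = \<Omega> \<inter> (\<Union>x\<in>K. ball x (1 / real (Suc k)))" for k
  have "\<exists>\<eta>. \<eta> \<in> test_functions (U k) \<and> (\<forall>x. 0 \<le> \<eta> x) \<and> (\<forall>x. \<eta> x \<le> 1) \<and> (\<forall>x\<in>K. \<eta> x = 1)" for k
  proof -
    have "open (U k)" "K \<subseteq> U k"
      using \<Omega> K(2) by (auto simp: U_def intro!: open_Int open_UN)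
    then show ?thesis
      using smooth_Urysohn[OF K(1), of "U k"] by metis
  qed
  then obtain \<eta> where \<eta>: "\<And>k. \<eta> k \<in> test_functions (U k)" "\<And>k x. 0 \<le> \<eta> k x" "\<And>k x. \<eta> k x \<le> 1"
      "\<And>k x. x \<in> K \<Longrightarrow> \<eta> k x = 1"
    by metis
  have [measurable]: "f \<in> borel_measurable (lebesgue_on \<Omega>)"
    using f by simp
  have lim: "(\<lambda>k. \<eta> k x) \<longlonglongrightarrow> indicator K x" for x
  proof (cases "x \<in> K")
    case True
    then show ?thesis
      by (simp add: \<eta>(4))
  next
    case False
    then obtain e where e: "e > 0" "\<And>y. y \<in> K \<Longrightarrow> e \<le> dist x y"
      using separate_point_closed[OF compact_imp_closed[OF K(1)] False] by blast
    obtain N where N: "1 / real (Suc N) < e"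
      using e(1) nat_approx_posE by blast
    have "\<eta> k x = 0" if "k \<ge> N" for k
    proof (rule test_functions_eq_0[OF \<eta>(1)])
      have "1 / real (Suc k) \<le> 1 / real (Suc N)"
        using that by (simp add: field_simps)
      then show "x \<notin> U k"
        using N e(2) by (fastforce simp: U_def dist_commute)
    qed
    then show ?thesis
      using False by (intro tendsto_eventually) (auto simp: eventually_sequentially)
  qed
  have "(\<lambda>k. LINT x|lebesgue_on \<Omega>. f x * \<eta> k x) \<longlonglongrightarrow> (LINT x|lebesgue_on \<Omega>. f x * indicator K x)"
  proof (rule integral_dominated_convergence)
    have "indicator K \<in> borel_measurable (lebesgue_on \<Omega>)"
      using K(1) by (intro borel_measurable_lebesgue_on borel_measurable_indicator) (auto intro: compact_imp_closed borel_closed)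
    then show "(\<lambda>x. f x * indicator K x) \<in> borel_measurable (lebesgue_on \<Omega>)"
      by (intro borel_measurable_times) auto
    have "\<eta> k \<in> borel_measurable (lebesgue_on \<Omega>)" for k
      by (intro borel_measurable_lebesgue_on test_functions_measurable[OF \<eta>(1)])
    then show "(\<lambda>x. f x * \<eta> k x) \<in> borel_measurable (lebesgue_on \<Omega>)" for k
      by (intro borel_measurable_times) auto
    show "integrable (lebesgue_on \<Omega>) (\<lambda>x. \<bar>f x\<bar>)"
      using f by simp
    show "AE x in lebesgue_on \<Omega>. (\<lambda>k. f x * \<eta> k x) \<longlonglongrightarrow> f x * indicator K x"
      by (intro AE_I2 tendsto_mult_left lim)
    show "AE x in lebesgue_on \<Omega>. norm (f x * \<eta> k x) \<le> \<bar>f x\<bar>" for k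
      by (intro AE_I2) (simp add: abs_mult mult_left_le \<eta>(2,3))
  qed
  moreover have "(LINT x|lebesgue_on \<Omega>. f x * \<eta> k x) = 0" for k
    by (rule orth, rule test_functions_mono[OF \<eta>(1)]) (simp add: U_def)
  ultimately show ?thesis
    by (simp add: LIMSEQ_const_iff)
qed

text \<open>Inner regularity: the set where \<open>f\<close> is positive is exhausted up to measure
  e by a closed subset, compact because \<Omega> is bounded. The integral of \<open>f\<close> over
  that subset is 0 although \<open>f\<close> is positive on it, so the subset is null.\<close>

lemma orthogonal_test_functions_imp_nonpos:
  fixes \<Omega> :: "(real ^ 'n) set"
  assumes \<Omega>: "open \<Omega>" "bounded \<Omega>"
    and f: "integrable (lebesgue_on \<Omega>) f"
    and orth: "\<And>\<phi>. \<phi> \<in> test_functions \<Omega> \<Longrightarrow> (LINT x|lebesgue_on \<Omega>. f x * \<phi> x) = 0"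
  shows "AE x in lebesgue_on \<Omega>. f x \<le> 0"
proof -
  define P where "P = {x \<in> \<Omega>. 0 < f x}"
  have \<Omega>_leb: "\<Omega> \<in> sets lebesgue"
    using \<Omega>(1) by simp
  have [measurable]: "f \<in> borel_measurable (lebesgue_on \<Omega>)"
    using f by simp
  have "P \<in> sets (lebesgue_on \<Omega>)"
    unfolding P_def by measurable (simp)
  then have P: "P \<in> sets lebesgue"
    using \<Omega>_leb by (simp add: sets_restrict_space_iff)
  have "emeasure lebesgue P \<le> 0 + ennreal e" if "e > 0" for e
  proof -
    obtain T where T: "closed T" "T \<subseteq> P" "P - T \<in> lmeasurable" "emeasure lebesgue (P - T) < ennreal e"
      using sets_lebesgue_inner_closed[OF P \<open>e > 0\<close>] by blast
    have "bounded T"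
      using T(2) \<Omega>(2) bounded_subset unfolding P_def by blast
    then have K: "compact T" "T \<subseteq> \<Omega>"
      using T(1,2) by (auto simp: compact_eq_bounded_closed P_def)
    have Tb: "T \<in> sets borel"
      using T(1) by (rule borel_closed)
    have "indicator T \<in> borel_measurable (lebesgue_on \<Omega>)"
      using Tb by (intro borel_measurable_lebesgue_on borel_measurable_indicator)
    then have int: "integrable (lebesgue_on \<Omega>) (\<lambda>x. f x * indicator T x)"
      by (intro Bochner_Integration.integrable_bound[OF f])
        (auto intro!: borel_measurable_times AE_I2 split: split_indicator)
    have nonneg: "0 \<le> f x * indicator T x" for x
      using T(2) by (cases "x \<in> T") (auto simp: P_def intro: less_imp_le)
    have "AE x in lebesgue_on \<Omega>. f x * indicator T x = 0"
      using integral_nonneg_eq_0_iff_AE[OF int] set_integral_compact_eq_0[OF \<Omega>(1) K f orth] nonneg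
      by simp
    then have "AE x in lebesgue_on \<Omega>. x \<notin> T"
      by (rule AE_mp) (use T(2) in \<open>auto simp: P_def intro!: AE_I2\<close>)
    then have "AE x in lebesgue. x \<in> \<Omega> \<longrightarrow> x \<notin> T"
      using \<Omega>_leb by (simp add: AE_restrict_space_iff)
    then have "AE x in lebesgue. x \<notin> T"
      by (rule AE_mp) (use K(2) in \<open>auto intro!: AE_I2\<close>)
    then have "T \<in> null_sets lebesgue"
      using Tb by (simp add: AE_iff_null_sets)
    have "P = T \<union> (P - T)"
      using T(2) by blast
    then have "emeasure lebesgue P \<le> emeasure lebesgue T + emeasure lebesgue (P - T)"
      using emeasure_subadditive[of T lebesgue "P - T"] Tb P by (metis sets.Diff sets_completionI_sets sets_lborel)
    also have "\<dots> \<le> 0 + ennreal e"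
      using \<open>T \<in> null_sets lebesgue\<close> T(4) by (intro add_mono) auto
    finally show ?thesis .
  qed
  then have "emeasure lebesgue P \<le> 0"
    by (rule ennreal_le_epsilon)
  then have "P \<in> null_sets lebesgue"
    using P by (simp add: null_sets_def)
  then have "AE x in lebesgue. x \<notin> P"
    using P by (simp add: AE_iff_null_sets)
  then have "AE x in lebesgue. x \<in> \<Omega> \<longrightarrow> f x \<le> 0"
    by (rule AE_mp) (auto simp: P_def intro!: AE_I2)
  then show ?thesis
    using \<Omega>_leb by (simp add: AE_restrict_space_iff)
qed

lemma L2_imp_integrable:
  assumes "bounded \<Omega>" "open \<Omega>" "f \<in> L2 \<Omega>"
  shows "integrable (lebesgue_on \<Omega>) f"
proof -
  have "finite_measure (lebesgue_on \<Omega>)"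
    using assms by (intro finite_measure_lebesgue_on lmeasurable_open)
  then have "(\<lambda>x. 1) \<in> SqInt (lebesgue_on \<Omega>)"
    by (simp add: SqInt_def finite_measure.integrable_const)
  from SqInt_mult_integrable[OF _ this] show ?thesis
    using assms(3) by (simp add: L2_eq_SqInt)
qed

lemma orthogonal_test_functions_imp_zero:
  fixes \<Omega> :: "(real ^ 'n) set"
  assumes \<Omega>: "open \<Omega>" "bounded \<Omega>" and f: "f \<in> L2 \<Omega>"
    and orth: "\<And>\<phi>. \<phi> \<in> test_functions \<Omega> \<Longrightarrow> (LINT x|lebesgue_on \<Omega>. f x * \<phi> x) = 0"
  shows "AE x in lebesgue_on \<Omega>. f x = 0"
proof -
  have int: "integrable (lebesgue_on \<Omega>) f"
    by (rule L2_imp_integrable[OF \<Omega>(2,1) f])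
  have "AE x in lebesgue_on \<Omega>. f x \<le> 0"
    by (rule orthogonal_test_functions_imp_nonpos[OF \<Omega> int orth])
  moreover have "AE x in lebesgue_on \<Omega>. - f x \<le> 0"
    by (rule orthogonal_test_functions_imp_nonpos[OF \<Omega>]) (simp_all add: int orth)
  ultimately show ?thesis
    by eventually_elim auto
qed

lemma test_functions_L2: "\<phi> \<in> test_functions \<Omega>' \<Longrightarrow> \<Omega> \<in> sets borel \<Longrightarrow> \<phi> \<in> L2 \<Omega>"
  by (rule SqInt_lborel_restrict[OF test_functions_SqInt])

text \<open>Each component of the difference is orthogonal to all test functions, so the fundamental
  lemma of the calculus of variations applies componentwise.\<close>

lemma weak_gradient_unique:
  fixes \<Omega> :: "(real ^ 'n) set"
  assumes \<Omega>: "open \<Omega>" "bounded \<Omega>"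
    and g: "\<And>i. (\<lambda>x. g x $ i) \<in> L2 \<Omega>" "has_weak_gradient \<Omega> u g"
    and h: "\<And>i. (\<lambda>x. h x $ i) \<in> L2 \<Omega>" "has_weak_gradient \<Omega> u h"
  shows "AE x in lebesgue_on \<Omega>. g x = h x"
proof -
  have "AE x in lebesgue_on \<Omega>. g x $ i - h x $ i = 0" for i
  proof (rule orthogonal_test_functions_imp_zero[OF \<Omega>])
    show "(\<lambda>x. g x $ i - h x $ i) \<in> L2 \<Omega>"
      using g(1)[of i] h(1)[of i] by (simp add: L2_eq_SqInt SqInt_diff)
    fix \<phi> assume \<phi>: "\<phi> \<in> test_functions \<Omega>"
    have "\<phi> \<in> L2 \<Omega>"
      using \<phi> \<Omega>(1) by (intro test_functions_L2) auto
    then have "(LINT x|lebesgue_on \<Omega>. (g x $ i - h x $ i) * \<phi> x)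
        = (LINT x|lebesgue_on \<Omega>. g x $ i * \<phi> x) - (LINT x|lebesgue_on \<Omega>. h x $ i * \<phi> x)"
      using g(1)[of i] h(1)[of i] unfolding left_diff_distrib L2_eq_SqInt
      by (intro Bochner_Integration.integral_diff SqInt_mult_integrable)
    moreover have "(LINT x|lebesgue_on \<Omega>. g x $ i * \<phi> x) = (LINT x|lebesgue_on \<Omega>. h x $ i * \<phi> x)"
      using bspec[OF g(2)[unfolded has_weak_gradient_def] \<phi>, THEN spec[of _ i]]
        bspec[OF h(2)[unfolded has_weak_gradient_def] \<phi>, THEN spec[of _ i]] by linarith
    ultimately show "(LINT x|lebesgue_on \<Omega>. (g x $ i - h x $ i) * \<phi> x) = 0"
      by simp
  qed
  then have "AE x in lebesgue_on \<Omega>. \<forall>i\<in>UNIV. g x $ i - h x $ i = 0"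
    by (intro AE_finite_allI) auto
  then show ?thesis
    by (rule AE_mp) (simp add: vec_eq_iff)
qed

text \<open>\<open>weak_grad\<close> is picked by choice, so nothing is known about it beyond its
  defining property. Uniqueness makes the norm computable from any square integrable weak
  gradient.\<close>

lemma grad_norm_eq:
  fixes \<Omega> :: "(real ^ 'n) set"
  assumes \<Omega>: "open \<Omega>" "bounded \<Omega>"
    and g: "\<And>i. (\<lambda>x. g x $ i) \<in> L2 \<Omega>" "has_weak_gradient \<Omega> u g"
  shows "(grad_norm \<Omega> u)\<^sup>2 = (\<Sum>i\<in>UNIV. (nrm (lebesgue_on \<Omega>) (\<lambda>x. g x $ i))\<^sup>2)"
proof -
  have "(\<forall>i. (\<lambda>x. weak_grad \<Omega> u x $ i) \<in> L2 \<Omega>) \<and> has_weak_gradient \<Omega> u (weak_grad \<Omega> u)"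
    unfolding weak_grad_def by (rule someI[of _ g]) (use g in blast)
  then have w: "\<And>i. (\<lambda>x. weak_grad \<Omega> u x $ i) \<in> L2 \<Omega>" "has_weak_gradient \<Omega> u (weak_grad \<Omega> u)"
    by blast+
  have AE: "AE x in lebesgue_on \<Omega>. weak_grad \<Omega> u x = g x"
    by (rule weak_gradient_unique[OF \<Omega> w g])
  have "(grad_norm \<Omega> u)\<^sup>2 = (LINT x|lebesgue_on \<Omega>. (norm (weak_grad \<Omega> u x))\<^sup>2)"
    by (simp add: grad_norm_def)
  also have "\<dots> = (LINT x|lebesgue_on \<Omega>. (\<Sum>i\<in>UNIV. (weak_grad \<Omega> u x $ i)\<^sup>2))"
    by (simp add: power2_norm_eq_inner inner_vec_def power2_eq_square[of "_ $ _"])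
  also have "\<dots> = (\<Sum>i\<in>UNIV. LINT x|lebesgue_on \<Omega>. (weak_grad \<Omega> u x $ i)\<^sup>2)"
    using w(1) by (intro Bochner_Integration.integral_sum) (simp add: L2_def)
  also have "\<dots> = (\<Sum>i\<in>UNIV. (nrm (lebesgue_on \<Omega>) (\<lambda>x. g x $ i))\<^sup>2)"
  proof (rule sum.cong[OF refl])
    fix i
    have "nrm (lebesgue_on \<Omega>) (\<lambda>x. weak_grad \<Omega> u x $ i) = nrm (lebesgue_on \<Omega>) (\<lambda>x. g x $ i)"
      by (rule nrm_cong_AE, rule AE_mp[OF AE])
        (use w(1)[of i] g(1)[of i] in \<open>auto simp: L2_def intro!: AE_I2\<close>)
    then show "(LINT x|lebesgue_on \<Omega>. (weak_grad \<Omega> u x $ i)\<^sup>2) = (nrm (lebesgue_on \<Omega>) (\<lambda>x. g x $ i))\<^sup>2"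
      by (simp flip: nrm_sq)
  qed
  finally show ?thesis .
qed

text \<open>The Dirichlet integral over the whole space, with classical derivatives. It does not
  refer to a domain, so it also measures mollified functions whose support leaves \<Omega>.\<close>

definition dirichlet :: "(real ^ 'n \<Rightarrow> real) \<Rightarrow> real" where
  "dirichlet \<phi> = (\<Sum>i\<in>UNIV. (nrm lborel (partial_deriv i \<phi>))\<^sup>2)"

lemma dirichlet_nonneg: "0 \<le> dirichlet \<phi>"
  by (simp add: dirichlet_def sum_nonneg)

lemma test_functions_weak_gradient:
  assumes \<phi>: "\<phi> \<in> test_functions \<Omega>" and \<Omega>: "open \<Omega>"
  shows "has_weak_gradient \<Omega> \<phi> (\<lambda>x. vec_lambda (\<lambda>i. partial_deriv i \<phi> x))"
  unfolding has_weak_gradient_def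
proof (intro ballI allI)
  fix \<psi> i assume \<psi>: "\<psi> \<in> test_functions \<Omega>"
  have [measurable]: "\<phi> \<in> borel_measurable borel" "\<psi> \<in> borel_measurable borel"
    "partial_deriv i \<phi> \<in> borel_measurable borel" "partial_deriv i \<psi> \<in> borel_measurable borel"
    by (rule test_functions_measurable, rule \<phi> \<psi> test_functions_partial_deriv[OF \<phi>] test_functions_partial_deriv[OF \<psi>])+
  have "(LINT x|lebesgue_on \<Omega>. \<phi> x * partial_deriv i \<psi> x) = (LINT x|lborel. \<phi> x * partial_deriv i \<psi> x)"
    by (rule integral_lebesgue_on_eq_lborel) (use \<Omega> \<phi> in \<open>auto simp: test_functions_eq_0\<close>)
  moreover have "(LINT x|lebesgue_on \<Omega>. partial_deriv i \<phi> x * \<psi> x) = (LINT x|lborel. partial_deriv i \<phi> x * \<psi> x)"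
    by (rule integral_lebesgue_on_eq_lborel) (use \<Omega> \<psi> in \<open>auto simp: test_functions_eq_0\<close>)
  ultimately show "(LINT x|lebesgue_on \<Omega>. \<phi> x * partial_deriv i \<psi> x)
      = - (LINT x|lebesgue_on \<Omega>. vec_lambda (\<lambda>i. partial_deriv i \<phi> x) $ i * \<psi> x)"
    using integral_by_parts_test_functions[OF \<phi> \<psi>] by simp
qed

lemma grad_norm_test_function:
  fixes \<Omega> :: "(real ^ 'n) set"
  assumes \<Omega>: "open \<Omega>" "bounded \<Omega>" and \<phi>: "\<phi> \<in> test_functions \<Omega>"
  shows "(grad_norm \<Omega> \<phi>)\<^sup>2 = dirichlet \<phi>"
proof -
  have pd: "partial_deriv i \<phi> \<in> test_functions \<Omega>" for i
    by (rule test_functions_partial_deriv[OF \<phi>])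
  have "(grad_norm \<Omega> \<phi>)\<^sup>2 = (\<Sum>i\<in>UNIV. (nrm (lebesgue_on \<Omega>) (\<lambda>x. vec_lambda (\<lambda>i. partial_deriv i \<phi> x) $ i))\<^sup>2)"
    by (rule grad_norm_eq[OF \<Omega> _ test_functions_weak_gradient[OF \<phi> \<Omega>(1)]])
      (use test_functions_L2[OF pd] \<Omega>(1) in simp)
  also have "\<dots> = dirichlet \<phi>"
    unfolding dirichlet_def
    by (intro sum.cong refl arg_cong[of _ _ "\<lambda>x. x\<^sup>2"])
      (use nrm_lebesgue_on_eq_lborel[OF test_functions_measurable[OF pd] _ test_functions_eq_0[OF pd]] \<Omega>(1) in simp)
  finally show ?thesis .
qed

lemma test_functions_H01:
  fixes \<Omega> :: "(real ^ 'n) set"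
  assumes \<Omega>: "open \<Omega>" "bounded \<Omega>" and \<phi>: "\<phi> \<in> test_functions \<Omega>"
  shows "\<phi> \<in> H01 \<Omega>"
proof -
  have "(\<lambda>x. vec_lambda (\<lambda>i. partial_deriv i \<phi> x) $ i) \<in> L2 \<Omega>" for i
    using test_functions_L2[OF test_functions_partial_deriv[OF \<phi>]] \<Omega>(1) by simp
  moreover have "\<phi> \<in> L2 \<Omega>"
    using test_functions_L2[OF \<phi>] \<Omega>(1) by simp
  ultimately have "\<phi> \<in> H1 \<Omega>"
    unfolding H1_def mem_Collect_eq
    by (intro conjI exI[of _ "\<lambda>x. vec_lambda (\<lambda>i. partial_deriv i \<phi> x)"] allI test_functions_weak_gradient[OF \<phi> \<Omega>(1)])
  moreover have "h1_norm \<Omega> (\<lambda>x. \<phi> x - \<phi> x) = 0"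
    using grad_norm_test_function[OF \<Omega> test_functions_zero]
    by (simp add: h1_norm_def l2_norm_def dirichlet_def nrm_def partial_deriv_const)
  ultimately show ?thesis
    unfolding H01_def mem_Collect_eq using \<phi> by (intro conjI exI[of _ "\<lambda>_. \<phi>"]) simp_all
qed

subsection \<open>Affine changes of variables\<close>

lemma nn_integral_affine:
  fixes f :: "'a::euclidean_space \<Rightarrow> ennreal"
  assumes "f \<in> borel_measurable borel" "a \<noteq> 0"
  shows "(\<integral>\<^sup>+x. f x \<partial>lborel) = ennreal (\<bar>a\<bar> ^ DIM('a)) * (\<integral>\<^sup>+x. f (c + a *\<^sub>R x) \<partial>lborel)"
  by (subst lborel_affine[OF assms(2), of c])
    (use assms(1) in \<open>simp add: nn_integral_density nn_integral_distr nn_integral_cmult\<close>)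

lemma nn_integral_reflect:
  fixes f :: "'a::euclidean_space \<Rightarrow> ennreal"
  assumes "f \<in> borel_measurable borel"
  shows "(\<integral>\<^sup>+x. f (c - x) \<partial>lborel) = (\<integral>\<^sup>+x. f x \<partial>lborel)"
  using nn_integral_affine[OF assms, of "-1" c] by simp

lemma SqInt_reflect:
  fixes f :: "'a::euclidean_space \<Rightarrow> real"
  assumes "f \<in> SqInt lborel"
  shows "(\<lambda>y. f (c - y)) \<in> SqInt lborel"
proof (rule SqIntI)
  have [measurable]: "f \<in> borel_measurable borel"
    using SqInt_measurable[OF assms] by simp
  show "(\<lambda>y. f (c - y)) \<in> borel_measurable lborel"
    by measurable
  show "(\<integral>\<^sup>+x. ennreal ((f (c - x))\<^sup>2) \<partial>lborel) < \<infinity>"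
    using nn_integral_reflect[of "\<lambda>x. ennreal ((f x)\<^sup>2)" c] nn_integral_sq[OF assms] by simp
qed

lemma nn_integral_sq_translate:
  fixes f :: "'a::euclidean_space \<Rightarrow> real"
  assumes "f \<in> borel_measurable borel"
  shows "(\<integral>\<^sup>+x. ennreal ((f (x + c))\<^sup>2) \<partial>lborel) = (\<integral>\<^sup>+x. ennreal ((f x)\<^sup>2) \<partial>lborel)"
  using nn_integral_translate[of "\<lambda>x. ennreal ((f x)\<^sup>2)" c] assms by simp

lemma SqInt_translate:
  fixes f :: "'a::euclidean_space \<Rightarrow> real"
  assumes "f \<in> SqInt lborel"
  shows "(\<lambda>y. f (y + c)) \<in> SqInt lborel"
proof (rule SqIntI)
  have [measurable]: "f \<in> borel_measurable borel"
    using SqInt_measurable[OF assms] by simp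
  show "(\<lambda>y. f (y + c)) \<in> borel_measurable lborel"
    by measurable
  show "(\<integral>\<^sup>+x. ennreal ((f (x + c))\<^sup>2) \<partial>lborel) < \<infinity>"
    using nn_integral_sq_translate[of f c] nn_integral_sq[OF assms] by simp
qed

subsection \<open>The Gagliardo seminorm as an integral over increments\<close>

text \<open>The squared L^2 norm of the increment of \<open>v\<close> by \<open>h\<close>. Being
  extended nonnegative, it is meaningful without integrability; the Gagliardo seminorm is its
  integral against the kernel.\<close>

definition incr_sq :: "(real ^ 'n \<Rightarrow> real) \<Rightarrow> real ^ 'n \<Rightarrow> ennreal" where
  "incr_sq v h = (\<integral>\<^sup>+x. ennreal ((v (x + h) - v x)\<^sup>2) \<partial>lborel)"

text \<open>The weight |h|^(-N-2s). At \<open>h = 0\<close> its value is 0 by the conventions for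
  \<open>powr\<close> and division.\<close>

definition kern :: "real \<Rightarrow> real ^ 'n \<Rightarrow> ennreal" where
  "kern s h = ennreal (1 / norm h powr (real CARD('n) + 2 * s))"

lemma kern_measurable [measurable]: "kern s \<in> borel_measurable borel"
  unfolding kern_def by measurable

lemma incr_sq_measurable [measurable]:
  assumes [measurable]: "v \<in> borel_measurable borel"
  shows "incr_sq v \<in> borel_measurable borel"
proof -
  have "(\<lambda>h. \<integral>\<^sup>+x. ennreal ((v (x + h) - v x)\<^sup>2) \<partial>lborel) \<in> borel_measurable lborel"
    by (rule lborel.borel_measurable_nn_integral) measurable
  then show ?thesis
    by (simp add: incr_sq_def[abs_def])
qed

lemma incr_sq_minus:
  assumes [measurable]: "v \<in> borel_measurable borel"
  shows "incr_sq v (- h) = incr_sq v h"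
proof -
  have "incr_sq v h = (\<integral>\<^sup>+x. ennreal ((v (x + - h + h) - v (x + - h))\<^sup>2) \<partial>lborel)"
    unfolding incr_sq_def by (rule nn_integral_translate[symmetric]) measurable
  then show ?thesis
    by (simp add: incr_sq_def power2_commute)
qed

text \<open>\<open>gagliardo\<close> integrates over a product of two completed measures, and
  Tonelli's theorem there asks for sigma-finiteness of the completion.\<close>

lemma sigma_finite_lebesgue: "sigma_finite_measure (lebesgue :: 'a::euclidean_space measure)"
proof
  obtain A :: "'a set set" where A: "countable A" "A \<subseteq> sets lborel" "\<Union>A = space lborel"
      "\<And>a. a \<in> A \<Longrightarrow> emeasure lborel a \<noteq> \<infinity>"
    using lborel.sigma_finite_countable by metis
  have "emeasure lebesgue a \<noteq> \<infinity>" if "a \<in> A" for a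
  proof -
    have "a \<in> sets borel"
      using that A(2) by auto
    then show ?thesis
      using A(4)[OF that] by simp
  qed
  moreover have "A \<subseteq> sets lebesgue"
  proof
    fix a assume "a \<in> A"
    then show "a \<in> sets lebesgue"
      using A(2) by (intro sets_completionI_sets) (rule subsetD)
  qed
  ultimately show "\<exists>A::'a set set. countable A \<and> A \<subseteq> sets lebesgue \<and> \<Union>A = space lebesgue \<and> (\<forall>a\<in>A. emeasure lebesgue a \<noteq> \<infinity>)"
    using A(1,3) by (intro exI[of _ A]) simp
qed

text \<open>Substitute y = x + h in the inner integral and exchange the order, so that the kernel
  comes outside the integral over x.\<close>

lemma double_integral_incr_sq:
  fixes v :: "real ^ 'n \<Rightarrow> real"
  assumes [measurable]: "v \<in> borel_measurable borel"
  shows "(\<integral>\<^sup>+x. \<integral>\<^sup>+y. ennreal (\<bar>v x - v y\<bar>\<^sup>2 / norm (x - y) powr (real CARD('n) + 2 * s)) \<partial>lborel \<partial>lborel)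
    = (\<integral>\<^sup>+h. kern s h * incr_sq v h \<partial>lborel)"
proof -
  have "(\<integral>\<^sup>+y. ennreal (\<bar>v x - v y\<bar>\<^sup>2 / norm (x - y) powr (real CARD('n) + 2 * s)) \<partial>lborel)
      = (\<integral>\<^sup>+h. kern s h * ennreal ((v (x + h) - v x)\<^sup>2) \<partial>lborel)" for x
  proof -
    have "(\<integral>\<^sup>+y. ennreal (\<bar>v x - v y\<bar>\<^sup>2 / norm (x - y) powr (real CARD('n) + 2 * s)) \<partial>lborel)
        = (\<integral>\<^sup>+h. ennreal (\<bar>v x - v (h + x)\<bar>\<^sup>2 / norm (x - (h + x)) powr (real CARD('n) + 2 * s)) \<partial>lborel)"
      by (rule nn_integral_translate[symmetric, of "\<lambda>y. ennreal (\<bar>v x - v y\<bar>\<^sup>2 / norm (x - y) powr (real CARD('n) + 2 * s))"]) measurable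
    also have "\<dots> = (\<integral>\<^sup>+h. kern s h * ennreal ((v (x + h) - v x)\<^sup>2) \<partial>lborel)"
    proof (rule nn_integral_cong)
      fix h
      have "\<bar>v x - v (h + x)\<bar>\<^sup>2 / norm (x - (h + x)) powr (real CARD('n) + 2 * s)
          = 1 / norm h powr (real CARD('n) + 2 * s) * (v (x + h) - v x)\<^sup>2"
        by (simp add: power2_commute[of "v x"] add.commute[of h])
      then show "ennreal (\<bar>v x - v (h + x)\<bar>\<^sup>2 / norm (x - (h + x)) powr (real CARD('n) + 2 * s))
          = kern s h * ennreal ((v (x + h) - v x)\<^sup>2)"
        unfolding kern_def by (simp only: ennreal_mult'' zero_le_power2)
    qed
    finally show ?thesis .
  qed
  then have "(\<integral>\<^sup>+x. \<integral>\<^sup>+y. ennreal (\<bar>v x - v y\<bar>\<^sup>2 / norm (x - y) powr (real CARD('n) + 2 * s)) \<partial>lborel \<partial>lborel)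
      = (\<integral>\<^sup>+x. \<integral>\<^sup>+h. kern s h * ennreal ((v (x + h) - v x)\<^sup>2) \<partial>lborel \<partial>lborel)"
    by (rule nn_integral_cong)
  also have "\<dots> = (\<integral>\<^sup>+h. \<integral>\<^sup>+x. kern s h * ennreal ((v (x + h) - v x)\<^sup>2) \<partial>lborel \<partial>lborel)"
    by (rule lborel_pair.Fubini'[symmetric]) measurable
  also have "\<dots> = (\<integral>\<^sup>+h. kern s h * incr_sq v h \<partial>lborel)"
    by (rule nn_integral_cong, unfold incr_sq_def, rule nn_integral_cmult) measurable
  finally show ?thesis .
qed

text \<open>Tonelli comes before the change of representative: in an iterated integral the a.e.
  equality is used in one variable at a time, and no null sets of the product measure have to be
  considered. The iterated integrals are then the same over \<open>lborel\<close>.\<close>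

lemma gagliardo_eq:
  fixes v v' :: "real ^ 'n \<Rightarrow> real"
  assumes v[measurable]: "v \<in> borel_measurable lebesgue" and v': "v' \<in> borel_measurable borel"
    and AE: "AE x in lebesgue. v x = v' x"
  shows "gagliardo s v = (\<integral>\<^sup>+h. kern s h * incr_sq v' h \<partial>lborel)"
proof -
  interpret L: sigma_finite_measure "lebesgue :: (real ^ 'n) measure"
    by (rule sigma_finite_lebesgue)
  let ?F = "\<lambda>v (x, y). ennreal (\<bar>v x - v y\<bar>\<^sup>2 / norm (x - y) powr (real CARD('n) + 2 * s))"
  \<comment> \<open>The kernel is a Borel function of x - y; its measurability on the completed
    product goes through projections with values in the Borel algebra.\<close>
  have id: "(\<lambda>x. x) \<in> (lebesgue :: (real ^ 'n) measure) \<rightarrow>\<^sub>M borel"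
    by (rule measurable_completion) simp
  have [measurable]: "fst \<in> lebesgue \<Otimes>\<^sub>M lebesgue \<rightarrow>\<^sub>M (borel :: (real ^ 'n) measure)"
    using measurable_compose[OF measurable_fst id] .
  have [measurable]: "snd \<in> lebesgue \<Otimes>\<^sub>M lebesgue \<rightarrow>\<^sub>M (borel :: (real ^ 'n) measure)"
    using measurable_compose[OF measurable_snd id] .
  have "gagliardo s v = (\<integral>\<^sup>+x. \<integral>\<^sup>+y. ?F v (x, y) \<partial>lebesgue \<partial>lebesgue)"
    unfolding gagliardo_def
    by (rule L.nn_integral_fst[symmetric]) (simp add: split_beta, measurable)
  also have "\<dots> = (\<integral>\<^sup>+x. \<integral>\<^sup>+y. ?F v' (x, y) \<partial>lebesgue \<partial>lebesgue)"
    by (rule nn_integral_cong_AE, rule AE_mp[OF AE], rule AE_I2, rule impI, rule nn_integral_cong_AE,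
        rule AE_mp[OF AE], rule AE_I2) simp
  also have "\<dots> = (\<integral>\<^sup>+h. kern s h * incr_sq v' h \<partial>lborel)"
    using double_integral_incr_sq[OF v'] by (simp only: nn_integral_completion split_conv)
  finally show ?thesis .
qed

subsection \<open>Convolution\<close>

definition conv :: "(real ^ 'n \<Rightarrow> real) \<Rightarrow> (real ^ 'n \<Rightarrow> real) \<Rightarrow> real ^ 'n \<Rightarrow> real" where
  "conv \<rho> f x = (LINT y|lborel. \<rho> (x - y) * f y)"

lemma conv_measurable [measurable]:
  assumes [measurable]: "\<rho> \<in> borel_measurable borel" "f \<in> borel_measurable borel"
  shows "conv \<rho> f \<in> borel_measurable borel"
proof -
  have "(\<lambda>x. LINT y|lborel. \<rho> (x - y) * f y) \<in> borel_measurable lborel"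
    by (rule lborel.borel_measurable_lebesgue_integral) measurable
  then show ?thesis
    by (simp add: conv_def[abs_def])
qed

lemma conv_integrable:
  assumes "\<rho> \<in> SqInt lborel" "f \<in> SqInt lborel"
  shows "integrable lborel (\<lambda>y. \<rho> (x - y) * f y)"
  by (rule SqInt_mult_integrable[OF SqInt_reflect[OF assms(1)] assms(2)])

text \<open>Cauchy-Schwarz with \<open>\<bar>k\<bar>\<close> split into two square roots. If the
  product is not integrable, the left side is 0 by convention.\<close>

lemma weighted_Jensen:
  assumes [measurable]: "k \<in> borel_measurable M" "g \<in> borel_measurable M"
  shows "ennreal ((LINT y|M. k y * g y)\<^sup>2) \<le> (\<integral>\<^sup>+y. ennreal \<bar>k y\<bar> \<partial>M) * (\<integral>\<^sup>+y. ennreal (\<bar>k y\<bar> * (g y)\<^sup>2) \<partial>M)"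
proof (cases "integrable M (\<lambda>y. k y * g y)")
  case True
  have "ennreal \<bar>LINT y|M. k y * g y\<bar> \<le> ennreal (LINT y|M. \<bar>k y * g y\<bar>)"
    using integral_abs_bound[of M "\<lambda>y. k y * g y"] by (rule ennreal_leI)
  also have "\<dots> = (\<integral>\<^sup>+y. ennreal \<bar>k y * g y\<bar> \<partial>M)"
    using True by (intro nn_integral_eq_integral[symmetric]) auto
  also have "\<dots> = (\<integral>\<^sup>+y. ennreal (sqrt \<bar>k y\<bar>) * ennreal (sqrt \<bar>k y\<bar> * \<bar>g y\<bar>) \<partial>M)"
  proof (rule nn_integral_cong)
    fix y
    have "\<bar>k y * g y\<bar> = sqrt \<bar>k y\<bar> * (sqrt \<bar>k y\<bar> * \<bar>g y\<bar>)"
      by (simp add: abs_mult flip: mult.assoc)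
    then show "ennreal \<bar>k y * g y\<bar> = ennreal (sqrt \<bar>k y\<bar>) * ennreal (sqrt \<bar>k y\<bar> * \<bar>g y\<bar>)"
      by (simp add: ennreal_mult)
  qed
  finally have "(ennreal \<bar>LINT y|M. k y * g y\<bar>)\<^sup>2 \<le> (\<integral>\<^sup>+y. ennreal (sqrt \<bar>k y\<bar>) * ennreal (sqrt \<bar>k y\<bar> * \<bar>g y\<bar>) \<partial>M)\<^sup>2"
    by (intro power_mono) auto
  also have "\<dots> \<le> (\<integral>\<^sup>+y. (ennreal (sqrt \<bar>k y\<bar>))\<^sup>2 \<partial>M) * (\<integral>\<^sup>+y. (ennreal (sqrt \<bar>k y\<bar> * \<bar>g y\<bar>))\<^sup>2 \<partial>M)"
    by (rule Cauchy_Schwarz_nn_integral) measurable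
  also have "\<dots> = (\<integral>\<^sup>+y. ennreal \<bar>k y\<bar> \<partial>M) * (\<integral>\<^sup>+y. ennreal (\<bar>k y\<bar> * (g y)\<^sup>2) \<partial>M)"
    by (simp add: ennreal_power power_mult_distrib)
  finally show ?thesis
    by (simp add: ennreal_power)
next
  case False
  then show ?thesis
    by (simp add: not_integrable_integral_eq)
qed

text \<open>Young's inequality for an L^1 kernel acting on L^2. The kernel may change sign, because
  the inequality is also applied to increments of a mollifier.\<close>

lemma conv_Young:
  fixes f :: "real ^ 'n \<Rightarrow> real"
  assumes [measurable]: "\<rho> \<in> borel_measurable borel" "f \<in> borel_measurable borel"
  shows "(\<integral>\<^sup>+x. ennreal ((conv \<rho> f x)\<^sup>2) \<partial>lborel) \<le> (\<integral>\<^sup>+z. ennreal \<bar>\<rho> z\<bar> \<partial>lborel)\<^sup>2 * (\<integral>\<^sup>+x. ennreal ((f x)\<^sup>2) \<partial>lborel)"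
proof -
  let ?A = "\<integral>\<^sup>+z. ennreal \<bar>\<rho> z\<bar> \<partial>lborel"
  have "(\<integral>\<^sup>+x. ennreal ((conv \<rho> f x)\<^sup>2) \<partial>lborel) \<le> (\<integral>\<^sup>+x. ?A * (\<integral>\<^sup>+y. ennreal (\<bar>\<rho> (x - y)\<bar> * (f y)\<^sup>2) \<partial>lborel) \<partial>lborel)"
  proof (rule nn_integral_mono)
    fix x
    have "ennreal ((conv \<rho> f x)\<^sup>2) \<le> (\<integral>\<^sup>+y. ennreal \<bar>\<rho> (x - y)\<bar> \<partial>lborel) * (\<integral>\<^sup>+y. ennreal (\<bar>\<rho> (x - y)\<bar> * (f y)\<^sup>2) \<partial>lborel)"
      unfolding conv_def by (rule weighted_Jensen) measurable
    also have "(\<integral>\<^sup>+y. ennreal \<bar>\<rho> (x - y)\<bar> \<partial>lborel) = ?A"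
      by (rule nn_integral_reflect[of "\<lambda>z. ennreal \<bar>\<rho> z\<bar>"]) measurable
    finally show "ennreal ((conv \<rho> f x)\<^sup>2) \<le> ?A * (\<integral>\<^sup>+y. ennreal (\<bar>\<rho> (x - y)\<bar> * (f y)\<^sup>2) \<partial>lborel)" .
  qed
  also have "\<dots> = ?A * (\<integral>\<^sup>+x. \<integral>\<^sup>+y. ennreal (\<bar>\<rho> (x - y)\<bar> * (f y)\<^sup>2) \<partial>lborel \<partial>lborel)"
    by (rule nn_integral_cmult) measurable
  also have "(\<integral>\<^sup>+x. \<integral>\<^sup>+y. ennreal (\<bar>\<rho> (x - y)\<bar> * (f y)\<^sup>2) \<partial>lborel \<partial>lborel)
      = (\<integral>\<^sup>+y. \<integral>\<^sup>+x. ennreal (\<bar>\<rho> (x - y)\<bar> * (f y)\<^sup>2) \<partial>lborel \<partial>lborel)"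
    by (rule lborel_pair.Fubini'[symmetric]) measurable
  also have "\<dots> = (\<integral>\<^sup>+y. ?A * ennreal ((f y)\<^sup>2) \<partial>lborel)"
  proof (rule nn_integral_cong)
    fix y
    have "(\<integral>\<^sup>+x. ennreal (\<bar>\<rho> (x - y)\<bar> * (f y)\<^sup>2) \<partial>lborel) = (\<integral>\<^sup>+x. ennreal \<bar>\<rho> (x + - y)\<bar> * ennreal ((f y)\<^sup>2) \<partial>lborel)"
      by (simp add: ennreal_mult)
    also have "\<dots> = (\<integral>\<^sup>+x. ennreal \<bar>\<rho> (x + - y)\<bar> \<partial>lborel) * ennreal ((f y)\<^sup>2)"
      by (rule nn_integral_multc) measurable
    also have "(\<integral>\<^sup>+x. ennreal \<bar>\<rho> (x + - y)\<bar> \<partial>lborel) = ?A"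
      by (rule nn_integral_translate[of "\<lambda>z. ennreal \<bar>\<rho> z\<bar>"]) measurable
    finally show "(\<integral>\<^sup>+x. ennreal (\<bar>\<rho> (x - y)\<bar> * (f y)\<^sup>2) \<partial>lborel) = ?A * ennreal ((f y)\<^sup>2)" .
  qed
  also have "\<dots> = ?A * (\<integral>\<^sup>+y. ennreal ((f y)\<^sup>2) \<partial>lborel)"
    by (rule nn_integral_cmult) measurable
  finally show ?thesis
    by (simp add: power2_eq_square mult.assoc)
qed

lemma conv_diff_right:
  assumes "\<rho> \<in> SqInt lborel" "f \<in> SqInt lborel" "g \<in> SqInt lborel"
  shows "conv \<rho> f x - conv \<rho> g x = conv \<rho> (\<lambda>y. f y - g y) x"
  unfolding conv_def
  using conv_integrable[OF assms(1,2)] conv_integrable[OF assms(1,3)] by (simp add: right_diff_distrib)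

lemma conv_diff_left:
  assumes "\<rho> \<in> SqInt lborel" "\<sigma> \<in> SqInt lborel" "f \<in> SqInt lborel"
  shows "conv \<rho> f x - conv \<sigma> f x = conv (\<lambda>y. \<rho> y - \<sigma> y) f x"
  unfolding conv_def
  using conv_integrable[OF assms(1,3)] conv_integrable[OF assms(2,3)] by (simp add: left_diff_distrib)

text \<open>A translation of the convolution can be put on either factor: on the kernel it gives
  smoothing estimates, on the function it gives contraction estimates.\<close>

lemma conv_translate_left: "conv \<rho> f (x + h) = conv (\<lambda>z. \<rho> (z + h)) f x"
  by (simp add: conv_def algebra_simps)

lemma conv_translate_right:
  assumes [measurable]: "\<rho> \<in> borel_measurable borel" "f \<in> borel_measurable borel"
  shows "conv \<rho> f (x + h) = conv \<rho> (\<lambda>y. f (y + h)) x"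
proof -
  have "conv \<rho> f (x + h) = (LINT y|lborel. \<rho> (x + h - (y + h)) * f (y + h))"
    unfolding conv_def by (rule integral_translate[symmetric]) measurable
  then show ?thesis
    by (simp add: conv_def)
qed

definition mollifier :: "(real ^ 'n \<Rightarrow> real) \<Rightarrow> bool" where
  "mollifier \<rho> \<longleftrightarrow> \<rho> \<in> test_functions UNIV \<and> (\<forall>x. 0 \<le> \<rho> x) \<and> (LINT x|lborel. \<rho> x) = 1"

section \<open>Contraction and error estimates for mollification\<close>

lemma mollifier_nn_integral:
  assumes "mollifier \<rho>"
  shows "(\<integral>\<^sup>+z. ennreal \<bar>\<rho> z\<bar> \<partial>lborel) = 1"
  using assms nn_integral_eq_integral[of lborel \<rho>] test_functions_integrable[of \<rho> UNIV]
  by (simp add: mollifier_def)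

lemma mollifier_Young:
  assumes "mollifier \<rho>" "f \<in> SqInt lborel"
  shows "conv \<rho> f \<in> SqInt lborel" "nrm lborel (conv \<rho> f) \<le> nrm lborel f"
proof -
  have [measurable]: "\<rho> \<in> borel_measurable borel" "f \<in> borel_measurable borel"
    using assms test_functions_measurable SqInt_measurable[of f lborel] by (auto simp: mollifier_def)
  have "(\<integral>\<^sup>+x. ennreal ((conv \<rho> f x)\<^sup>2) \<partial>lborel) \<le> ennreal ((nrm lborel f)\<^sup>2)"
    using conv_Young[of \<rho> f] mollifier_nn_integral[OF assms(1)] nn_integral_sq[OF assms(2)] by simp
  from SqInt_bound[OF _ this] show "conv \<rho> f \<in> SqInt lborel" "nrm lborel (conv \<rho> f) \<le> nrm lborel f"
    by (simp_all add: nrm_nonneg)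
qed

text \<open>Increments commute with convolution, so Young's inequality with total mass 1 applies to
  the increment of \<open>f\<close>. Integrated against the kernel, this is the monotonicity of the
  energy under mollification.\<close>

lemma incr_sq_mollify_le:
  assumes "mollifier \<rho>" "f \<in> SqInt lborel"
  shows "incr_sq (conv \<rho> f) h \<le> incr_sq f h"
proof -
  have [measurable]: "\<rho> \<in> borel_measurable borel" "f \<in> borel_measurable borel"
    using assms test_functions_measurable SqInt_measurable[of f lborel] by (auto simp: mollifier_def)
  have "\<rho> \<in> SqInt lborel"
    using assms(1) test_functions_SqInt by (auto simp: mollifier_def)
  then have "conv \<rho> f (x + h) - conv \<rho> f x = conv \<rho> (\<lambda>y. f (y + h) - f y) x" for x
    using conv_diff_right[OF _ SqInt_translate[OF assms(2)] assms(2)] by (simp add: conv_translate_right)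
  then show ?thesis
    using conv_Young[of \<rho> "\<lambda>y. f (y + h) - f y"] mollifier_nn_integral[OF assms(1)]
    by (simp add: incr_sq_def)
qed

text \<open>Since \<rho> has mass 1, the error at x is an average of f(x - h) - f(x) with weight
  \<rho>(h). Jensen's inequality and Tonelli turn it into an average of squared increments.\<close>

lemma mollify_error:
  fixes f :: "real ^ 'n \<Rightarrow> real"
  assumes \<rho>: "mollifier \<rho>" and f: "f \<in> SqInt lborel"
  shows "(\<integral>\<^sup>+x. ennreal ((conv \<rho> f x - f x)\<^sup>2) \<partial>lborel) \<le> (\<integral>\<^sup>+h. ennreal (\<rho> h) * incr_sq f h \<partial>lborel)"
proof -
  have [measurable]: "\<rho> \<in> borel_measurable borel" "f \<in> borel_measurable borel"
    using assms test_functions_measurable SqInt_measurable[of f lborel] by (auto simp: mollifier_def)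
  have nonneg: "0 \<le> \<rho> x" for x
    using \<rho> by (simp add: mollifier_def)
  have \<rho>_test: "\<rho> \<in> test_functions UNIV"
    using \<rho> by (simp add: mollifier_def)
  have "(\<integral>\<^sup>+x. ennreal ((conv \<rho> f x - f x)\<^sup>2) \<partial>lborel)
      \<le> (\<integral>\<^sup>+x. \<integral>\<^sup>+h. ennreal (\<rho> h) * ennreal ((f (x - h) - f x)\<^sup>2) \<partial>lborel \<partial>lborel)"
  proof (rule nn_integral_mono)
    fix x
    have int: "integrable lborel (\<lambda>y. \<rho> (x - y))" "(LINT y|lborel. \<rho> (x - y)) = 1"
    proof -
      have nn: "(\<integral>\<^sup>+y. ennreal (\<rho> (x - y)) \<partial>lborel) = 1"
        using nn_integral_reflect[of "\<lambda>z. ennreal (\<rho> z)" x] mollifier_nn_integral[OF \<rho>] nonneg by simp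
      then show "integrable lborel (\<lambda>y. \<rho> (x - y))"
        by (intro integrableI_nonneg) (auto simp: nonneg)
      show "(LINT y|lborel. \<rho> (x - y)) = 1"
        by (subst integral_eq_nn_integral) (auto simp: nonneg nn)
    qed
    have "(LINT y|lborel. \<rho> (x - y) * (f y - f x)) = conv \<rho> f x - f x"
      using conv_integrable[OF test_functions_SqInt[OF \<rho>_test] f, of x] int
      by (simp add: conv_def right_diff_distrib)
    then have "ennreal ((conv \<rho> f x - f x)\<^sup>2) \<le> (\<integral>\<^sup>+y. ennreal \<bar>\<rho> (x - y)\<bar> \<partial>lborel) * (\<integral>\<^sup>+y. ennreal (\<bar>\<rho> (x - y)\<bar> * (f y - f x)\<^sup>2) \<partial>lborel)"
      using weighted_Jensen[of "\<lambda>y. \<rho> (x - y)" lborel "\<lambda>y. f y - f x"] by simp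
    also have "(\<integral>\<^sup>+y. ennreal \<bar>\<rho> (x - y)\<bar> \<partial>lborel) = 1"
      using nn_integral_reflect[of "\<lambda>z. ennreal \<bar>\<rho> z\<bar>" x] mollifier_nn_integral[OF \<rho>] by simp
    \<comment> \<open>The substitution y = x - h produces increments by -h; after integration in x
      they agree with those by h.\<close>
    also have "(\<integral>\<^sup>+y. ennreal (\<bar>\<rho> (x - y)\<bar> * (f y - f x)\<^sup>2) \<partial>lborel)
        = (\<integral>\<^sup>+h. ennreal (\<bar>\<rho> (x - (x - h))\<bar> * (f (x - h) - f x)\<^sup>2) \<partial>lborel)"
      by (rule nn_integral_reflect[symmetric]) measurable
    also have "\<dots> = (\<integral>\<^sup>+h. ennreal (\<rho> h) * ennreal ((f (x - h) - f x)\<^sup>2) \<partial>lborel)"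
      by (simp add: nonneg ennreal_mult)
    finally show "ennreal ((conv \<rho> f x - f x)\<^sup>2) \<le> (\<integral>\<^sup>+h. ennreal (\<rho> h) * ennreal ((f (x - h) - f x)\<^sup>2) \<partial>lborel)"
      by simp
  qed
  also have "\<dots> = (\<integral>\<^sup>+h. \<integral>\<^sup>+x. ennreal (\<rho> h) * ennreal ((f (x - h) - f x)\<^sup>2) \<partial>lborel \<partial>lborel)"
    by (rule lborel_pair.Fubini'[symmetric]) measurable
  also have "\<dots> = (\<integral>\<^sup>+h. ennreal (\<rho> h) * incr_sq f h \<partial>lborel)"
  proof (rule nn_integral_cong)
    fix h
    have "(\<integral>\<^sup>+x. ennreal (\<rho> h) * ennreal ((f (x - h) - f x)\<^sup>2) \<partial>lborel) = ennreal (\<rho> h) * incr_sq f (- h)"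
      unfolding incr_sq_def by (subst nn_integral_cmult) simp_all
    then show "(\<integral>\<^sup>+x. ennreal (\<rho> h) * ennreal ((f (x - h) - f x)\<^sup>2) \<partial>lborel) = ennreal (\<rho> h) * incr_sq f h"
      by (simp add: incr_sq_minus)
  qed
  finally show ?thesis .
qed

subsection \<open>Smoothness of convolutions\<close>

lemma test_functions_ball:
  assumes "\<phi> \<in> test_functions \<Omega>"
  obtains R where "R \<ge> 0" "\<And>x. norm x > R \<Longrightarrow> \<phi> x = 0"
proof -
  obtain K where K: "compact K" "K \<subseteq> \<Omega>" "\<And>x. x \<notin> K \<Longrightarrow> \<phi> x = 0"
    using test_functionsE[OF assms] by blast
  obtain R where R: "\<And>x. x \<in> K \<Longrightarrow> norm x \<le> R"
    using compact_imp_bounded[OF K(1)] unfolding bounded_iff by blast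
  have "\<phi> x = 0" if "norm x > max R 0" for x
    using that R[of x] K(3)[of x] by fastforce
  then show thesis
    by (intro that[of "max R 0"]) auto
qed

lemma nn_integral_cball_le:
  fixes g :: "'a::euclidean_space \<Rightarrow> real"
  assumes "\<And>z. g z \<le> b * indicator (cball 0 R) z" "0 \<le> b"
  shows "(\<integral>\<^sup>+z. ennreal (g z) \<partial>lborel) \<le> ennreal (b * measure lborel (cball 0 R :: 'a set))"
proof -
  have "(\<integral>\<^sup>+z. ennreal (g z) \<partial>lborel) \<le> (\<integral>\<^sup>+z. ennreal b * indicator (cball (0::'a) R) z \<partial>lborel)"
  proof (rule nn_integral_mono)
    fix z :: 'a
    show "ennreal (g z) \<le> ennreal b * indicator (cball 0 R) z"
      using ennreal_leI[OF assms(1)[of z]] by (cases "z \<in> cball 0 R") simp_all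
  qed
  also have "\<dots> = ennreal b * emeasure lborel (cball 0 R :: 'a set)"
    by (rule nn_integral_cmult_indicator) simp
  also have "emeasure lborel (cball 0 R :: 'a set) = ennreal (measure lborel (cball 0 R :: 'a set))"
    by (rule emeasure_eq_ennreal_measure)
      (use emeasure_lborel_cball_finite[of "0::'a" R] in \<open>simp only: infinity_ennreal_def less_top\<close>)
  finally show ?thesis
    using assms(2) by (simp add: ennreal_mult)
qed

text \<open>For short h the Lipschitz bound is multiplied by the volume of a ball that contains both
  supports; for long h twice the L^1 norm is enough.\<close>

lemma test_functions_increment_L1:
  assumes \<rho>: "\<rho> \<in> test_functions \<Omega>"
  obtains c where "c \<ge> 0" "\<And>h. (\<integral>\<^sup>+z. ennreal \<bar>\<rho> (z + h) - \<rho> z\<bar> \<partial>lborel) \<le> ennreal (c * min 1 (norm h))"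
proof -
  obtain L where L: "L \<ge> 0" "\<And>x y. \<bar>\<rho> x - \<rho> y\<bar> \<le> L * norm (x - y)"
    using test_functions_Lipschitz[OF \<rho>] by blast
  obtain R where R: "R \<ge> 0" "\<And>x. norm x > R \<Longrightarrow> \<rho> x = 0"
    using test_functions_ball[OF \<rho>] by blast
  have [measurable]: "\<rho> \<in> borel_measurable borel"
    by (rule test_functions_measurable[OF \<rho>])
  define m where "m = measure lborel (cball 0 (R + 1) :: (real ^ 'a) set)"
  define A where "A = (LINT z|lborel. \<bar>\<rho> z\<bar>)"
  have A: "A \<ge> 0" "(\<integral>\<^sup>+z. ennreal \<bar>\<rho> z\<bar> \<partial>lborel) = ennreal A"
    using test_functions_integrable[OF \<rho>] by (auto simp: A_def nn_integral_eq_integral)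
  have m: "m \<ge> 0"
    by (simp add: m_def)
  have "(\<integral>\<^sup>+z. ennreal \<bar>\<rho> (z + h) - \<rho> z\<bar> \<partial>lborel) \<le> ennreal ((L * m + 2 * A) * min 1 (norm h))" for h
  proof (cases "norm h \<le> 1")
    case True
    have "(\<integral>\<^sup>+z. ennreal \<bar>\<rho> (z + h) - \<rho> z\<bar> \<partial>lborel) \<le> ennreal (L * norm h * m)"
      unfolding m_def
    proof (rule nn_integral_cball_le)
      fix z
      show "\<bar>\<rho> (z + h) - \<rho> z\<bar> \<le> L * norm h * indicator (cball 0 (R + 1)) z"
      proof (cases "norm z \<le> R + 1")
        case True
        then show ?thesis
          using L(2)[of "z + h" z] by simp
      next
        case False
        then have "norm (z + h) > R"
          using \<open>norm h \<le> 1\<close> norm_diff_ineq[of z h] by linarith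
        then show ?thesis
          using R(2)[of z] R(2)[of "z + h"] False by simp
      qed
    qed (use L(1) in simp)
    also have "\<dots> \<le> ennreal ((L * m + 2 * A) * min 1 (norm h))"
      using True A(1) by (intro ennreal_leI) (simp add: algebra_simps)
    finally show ?thesis .
  next
    case False
    have "(\<integral>\<^sup>+z. ennreal \<bar>\<rho> (z + h) - \<rho> z\<bar> \<partial>lborel) \<le> (\<integral>\<^sup>+z. ennreal \<bar>\<rho> (z + h)\<bar> + ennreal \<bar>\<rho> z\<bar> \<partial>lborel)"
      by (rule nn_integral_mono) (simp flip: ennreal_plus add: ennreal_leI)
    also have "\<dots> = (\<integral>\<^sup>+z. ennreal \<bar>\<rho> (z + h)\<bar> \<partial>lborel) + (\<integral>\<^sup>+z. ennreal \<bar>\<rho> z\<bar> \<partial>lborel)"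
      by (rule nn_integral_add) measurable
    also have "(\<integral>\<^sup>+z. ennreal \<bar>\<rho> (z + h)\<bar> \<partial>lborel) = ennreal A"
      using nn_integral_translate[of "\<lambda>z. ennreal \<bar>\<rho> z\<bar>" h] A(2) by simp
    also have "ennreal A + (\<integral>\<^sup>+z. ennreal \<bar>\<rho> z\<bar> \<partial>lborel) = ennreal (2 * A)"
      using A by (simp flip: ennreal_plus)
    also have "\<dots> \<le> ennreal ((L * m + 2 * A) * min 1 (norm h))"
      using False L(1) m by (intro ennreal_leI) simp
    finally show ?thesis .
  qed
  then show thesis
    using L(1) m A(1) by (intro that[of "L * m + 2 * A"]) auto
qed

text \<open>With the increment placed on the kernel, the convolution is controlled by the L^2 norm
  of \<open>f\<close> alone. The constant depends only on \<rho>, and the factor min(1, |h|^2) is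
  the one whose kernel integral stays bounded as s tends to 1.\<close>

lemma incr_sq_conv_le:
  assumes \<rho>: "\<rho> \<in> test_functions \<Omega>"
  obtains c where "c \<ge> 0" "\<And>f h. f \<in> SqInt lborel \<Longrightarrow>
    incr_sq (conv \<rho> f) h \<le> ennreal (c * (nrm lborel f)\<^sup>2) * ennreal (min 1 ((norm h)\<^sup>2))"
proof -
  obtain c where c: "c \<ge> 0" "\<And>h. (\<integral>\<^sup>+z. ennreal \<bar>\<rho> (z + h) - \<rho> z\<bar> \<partial>lborel) \<le> ennreal (c * min 1 (norm h))"
    using test_functions_increment_L1[OF \<rho>] by blast
  have [measurable]: "\<rho> \<in> borel_measurable borel"
    by (rule test_functions_measurable[OF \<rho>])
  have "incr_sq (conv \<rho> f) h \<le> ennreal (c\<^sup>2 * (nrm lborel f)\<^sup>2) * ennreal (min 1 ((norm h)\<^sup>2))"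
    if f: "f \<in> SqInt lborel" for f h
  proof -
    have [measurable]: "f \<in> borel_measurable borel"
      using SqInt_measurable[OF f] by simp
    have \<rho>S: "\<rho> \<in> SqInt lborel"
      by (rule test_functions_SqInt[OF \<rho>])
    have "conv \<rho> f (x + h) - conv \<rho> f x = conv (\<lambda>z. \<rho> (z + h) - \<rho> z) f x" for x
      unfolding conv_translate_left by (rule conv_diff_left[OF SqInt_translate[OF \<rho>S] \<rho>S f])
    then have "incr_sq (conv \<rho> f) h \<le> (\<integral>\<^sup>+z. ennreal \<bar>\<rho> (z + h) - \<rho> z\<bar> \<partial>lborel)\<^sup>2 * ennreal ((nrm lborel f)\<^sup>2)"
      using conv_Young[of "\<lambda>z. \<rho> (z + h) - \<rho> z" f] nn_integral_sq[OF f] by (simp add: incr_sq_def)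
    also have "\<dots> \<le> (ennreal (c * min 1 (norm h)))\<^sup>2 * ennreal ((nrm lborel f)\<^sup>2)"
      by (intro mult_right_mono power_mono c) auto
    also have "\<dots> = ennreal ((c * min 1 (norm h))\<^sup>2 * (nrm lborel f)\<^sup>2)"
      using c(1) by (subst ennreal_power) (simp_all only: ennreal_mult zero_le_power2 mult_nonneg_nonneg min_def norm_ge_zero split: if_split, auto)
    also have "(c * min 1 (norm h))\<^sup>2 * (nrm lborel f)\<^sup>2 = (c\<^sup>2 * (nrm lborel f)\<^sup>2) * min 1 ((norm h)\<^sup>2)"
      using power2_le_iff_abs_le[of 1 "norm h"] abs_square_le_1[of "norm h"]
      by (simp add: min_def power_mult_distrib) (use power_mono[of "norm h" 1 2] power_mono[of 1 "norm h" 2] in fastforce)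
    finally show ?thesis
      by (simp add: ennreal_mult)
  qed
  then show thesis
    by (intro that[of "c\<^sup>2"]) auto
qed

text \<open>The first order Taylor bound comes with a majorant supported in a fixed ball, so that
  the remainder is small in L^2 and can be paired with a square integrable function.\<close>

lemma test_functions_remainder:
  assumes \<rho>: "\<rho> \<in> test_functions \<Omega>"
  obtains C R where "C \<ge> 0" "R \<ge> 0" "\<And>z h. norm h \<le> 1 \<Longrightarrow>
    \<bar>\<rho> (z + h) - \<rho> z - (\<Sum>i\<in>UNIV. h $ i * partial_deriv i \<rho> z)\<bar> \<le> C * (norm h)\<^sup>2 * indicator (cball 0 R) z"
proof -
  obtain R where R: "R \<ge> 0" "\<And>x. norm x > R \<Longrightarrow> \<rho> x = 0"
    using test_functions_ball[OF \<rho>] by blast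
  have "\<exists>L. L \<ge> 0 \<and> (\<forall>x y. \<bar>partial_deriv i \<rho> x - partial_deriv i \<rho> y\<bar> \<le> L * norm (x - y))" for i
    by (rule test_functions_Lipschitz[OF test_functions_partial_deriv[OF \<rho>, of i]]) auto
  then obtain L where L: "\<And>i. L i \<ge> 0" "\<And>i x y. \<bar>partial_deriv i \<rho> x - partial_deriv i \<rho> y\<bar> \<le> L i * norm (x - y)"
    by metis
  define C where "C = (\<Sum>i\<in>UNIV. L i)"
  have C: "C \<ge> 0"
    unfolding C_def by (rule sum_nonneg) (rule L)
  have taylor: "\<bar>\<rho> (z + h) - \<rho> z - (\<Sum>i\<in>UNIV. h $ i * partial_deriv i \<rho> z)\<bar> \<le> C * (norm h)\<^sup>2" for z h
  proof -
    define D where "D = frechet_derivative \<rho> (at z)"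
    have D: "(\<rho> has_derivative D) (at z)"
      unfolding D_def by (rule frechet_derivative_worksD[OF test_functions_differentiable[OF \<rho>]])
    have lin: "bounded_linear D"
      using D by (rule has_derivative_bounded_linear)
    \<comment> \<open>The mean value inequality is applied to \<rho> - D. The derivative of this
      function at w is the difference of the derivatives of \<rho> at w and at z, which is at most
      \<open>C * norm h\<close> on the ball.\<close>
    have "norm ((\<rho> (z + h) - D (z + h)) - (\<rho> z - D z)) \<le> C * norm h * norm (z + h - z)"
    proof (rule differentiable_bound[of "cball z (norm h)"])
      fix w assume w: "w \<in> cball z (norm h)"
      show "((\<lambda>w. \<rho> w - D w) has_derivative (\<lambda>k. frechet_derivative \<rho> (at w) k - D k)) (at w within cball z (norm h))"
        by (rule has_derivative_diff[OF has_derivative_at_withinI[OF frechet_derivative_worksD[OF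
          test_functions_differentiable[OF \<rho>]]] bounded_linear_imp_has_derivative[OF lin]])
      show "onorm (\<lambda>k. frechet_derivative \<rho> (at w) k - D k) \<le> C * norm h"
      proof (rule onorm_bound)
        show "0 \<le> C * norm h"
          using C by simp
        fix k
        have "frechet_derivative \<rho> (at w) k - D k = (\<Sum>i\<in>UNIV. k $ i * (partial_deriv i \<rho> w - partial_deriv i \<rho> z))"
          unfolding D_def frechet_derivative_eq_sum[OF test_functions_differentiable[OF \<rho>]]
          by (simp add: sum_subtractf right_diff_distrib)
        also have "\<bar>\<dots>\<bar> \<le> (\<Sum>i\<in>UNIV. L i * norm h * norm k)"
        proof (rule order_trans[OF sum_abs sum_mono])
          fix i
          have "\<bar>partial_deriv i \<rho> w - partial_deriv i \<rho> z\<bar> \<le> L i * norm h"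
            using w L(2)[where i = i and x = w and y = z] mult_left_mono[OF _ L(1), of "norm (w - z)" "norm h" i]
            by (simp add: dist_norm norm_minus_commute)
          then show "\<bar>k $ i * (partial_deriv i \<rho> w - partial_deriv i \<rho> z)\<bar> \<le> L i * norm h * norm k"
            unfolding abs_mult
            by (subst mult.commute) (intro mult_mono component_le_norm_cart abs_ge_zero mult_nonneg_nonneg L norm_ge_zero)
        qed
        also have "\<dots> = C * norm h * norm k"
          by (simp add: C_def sum_distrib_right)
        finally show "norm (frechet_derivative \<rho> (at w) k - D k) \<le> C * norm h * norm k"
          by simp
      qed
    qed (auto simp: dist_norm)
    moreover have "D (z + h) = D z + (\<Sum>i\<in>UNIV. h $ i * partial_deriv i \<rho> z)"
      using linear_add[OF bounded_linear.linear[OF lin], of z h]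
      by (simp add: D_def frechet_derivative_eq_sum[OF test_functions_differentiable[OF \<rho>], of z h])
    ultimately show ?thesis
      by (simp add: power2_eq_square algebra_simps)
  qed
  have "\<bar>\<rho> (z + h) - \<rho> z - (\<Sum>i\<in>UNIV. h $ i * partial_deriv i \<rho> z)\<bar> \<le> C * (norm h)\<^sup>2 * indicator (cball 0 (R + 1)) z"
    if "norm h \<le> 1" for z h
  proof (cases "norm z \<le> R + 1")
    case True
    then show ?thesis
      using taylor[of z h] by simp
  next
    case False
    then have "norm (z + h) > R"
      using that norm_diff_ineq[of z h] by linarith
    moreover have "partial_deriv i \<rho> z = 0" for i
      by (rule partial_deriv_eq_0_outside[of "cball 0 R"]) (use R False in auto)
    ultimately show ?thesis
      using R(2)[of z] R(2)[of "z + h"] False by simp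
  qed
  then show thesis
    using C R(1) by (intro that[of C "R + 1"]) auto
qed

lemma conv_remainder:
  assumes "\<rho> \<in> test_functions \<Omega>" "f \<in> SqInt lborel"
  shows "conv \<rho> f (x + h) - conv \<rho> f x - (\<Sum>i\<in>UNIV. h $ i * conv (partial_deriv i \<rho>) f x)
    = (LINT y|lborel. (\<rho> (x - y + h) - \<rho> (x - y) - (\<Sum>i\<in>UNIV. h $ i * partial_deriv i \<rho> (x - y))) * f y)"
proof -
  have 1: "integrable lborel (\<lambda>y. \<rho> (x - y + h) * f y)"
    by (rule conv_integrable[OF SqInt_translate[OF test_functions_SqInt[OF assms(1)]] assms(2)])
  have 2: "integrable lborel (\<lambda>y. \<rho> (x - y) * f y)"
    by (rule conv_integrable[OF test_functions_SqInt[OF assms(1)] assms(2)])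
  have 3: "integrable lborel (\<lambda>y. h $ i * (partial_deriv i \<rho> (x - y) * f y))" for i
    by (rule integrable_mult_right, rule conv_integrable[OF test_functions_SqInt[OF test_functions_partial_deriv[OF assms(1)]] assms(2)])
  have "conv \<rho> f (x + h) = (LINT y|lborel. \<rho> (x - y + h) * f y)"
    by (simp add: conv_def algebra_simps)
  moreover have "(\<Sum>i\<in>UNIV. h $ i * conv (partial_deriv i \<rho>) f x)
      = (LINT y|lborel. (\<Sum>i\<in>UNIV. h $ i * (partial_deriv i \<rho> (x - y) * f y)))"
    using 3 by (simp add: conv_def)
  ultimately show ?thesis
    using 1 2 3 by (simp add: conv_def left_diff_distrib sum_distrib_right mult.assoc)
qed

text \<open>The Taylor remainder of the kernel has L^2 norm of order |h|^2, where
  \<open>sqrt m\<close> accounts for the volume of its support; by Cauchy-Schwarz the remainder of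
  the convolution is of the same order.\<close>

lemma conv_has_derivative:
  assumes \<rho>: "\<rho> \<in> test_functions \<Omega>" and f: "f \<in> SqInt lborel"
  shows "(conv \<rho> f has_derivative (\<lambda>h. \<Sum>i\<in>UNIV. h $ i * conv (partial_deriv i \<rho>) f x)) (at x)"
proof -
  obtain C R where C: "C \<ge> 0" "R \<ge> 0" "\<And>z h. norm h \<le> 1 \<Longrightarrow>
      \<bar>\<rho> (z + h) - \<rho> z - (\<Sum>i\<in>UNIV. h $ i * partial_deriv i \<rho> z)\<bar> \<le> C * (norm h)\<^sup>2 * indicator (cball 0 R) z"
    using test_functions_remainder[OF \<rho>] by blast
  define m where "m = measure lborel (cball 0 R :: (real ^ 'a) set)"
  have m: "m \<ge> 0"
    by (simp add: m_def)
  have [measurable]: "\<rho> \<in> borel_measurable borel" "partial_deriv i \<rho> \<in> borel_measurable borel" for i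
    by (rule test_functions_measurable[OF \<rho>], rule test_functions_measurable[OF test_functions_partial_deriv[OF \<rho>]])
  have bound: "norm (conv \<rho> f (x + h) - conv \<rho> f x - (\<Sum>i\<in>UNIV. h $ i * conv (partial_deriv i \<rho>) f x))
      \<le> (C * sqrt m * nrm lborel f) * (norm h)\<^sup>2" if h: "norm h \<le> 1" for h
  proof -
    define r where "r z = \<rho> (z + h) - \<rho> z - (\<Sum>i\<in>UNIV. h $ i * partial_deriv i \<rho> z)" for z
    have [measurable]: "r \<in> borel_measurable borel"
      unfolding r_def by measurable
    have "(r z)\<^sup>2 \<le> (C * (norm h)\<^sup>2)\<^sup>2 * indicator (cball 0 R) z" for z
      using power_mono[OF C(3)[OF h, of z], of 2] by (cases "norm z \<le> R") (simp_all add: r_def)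
    then have "(\<integral>\<^sup>+z. ennreal ((r z)\<^sup>2) \<partial>lborel) \<le> ennreal ((C * (norm h)\<^sup>2)\<^sup>2 * m)"
      unfolding m_def by (rule nn_integral_cball_le) simp
    then have "(\<integral>\<^sup>+y. ennreal ((r (x - y))\<^sup>2) \<partial>lborel) \<le> ennreal ((C * (norm h)\<^sup>2 * sqrt m)\<^sup>2)"
      using nn_integral_reflect[of "\<lambda>z. ennreal ((r z)\<^sup>2)" x] m by (simp add: power_mult_distrib)
    then have r: "(\<lambda>y. r (x - y)) \<in> SqInt lborel" "nrm lborel (\<lambda>y. r (x - y)) \<le> C * (norm h)\<^sup>2 * sqrt m"
      using C(1) m by (auto intro!: SqInt_bound)
    have "conv \<rho> f (x + h) - conv \<rho> f x - (\<Sum>i\<in>UNIV. h $ i * conv (partial_deriv i \<rho>) f x)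
        = (LINT y|lborel. r (x - y) * f y)"
      using conv_remainder[OF \<rho> f, of x h] by (simp add: r_def)
    also have "\<bar>\<dots>\<bar> \<le> nrm lborel (\<lambda>y. r (x - y)) * nrm lborel f"
      by (rule Cauchy_Schwarz_SqInt[OF r(1) f])
    also have "\<dots> \<le> C * (norm h)\<^sup>2 * sqrt m * nrm lborel f"
      by (rule mult_right_mono[OF r(2) nrm_nonneg])
    finally show ?thesis
      by (simp add: mult_ac)
  qed
  show ?thesis
    unfolding has_derivative_at
  proof
    have "linear (\<lambda>h. \<Sum>i\<in>UNIV. h $ i * conv (partial_deriv i \<rho>) f x)"
      by (rule linearI) (simp_all add: sum.distrib distrib_right sum_distrib_left mult.assoc)
    then show "bounded_linear (\<lambda>h. \<Sum>i\<in>UNIV. h $ i * conv (partial_deriv i \<rho>) f x)"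
      by (simp add: linear_linear)
    show "((\<lambda>h. norm (conv \<rho> f (x + h) - conv \<rho> f x - (\<Sum>i\<in>UNIV. h $ i * conv (partial_deriv i \<rho>) f x)) / norm h) \<longlongrightarrow> 0) (at 0)"
    proof (rule Lim_null_comparison)
      show "((\<lambda>h :: real ^ 'a. (C * sqrt m * nrm lborel f) * norm h) \<longlongrightarrow> 0) (at 0)"
        by (rule tendsto_mult_right_zero, rule tendsto_norm_zero, rule tendsto_ident_at)
      show "\<forall>\<^sub>F h in at 0. norm (norm (conv \<rho> f (x + h) - conv \<rho> f x - (\<Sum>i\<in>UNIV. h $ i * conv (partial_deriv i \<rho>) f x)) / norm h)
          \<le> (C * sqrt m * nrm lborel f) * norm h"
        unfolding eventually_at
      proof (intro exI[of _ 1] conjI ballI impI)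
        fix h :: "real ^ 'a" assume "h \<noteq> 0 \<and> dist h 0 < 1"
        then show "norm (norm (conv \<rho> f (x + h) - conv \<rho> f x - (\<Sum>i\<in>UNIV. h $ i * conv (partial_deriv i \<rho>) f x)) / norm h)
            \<le> (C * sqrt m * nrm lborel f) * norm h"
          using bound[of h] by (simp add: divide_le_eq power2_eq_square mult.assoc)
      qed simp
    qed
  qed
qed

lemma partial_deriv_conv:
  assumes "\<rho> \<in> test_functions \<Omega>" "f \<in> SqInt lborel"
  shows "partial_deriv i (conv \<rho> f) = conv (partial_deriv i \<rho>) f"
proof
  fix x
  have "partial_deriv i (conv \<rho> f) x = (\<Sum>j\<in>UNIV. axis i 1 $ j * conv (partial_deriv j \<rho>) f x)"
    by (rule partial_deriv_eq[OF conv_has_derivative[OF assms]])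
  also have "\<dots> = (\<Sum>j\<in>UNIV. if j = i then conv (partial_deriv j \<rho>) f x else 0)"
    by (intro sum.cong refl) (simp add: axis_def)
  finally show "partial_deriv i (conv \<rho> f) x = conv (partial_deriv i \<rho>) f x"
    by simp
qed

text \<open>All derivatives fall on the kernel, and partial derivatives of test functions are test
  functions, so the induction on the order varies the kernel and keeps \<open>f\<close>
  fixed.\<close>

lemma smooth_conv:
  assumes "\<rho> \<in> test_functions \<Omega>" "f \<in> SqInt lborel"
  shows "smooth (conv \<rho> f)"
proof -
  have "C_k k (conv \<rho> f)" if "\<rho> \<in> test_functions \<Omega>" for k \<rho>
    using that
  proof (induction k arbitrary: \<rho>)
    case 0
    have "isCont (conv \<rho> f) x" for x
      by (rule has_derivative_continuous[OF conv_has_derivative[OF 0 assms(2)]])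
    then show ?case
      by (simp add: continuous_at_imp_continuous_on)
  next
    case (Suc k)
    have "C_k k (partial_deriv i (conv \<rho> f))" for i
      unfolding partial_deriv_conv[OF Suc.prems assms(2)]
      by (rule Suc.IH[OF test_functions_partial_deriv[OF Suc.prems]])
    then show ?case
      using differentiableI[OF conv_has_derivative[OF Suc.prems assms(2)]] by simp
  qed
  then show ?thesis
    using assms(1) by (simp add: smooth_def)
qed

text \<open>The convolution is supported in the Minkowski sum of \<open>B\<close> and
  \<open>K\<close>, which is compact. The ball \<open>B\<close> need not be centred at 0: an
  off-centre kernel moves \<open>K\<close> into \<Omega>.\<close>

lemma conv_test_functions:
  assumes \<rho>: "\<rho> \<in> test_functions UNIV" "\<And>x. x \<notin> B \<Longrightarrow> \<rho> x = 0" "compact B"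
    and f: "f \<in> SqInt lborel" "\<And>x. x \<notin> K \<Longrightarrow> f x = 0" "compact K"
    and sub: "\<And>x y. x \<in> B \<Longrightarrow> y \<in> K \<Longrightarrow> x + y \<in> \<Omega>"
  shows "conv \<rho> f \<in> test_functions \<Omega>"
proof (rule test_functionsI[OF smooth_conv[OF \<rho>(1) f(1)]])
  show "compact {x + y |x y. x \<in> B \<and> y \<in> K}"
    by (rule compact_sums[OF \<rho>(3) f(3)])
  show "{x + y |x y. x \<in> B \<and> y \<in> K} \<subseteq> \<Omega>"
    using sub by auto
  fix x assume x: "x \<notin> {x + y |x y. x \<in> B \<and> y \<in> K}"
  have "\<rho> (x - y) * f y = 0" for y
  proof -
    have "x - y \<notin> B \<or> y \<notin> K"
      using x by force
    then show ?thesis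
      using \<rho>(2) f(2) by auto
  qed
  then show "conv \<rho> f x = 0"
    unfolding conv_def by (simp only: Bochner_Integration.integral_zero)
qed

subsection \<open>Mollifiers\<close>

text \<open>A cutoff divided by its integral. The cutoff is 1 on the ball of radius
  \<open>e / 2\<close>, so its integral is at least the volume of that ball; this gives the upper
  bound. The centre \<open>z\<close> is free because inward shifts use kernels concentrated away
  from 0.\<close>

lemma mollifier_exists:
  fixes z :: "real ^ 'n"
  assumes "e > 0"
  obtains \<rho> where "mollifier \<rho>" "\<And>x. x \<notin> cball z e \<Longrightarrow> \<rho> x = 0"
    "\<And>x. \<rho> x \<le> 1 / (unit_ball_vol (real CARD('n)) * (e / 2) ^ CARD('n))"
proof -
  define I where "I = (LINT x|lborel. cutoff z (e / 2) x)"
  define V where "V = unit_ball_vol (real CARD('n)) * (e / 2) ^ CARD('n)"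
  have test: "cutoff z (e / 2) \<in> test_functions UNIV"
    using assms by (intro cutoff_test_function) auto
  have int: "integrable lborel (cutoff z (e / 2))"
    by (rule test_functions_integrable[OF test])
  have V: "V > 0"
    using assms by (simp add: V_def)
  have "V = measure lborel (cball z (e / 2))"
    using assms content_cball[of "e / 2" z] by (simp add: V_def)
  also have "\<dots> = (LINT x|lborel. indicator (cball z (e / 2)) x)"
    by simp
  also have "\<dots> \<le> I"
    unfolding I_def
  proof (rule integral_mono[OF _ int])
    show "integrable lborel (indicator (cball z (e / 2)) :: real ^ 'n \<Rightarrow> real)"
      by (rule integrable_real_indicator) (use emeasure_lborel_cball_finite[of z "e / 2"] in \<open>simp_all add: less_top\<close>)
    show "indicator (cball z (e / 2)) x \<le> cutoff z (e / 2) x" for x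
      using assms by (cases "x \<in> cball z (e / 2)") (simp_all add: cutoff_eq_1 cutoff_nonneg dist_commute)
  qed
  finally have VI: "V \<le> I" .
  then have I: "I > 0"
    using V by linarith
  show thesis
  proof
    have "(\<lambda>x. (1 / I) * cutoff z (e / 2) x) \<in> test_functions UNIV"
      by (rule test_functions_cmult[OF test])
    moreover have "(LINT x|lborel. (1 / I) * cutoff z (e / 2) x) = 1"
      using I by (simp add: I_def)
    ultimately show "mollifier (\<lambda>x. (1 / I) * cutoff z (e / 2) x)"
      using I by (simp add: mollifier_def cutoff_nonneg)
    show "(1 / I) * cutoff z (e / 2) x = 0" if "x \<notin> cball z e" for x
      using that assms cutoff_eq_0[of "e / 2" x z] by (simp add: dist_commute)
    fix x
    have "(1 / I) * cutoff z (e / 2) x \<le> 1 / I"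
      using I assms cutoff_le_1[of "e / 2" z x] by (simp add: divide_le_cancel)
    also have "\<dots> \<le> 1 / V"
      using V VI by (simp add: frac_le)
    finally show "(1 / I) * cutoff z (e / 2) x \<le> 1 / (unit_ball_vol (real CARD('n)) * (e / 2) ^ CARD('n))"
      by (simp add: V_def)
  qed
qed

text \<open>On the ball of radius e the mollifier is at most a constant times e^(-N), which is at
  most the same constant times e^(2s) |h|^(-N-2s). The constant is the inverse volume of the ball of
  radius 1/2.\<close>

lemma mollify_error_gagliardo:
  fixes v :: "real ^ 'n \<Rightarrow> real"
  assumes v: "v \<in> SqInt lborel" and e: "e > 0" and \<rho>: "mollifier \<rho>" "\<And>x. x \<notin> cball 0 e \<Longrightarrow> \<rho> x = 0"
    "\<And>x. \<rho> x \<le> 1 / (unit_ball_vol (real CARD('n)) * (e / 2) ^ CARD('n))" and s: "s > 0"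
  shows "(\<integral>\<^sup>+x. ennreal ((conv \<rho> v x - v x)\<^sup>2) \<partial>lborel)
    \<le> ennreal (2 ^ CARD('n) / unit_ball_vol (real CARD('n)) * e powr (2 * s)) * (\<integral>\<^sup>+h. kern s h * incr_sq v h \<partial>lborel)"
proof -
  define c where "c = 2 ^ CARD('n) / unit_ball_vol (real CARD('n))"
  have c: "c > 0"
    by (simp add: c_def)
  have [measurable]: "v \<in> borel_measurable borel"
    using SqInt_measurable[OF v] by simp
  have "(\<integral>\<^sup>+x. ennreal ((conv \<rho> v x - v x)\<^sup>2) \<partial>lborel) \<le> (\<integral>\<^sup>+h. ennreal (\<rho> h) * incr_sq v h \<partial>lborel)"
    by (rule mollify_error[OF \<rho>(1) v])
  also have "\<dots> \<le> (\<integral>\<^sup>+h. ennreal (c * e powr (2 * s)) * (kern s h * incr_sq v h) \<partial>lborel)"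
  proof (rule nn_integral_mono)
    fix h :: "real ^ 'n"
    show "ennreal (\<rho> h) * incr_sq v h \<le> ennreal (c * e powr (2 * s)) * (kern s h * incr_sq v h)"
    \<comment> \<open>At \<open>h = 0\<close> the kernel takes the value 0, but the increment
      vanishes as well; off the ball \<rho> vanishes.\<close>
    proof (cases "h = 0 \<or> h \<notin> cball 0 e")
      case True
      then show ?thesis
        using \<rho>(2)[of h] by (auto simp: incr_sq_def)
    next
      case False
      then have h: "0 < norm h" "norm h \<le> e"
        by auto
      have "\<rho> h \<le> 1 / (unit_ball_vol (real CARD('n)) * (e / 2) ^ CARD('n))"
        by (rule \<rho>(3))
      also have "\<dots> = c * e powr (2 * s) * (1 / e powr (real CARD('n) + 2 * s))"
        using e by (simp add: c_def powr_add powr_realpow power_divide field_simps)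
      also have "\<dots> \<le> c * e powr (2 * s) * (1 / norm h powr (real CARD('n) + 2 * s))"
        using h c s e by (intro mult_left_mono divide_left_mono powr_mono2 mult_pos_pos) auto
      finally have "ennreal (\<rho> h) \<le> ennreal (c * e powr (2 * s) * (1 / norm h powr (real CARD('n) + 2 * s)))"
        by (rule ennreal_leI)
      also have "\<dots> = ennreal (c * e powr (2 * s)) * kern s h"
        unfolding kern_def using c by (intro ennreal_mult) auto
      finally show ?thesis
        by (simp add: mult_right_mono mult.assoc[symmetric])
    qed
  qed
  also have "\<dots> = ennreal (c * e powr (2 * s)) * (\<integral>\<^sup>+h. kern s h * incr_sq v h \<partial>lborel)"
    by (rule nn_integral_cmult) measurable
  finally show ?thesis
    by (simp add: c_def)
qed

subsection \<open>Consequences of the normalization\<close>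

text \<open>The fractional energy as an integral over increments. It agrees with
  \<open>frac_energy\<close> on Borel functions and on functions that are a.e. equal to
  them.\<close>

definition energy :: "(real \<Rightarrow> real) \<Rightarrow> real \<Rightarrow> (real ^ 'n \<Rightarrow> real) \<Rightarrow> ennreal" where
  "energy C s v = ennreal (C s / 2) * (\<integral>\<^sup>+h. kern s h * incr_sq v h \<partial>lborel)"

lemma frac_energy_eq:
  assumes "v \<in> borel_measurable lebesgue" "v' \<in> borel_measurable borel" "AE x in lebesgue. v x = v' x"
  shows "frac_energy C s v = energy C s v'"
  by (simp add: frac_energy_def energy_def gagliardo_eq[OF assms])

lemma frac_energy_borel:
  assumes "v \<in> borel_measurable borel"
  shows "frac_energy C s v = energy C s v"
  by (rule frac_energy_eq) (use assms in \<open>auto intro: measurable_completion\<close>)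

lemma bbm_test_function:
  fixes \<Omega> :: "(real ^ 'n) set"
  assumes \<Omega>: "open \<Omega>" "bounded \<Omega>" and bbm: "bbm_normalization \<Omega> C" and \<phi>: "\<phi> \<in> test_functions \<Omega>"
  shows "((\<lambda>s. energy C s \<phi>) \<longlongrightarrow> ennreal (dirichlet \<phi>)) (at_left 1)"
proof -
  have "zero_ext \<Omega> \<phi> = \<phi>"
    using test_functions_eq_0[OF \<phi>] by (auto simp: zero_ext_def)
  moreover have "((\<lambda>s. frac_energy C s (zero_ext \<Omega> \<phi>)) \<longlongrightarrow> ennreal ((grad_norm \<Omega> \<phi>)\<^sup>2)) (at_left 1)"
    using bbm test_functions_H01[OF \<Omega> \<phi>] by (simp add: bbm_normalization_def)
  ultimately show ?thesis
    by (simp add: grad_norm_test_function[OF \<Omega> \<phi>] frac_energy_borel[OF test_functions_measurable[OF \<phi>]])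
qed

section \<open>Scaling of the fractional and the classical energy\<close>

lemma incr_sq_affine:
  fixes \<phi> :: "real ^ 'n \<Rightarrow> real"
  assumes [measurable]: "\<phi> \<in> borel_measurable borel" and a: "a > 0"
  shows "incr_sq \<phi> (a *\<^sub>R h) = ennreal (a ^ CARD('n)) * incr_sq (\<lambda>x. \<phi> (c + a *\<^sub>R x)) h"
proof -
  have "incr_sq \<phi> (a *\<^sub>R h) = ennreal (\<bar>a\<bar> ^ DIM(real ^ 'n)) *
      (\<integral>\<^sup>+x. ennreal ((\<phi> (c + a *\<^sub>R x + a *\<^sub>R h) - \<phi> (c + a *\<^sub>R x))\<^sup>2) \<partial>lborel)"
    unfolding incr_sq_def by (rule nn_integral_affine) (use a in \<open>measurable, simp\<close>)
  then show ?thesis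
    using a by (simp add: incr_sq_def scaleR_add_right add.assoc)
qed

lemma kern_scale:
  fixes h :: "real ^ 'n"
  assumes "a > 0"
  shows "kern s (a *\<^sub>R h) = ennreal (a powr - (real CARD('n) + 2 * s)) * kern s h"
proof -
  have "1 / norm (a *\<^sub>R h) powr (real CARD('n) + 2 * s)
      = a powr - (real CARD('n) + 2 * s) * (1 / norm h powr (real CARD('n) + 2 * s))"
    using assms by (simp add: powr_mult divide_inverse del: minus_add_distrib add: powr_minus[of a "real CARD('n) + 2 * s"])
  then show ?thesis
    unfolding kern_def by (simp only:) (rule ennreal_mult, simp_all)
qed

text \<open>The exponent N - 2s collects a^N from the integral over x, a^N from the integral over h
  and a^(-N-2s) from the kernel.\<close>

lemma energy_affine:
  fixes \<phi> :: "real ^ 'n \<Rightarrow> real"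
  assumes [measurable]: "\<phi> \<in> borel_measurable borel" and a: "a > 0"
  shows "energy C s \<phi> = ennreal (a powr (real CARD('n) - 2 * s)) * energy C s (\<lambda>x. \<phi> (c + a *\<^sub>R x))"
proof -
  let ?\<psi> = "\<lambda>x. \<phi> (c + a *\<^sub>R x)"
  let ?N = "real CARD('n)"
  have "(\<integral>\<^sup>+h. kern s h * incr_sq \<phi> h \<partial>lborel)
      = ennreal (\<bar>a\<bar> ^ DIM(real ^ 'n)) * (\<integral>\<^sup>+h. kern s (0 + a *\<^sub>R h) * incr_sq \<phi> (0 + a *\<^sub>R h) \<partial>lborel)"
    by (rule nn_integral_affine) (use a in \<open>measurable, simp\<close>)
  also have "(\<integral>\<^sup>+h. kern s (0 + a *\<^sub>R h) * incr_sq \<phi> (0 + a *\<^sub>R h) \<partial>lborel)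
      = (\<integral>\<^sup>+h. ennreal (a powr - (?N + 2 * s) * a ^ CARD('n)) * (kern s h * incr_sq ?\<psi> h) \<partial>lborel)"
  proof (rule nn_integral_cong)
    fix h :: "real ^ 'n"
    have "kern s (a *\<^sub>R h) * incr_sq \<phi> (a *\<^sub>R h)
        = ennreal (a powr - (?N + 2 * s)) * kern s h * (ennreal (a ^ CARD('n)) * incr_sq ?\<psi> h)"
      by (simp only: incr_sq_affine[OF assms, of h c] kern_scale[OF a])
    also have "\<dots> = ennreal (a powr - (?N + 2 * s) * a ^ CARD('n)) * (kern s h * incr_sq ?\<psi> h)"
      using a by (simp add: ennreal_mult mult_ac del: minus_add_distrib)
    finally show "kern s (0 + a *\<^sub>R h) * incr_sq \<phi> (0 + a *\<^sub>R h)
        = ennreal (a powr - (?N + 2 * s) * a ^ CARD('n)) * (kern s h * incr_sq ?\<psi> h)"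
      by simp
  qed
  also have "\<dots> = ennreal (a powr - (?N + 2 * s) * a ^ CARD('n)) * (\<integral>\<^sup>+h. kern s h * incr_sq ?\<psi> h \<partial>lborel)"
    by (rule nn_integral_cmult) measurable
  finally have eq: "(\<integral>\<^sup>+h. kern s h * incr_sq \<phi> h \<partial>lborel)
      = ennreal (\<bar>a\<bar> ^ DIM(real ^ 'n)) * (ennreal (a powr - (?N + 2 * s) * a ^ CARD('n)) * (\<integral>\<^sup>+h. kern s h * incr_sq ?\<psi> h \<partial>lborel))" .
  have "\<bar>a\<bar> ^ DIM(real ^ 'n) * (a powr - (?N + 2 * s) * a ^ CARD('n)) = a powr ?N * (a powr - (?N + 2 * s) * a powr ?N)"
    using a by (simp add: powr_realpow)
  also have "\<dots> = a powr (?N - 2 * s)"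
    by (simp flip: powr_add)
  finally have "ennreal (\<bar>a\<bar> ^ DIM(real ^ 'n)) * ennreal (a powr - (?N + 2 * s) * a ^ CARD('n)) = ennreal (a powr (?N - 2 * s))"
    using a by (simp flip: ennreal_mult)
  then show ?thesis
    unfolding energy_def eq by (simp add: mult.assoc[symmetric]) (simp add: mult_ac)
qed

text \<open>The volume contributes a^N and the two derivatives a^(-2). The exponent is the value at
  s = 1 of the one for the fractional energy, so the limits of both sides match.\<close>

lemma dirichlet_affine:
  fixes \<phi> :: "real ^ 'n \<Rightarrow> real"
  assumes \<phi>: "\<phi> \<in> test_functions \<Omega>" and a: "a > 0" and \<psi>: "(\<lambda>x. \<phi> (c + a *\<^sub>R x)) \<in> test_functions \<Omega>'"
  shows "dirichlet \<phi> = a powr (real CARD('n) - 2) * dirichlet (\<lambda>x. \<phi> (c + a *\<^sub>R x))"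
proof -
  let ?\<psi> = "\<lambda>x. \<phi> (c + a *\<^sub>R x)"
  have "(nrm lborel (partial_deriv i \<phi>))\<^sup>2 = a powr (real CARD('n) - 2) * (nrm lborel (partial_deriv i ?\<psi>))\<^sup>2" for i
  proof -
    have [measurable]: "partial_deriv i \<phi> \<in> borel_measurable borel"
      by (rule test_functions_measurable[OF test_functions_partial_deriv[OF \<phi>]])
    have pd: "partial_deriv i \<phi> (c + a *\<^sub>R x) = partial_deriv i ?\<psi> x / a" for x
      using partial_deriv_affine[OF test_functions_differentiable[OF \<phi>], of i c a x] a by simp
    have "ennreal ((nrm lborel (partial_deriv i \<phi>))\<^sup>2) = (\<integral>\<^sup>+x. ennreal ((partial_deriv i \<phi> x)\<^sup>2) \<partial>lborel)"
      by (rule nn_integral_sq[symmetric, OF test_functions_SqInt[OF test_functions_partial_deriv[OF \<phi>]]])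
    also have "\<dots> = ennreal (\<bar>a\<bar> ^ DIM(real ^ 'n)) * (\<integral>\<^sup>+x. ennreal ((partial_deriv i \<phi> (c + a *\<^sub>R x))\<^sup>2) \<partial>lborel)"
      by (rule nn_integral_affine) (use a in \<open>measurable, simp\<close>)
    also have "(\<integral>\<^sup>+x. ennreal ((partial_deriv i \<phi> (c + a *\<^sub>R x))\<^sup>2) \<partial>lborel)
        = ennreal ((nrm lborel (\<lambda>x. 1 / a * partial_deriv i ?\<psi> x))\<^sup>2)"
      unfolding pd using nn_integral_sq[OF SqInt_cmult[OF test_functions_SqInt[OF test_functions_partial_deriv[OF \<psi>, of i]]], of "1 / a"]
      by simp
    also have "ennreal (\<bar>a\<bar> ^ DIM(real ^ 'n)) * \<dots> = ennreal (a ^ CARD('n) * (1 / a)\<^sup>2 * (nrm lborel (partial_deriv i ?\<psi>))\<^sup>2)"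
      using a by (simp only: nrm_cmult power_mult_distrib power2_abs mult.assoc) (simp flip: ennreal_mult)
    also have "a ^ CARD('n) * (1 / a)\<^sup>2 = a powr (real CARD('n) - 2)"
      using a by (simp add: powr_diff powr_realpow power_divide)
    finally show ?thesis
      by simp
  qed
  then show ?thesis
    by (simp add: dirichlet_def sum_distrib_left)
qed

text \<open>Mollified functions need not be supported in \<Omega>, whereas the normalization speaks
  only about functions on \<Omega>. An affine map carries the support into a ball inside \<Omega>,
  and the scaling factors of the two energies agree in the limit.\<close>

lemma bbm_test_function_UNIV:
  fixes \<Omega> :: "(real ^ 'n) set"
  assumes \<Omega>: "open \<Omega>" "bounded \<Omega>" "\<Omega> \<noteq> {}" and bbm: "bbm_normalization \<Omega> C"
    and \<phi>: "\<phi> \<in> test_functions (UNIV :: (real ^ 'n) set)"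
  shows "((\<lambda>s. energy C s \<phi>) \<longlongrightarrow> ennreal (dirichlet \<phi>)) (at_left 1)"
proof -
  obtain x0 r where r: "r > 0" "cball x0 r \<subseteq> \<Omega>"
    using \<Omega>(1,3) open_contains_cball by blast
  obtain R where R: "R \<ge> 0" "\<And>x. norm x > R \<Longrightarrow> \<phi> x = 0"
    using test_functions_ball[OF \<phi>] by blast
  \<comment> \<open>With this factor, points at distance more than \<open>r\<close> from
    \<open>x0\<close> are sent beyond norm \<open>R + 1\<close>, where \<phi> vanishes.\<close>
  define a where "a = (R + 1) / r"
  have a: "a > 0"
    using r(1) R(1) by (simp add: a_def)
  define c where "c = - (a *\<^sub>R x0)"
  let ?\<psi> = "\<lambda>x. \<phi> (c + a *\<^sub>R x)"
  have \<psi>: "?\<psi> \<in> test_functions \<Omega>"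
  proof (rule test_functionsI[OF smooth_affine[OF test_functions_smooth[OF \<phi>]] compact_cball r(2)])
    fix x assume "x \<notin> cball x0 r"
    then have "a * norm (x - x0) > a * r"
      using a by (simp add: dist_norm norm_minus_commute)
    moreover have "a * r = R + 1"
      using r(1) by (simp add: a_def)
    moreover have "norm (c + a *\<^sub>R x) = a * norm (x - x0)"
      using a by (simp add: c_def flip: scaleR_diff_right)
    ultimately show "?\<psi> x = 0"
      by (intro R(2)) linarith
  qed
  have "((\<lambda>s. ennreal (a powr (real CARD('n) - 2 * s)) * energy C s ?\<psi>)
      \<longlongrightarrow> ennreal (a powr (real CARD('n) - 2 * 1)) * ennreal (dirichlet ?\<psi>)) (at_left 1)"
  proof (rule tendsto_mult_ennreal)
    show "((\<lambda>s. ennreal (a powr (real CARD('n) - 2 * s))) \<longlongrightarrow> ennreal (a powr (real CARD('n) - 2 * 1))) (at_left 1)"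
      using a by (intro tendsto_intros) auto
  qed (use bbm_test_function[OF \<Omega>(1,2) bbm \<psi>] in auto)
  moreover have "energy C s \<phi> = ennreal (a powr (real CARD('n) - 2 * s)) * energy C s ?\<psi>" for s
    by (rule energy_affine[OF test_functions_measurable[OF \<phi>] a])
  moreover have "ennreal (a powr (real CARD('n) - 2 * 1)) * ennreal (dirichlet ?\<psi>) = ennreal (dirichlet \<phi>)"
    using dirichlet_affine[OF \<phi> a \<psi>] by (simp add: dirichlet_nonneg flip: ennreal_mult)
  ultimately show ?thesis
    by simp
qed

section \<open>A bound for the normalized kernel near s = 1\<close>

lemma incr_sq_ge:
  fixes v :: "real ^ 'n \<Rightarrow> real"
  assumes "\<And>x. x \<in> S \<Longrightarrow> (v (x + h) - v x)\<^sup>2 = b" "S \<in> sets borel"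
  shows "ennreal b * emeasure lborel S \<le> incr_sq v h"
proof -
  have "ennreal b * emeasure lborel S = (\<integral>\<^sup>+x. ennreal b * indicator S x \<partial>lborel)"
    using assms(2) by (simp add: nn_integral_cmult_indicator)
  also have "\<dots> \<le> incr_sq v h"
    unfolding incr_sq_def
    by (rule nn_integral_mono) (use assms(1) in \<open>auto simp: indicator_def\<close>)
  finally show ?thesis .
qed

text \<open>
  The coordinate functions, cut off, control small increments; a narrow bump controls large ones.
\<close>

lemma min_kernel_dominated:
  fixes \<Omega> :: "(real ^ 'n) set"
  assumes \<Omega>: "open \<Omega>" "\<Omega> \<noteq> {}"
  obtains \<phi> \<phi>0 k where "\<And>i::'n. \<phi> i \<in> test_functions \<Omega>" "\<phi>0 \<in> test_functions \<Omega>" "k \<ge> 0"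
    "\<And>h. ennreal (min 1 ((norm h)\<^sup>2)) \<le> ennreal k * ((\<Sum>i\<in>UNIV. incr_sq (\<phi> i) h) + incr_sq \<phi>0 h)"
proof -
  obtain x0 R where R: "R > 0" "cball x0 R \<subseteq> \<Omega>"
    using \<Omega> open_contains_cball by blast
  \<comment> \<open>The cutoff of radius \<open>2 * r\<close> is supported in the ball of radius
    \<open>4 * r\<close>, which is the ball of radius \<open>R\<close> inside \<Omega>.\<close>
  define r where "r = R / 4"
  have r: "r > 0" "cball x0 (2 * (2 * r)) \<subseteq> \<Omega>"
    using R by (simp_all add: r_def)
  \<comment> \<open>Each of these has slope exactly 1 in its coordinate on the ball of radius
    \<open>2 * r\<close>. For |h| \<le> r and x in the ball of radius \<open>r\<close>, both x and x
    + h lie there, so the increment equals \<open>h $ i\<close>.\<close>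
  define \<phi> where "\<phi> i x = (x $ i - x0 $ i) * cutoff x0 (2 * r) x" for i x
  \<comment> \<open>Equal to 1 on the ball of radius \<open>r / 4\<close> and 0 off the ball of
    radius \<open>r / 2\<close>: an increment longer than \<open>r\<close> takes every point of the
    former out of the latter.\<close>
  define \<phi>0 where "\<phi>0 = cutoff x0 (r / 4)"
  define m1 where "m1 = measure lborel (cball x0 r)"
  define m2 where "m2 = measure lborel (cball x0 (r / 4))"
  have m: "m1 > 0" "m2 > 0"
    using r(1) content_cball_pos[of r x0] content_cball_pos[of "r / 4" x0] by (simp_all add: m1_def m2_def)
  have em: "emeasure lborel (cball x0 \<rho>) = ennreal (measure lborel (cball x0 \<rho>))" for \<rho>
    by (rule emeasure_eq_ennreal_measure)
      (use emeasure_lborel_cball_finite[of x0 \<rho>] in \<open>simp only: infinity_ennreal_def less_top\<close>)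
  show thesis
  proof
    show "\<phi> i \<in> test_functions \<Omega>" for i
      unfolding \<phi>_def
      by (rule test_functions_mult_smooth[OF cutoff_test_function[OF _ r(2)] smooth_diff[OF smooth_component smooth_const]])
        (use r(1) in simp)
    show "\<phi>0 \<in> test_functions \<Omega>"
      unfolding \<phi>0_def
    proof (rule cutoff_test_function)
      have "cball x0 (2 * (r / 4)) \<subseteq> cball x0 (2 * (2 * r))"
        using r(1) by (intro subset_cball) simp
      then show "cball x0 (2 * (r / 4)) \<subseteq> \<Omega>"
        using r(2) by (rule subset_trans)
    qed (use r(1) in simp)
    \<comment> \<open>One constant serves both ranges of h: the summand \<open>1 / m1\<close> covers
      the short increments and \<open>1 / m2\<close> the long ones.\<close>
    show "0 \<le> 1 / m1 + 1 / m2"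
      using m by simp
    fix h :: "real ^ 'n"
    show "ennreal (min 1 ((norm h)\<^sup>2)) \<le> ennreal (1 / m1 + 1 / m2) * ((\<Sum>i\<in>UNIV. incr_sq (\<phi> i) h) + incr_sq \<phi>0 h)"
    proof (cases "norm h \<le> r")
      case True
      have "ennreal ((h $ i)\<^sup>2) * emeasure lborel (cball x0 r) \<le> incr_sq (\<phi> i) h" for i
      proof (rule incr_sq_ge)
        fix x assume x: "x \<in> cball x0 r"
        have "dist (x + h) x0 \<le> 2 * r"
          using x True norm_triangle_ineq[of "x - x0" h] by (simp add: dist_norm norm_minus_commute algebra_simps)
        then show "(\<phi> i (x + h) - \<phi> i x)\<^sup>2 = (h $ i)\<^sup>2"
          using x r(1) by (simp add: \<phi>_def cutoff_eq_1 dist_commute)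
      qed simp
      then have "(\<Sum>i\<in>UNIV. ennreal ((h $ i)\<^sup>2) * ennreal m1) \<le> (\<Sum>i\<in>UNIV. incr_sq (\<phi> i) h)"
        by (intro sum_mono) (simp add: em m1_def)
      moreover have "(\<Sum>i\<in>UNIV. ennreal ((h $ i)\<^sup>2) * ennreal m1) = ennreal ((norm h)\<^sup>2 * m1)"
        using m unfolding power2_norm_eq_inner inner_vec_def
        by (simp add: power2_eq_square sum_distrib_right flip: ennreal_mult)
      ultimately have le: "ennreal ((norm h)\<^sup>2 * m1) \<le> (\<Sum>i\<in>UNIV. incr_sq (\<phi> i) h) + incr_sq \<phi>0 h"
        by (simp add: add_increasing2)
      have "ennreal (min 1 ((norm h)\<^sup>2)) \<le> ennreal (1 / m1 + 1 / m2) * ennreal ((norm h)\<^sup>2 * m1)"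
        using m by (simp add: distrib_right min_le_iff_disj add_increasing2 flip: ennreal_mult)
      also have "\<dots> \<le> ennreal (1 / m1 + 1 / m2) * ((\<Sum>i\<in>UNIV. incr_sq (\<phi> i) h) + incr_sq \<phi>0 h)"
        by (intro mult_left_mono le) simp
      finally show ?thesis .
    next
      case False
      have "ennreal 1 * emeasure lborel (cball x0 (r / 4)) \<le> incr_sq \<phi>0 h"
      proof (rule incr_sq_ge)
        fix x assume x: "x \<in> cball x0 (r / 4)"
        have "dist (x + h) x0 \<ge> 2 * (r / 4)"
          using x False r(1) norm_triangle_ineq4[of "x + h - x0" "x - x0"] by (simp add: dist_norm norm_minus_commute)
        then show "(\<phi>0 (x + h) - \<phi>0 x)\<^sup>2 = 1"
          using x r(1) by (simp add: \<phi>0_def cutoff_eq_0 cutoff_eq_1 dist_commute)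
      qed simp
      then have le: "ennreal m2 \<le> (\<Sum>i\<in>UNIV. incr_sq (\<phi> i) h) + incr_sq \<phi>0 h"
        by (simp add: em m2_def add_increasing)
      have "min 1 ((norm h)\<^sup>2) \<le> (1 / m1 + 1 / m2) * m2"
        using m by (simp add: distrib_right min_le_iff_disj)
      then have "ennreal (min 1 ((norm h)\<^sup>2)) \<le> ennreal ((1 / m1 + 1 / m2) * m2)"
        by (rule ennreal_leI)
      also have "\<dots> = ennreal (1 / m1 + 1 / m2) * ennreal m2"
        using m by (intro ennreal_mult) auto
      also have "\<dots> \<le> ennreal (1 / m1 + 1 / m2) * ((\<Sum>i\<in>UNIV. incr_sq (\<phi> i) h) + incr_sq \<phi>0 h)"
        by (intro mult_left_mono le) simp
      finally show ?thesis .
    qed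
  qed
qed

text \<open>This is the form in which the smallness of \<open>C s\<close> near 1 enters. The
  normalization is applied to the finitely many test functions that dominate min(1, |h|^2); their
  energies converge and are therefore eventually below their limits plus 1.\<close>

lemma min_kernel_bounded:
  fixes \<Omega> :: "(real ^ 'n) set"
  assumes \<Omega>: "open \<Omega>" "bounded \<Omega>" "\<Omega> \<noteq> {}" and bbm: "bbm_normalization \<Omega> C"
  obtains A where "A \<ge> 0"
    "\<forall>\<^sub>F s in at_left 1. ennreal (C s / 2) * (\<integral>\<^sup>+h. kern s h * ennreal (min 1 ((norm (h :: real ^ 'n))\<^sup>2)) \<partial>lborel) \<le> ennreal A"
proof -
  obtain \<phi> \<phi>0 k where \<phi>: "\<And>i::'n. \<phi> i \<in> test_functions \<Omega>" "\<phi>0 \<in> test_functions \<Omega>" "k \<ge> 0"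
    "\<And>h. ennreal (min 1 ((norm h)\<^sup>2)) \<le> ennreal k * ((\<Sum>i\<in>UNIV. incr_sq (\<phi> i) h) + incr_sq \<phi>0 h)"
    using min_kernel_dominated[OF \<Omega>(1,3)] by blast
  have [measurable]: "\<phi>0 \<in> borel_measurable borel" "\<phi> i \<in> borel_measurable borel" for i
    by (rule test_functions_measurable[OF \<phi>(2)], rule test_functions_measurable[OF \<phi>(1)])
  have ev: "\<forall>\<^sub>F s in at_left 1. energy C s \<psi> \<le> ennreal (dirichlet \<psi> + 1)" if "\<psi> \<in> test_functions \<Omega>" for \<psi>
  proof -
    have "ennreal (dirichlet \<psi>) < ennreal (dirichlet \<psi> + 1)"
      using dirichlet_nonneg[of \<psi>] by (intro ennreal_lessI) auto
    from order_tendstoD(2)[OF bbm_test_function[OF \<Omega>(1,2) bbm that] this] show ?thesis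
      by (rule eventually_mono) simp
  qed
  define A where "A = k * ((\<Sum>i\<in>UNIV. dirichlet (\<phi> i) + 1) + (dirichlet \<phi>0 + 1))"
  have sum_nn: "0 \<le> (\<Sum>i\<in>UNIV. dirichlet (\<phi> i) + 1)"
    by (rule sum_nonneg) (simp add: dirichlet_nonneg)
  have "\<forall>\<^sub>F s in at_left 1. \<forall>i. energy C s (\<phi> i) \<le> ennreal (dirichlet (\<phi> i) + 1)"
    by (rule eventually_all_finite) (rule ev[OF \<phi>(1)])
  then have "\<forall>\<^sub>F s in at_left 1. ennreal (C s / 2) * (\<integral>\<^sup>+h. kern s h * ennreal (min 1 ((norm (h :: real ^ 'n))\<^sup>2)) \<partial>lborel) \<le> ennreal A"
    using ev[OF \<phi>(2)]
  proof eventually_elim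
    case (elim s)
    have "(\<integral>\<^sup>+h. kern s h * ennreal (min 1 ((norm (h :: real ^ 'n))\<^sup>2)) \<partial>lborel)
        \<le> (\<integral>\<^sup>+h. ennreal k * ((\<Sum>i\<in>UNIV. kern s h * incr_sq (\<phi> i) h) + kern s h * incr_sq \<phi>0 h) \<partial>lborel)"
    proof (rule nn_integral_mono)
      fix h :: "real ^ 'n"
      have "kern s h * ennreal (min 1 ((norm h)\<^sup>2)) \<le> kern s h * (ennreal k * ((\<Sum>i\<in>UNIV. incr_sq (\<phi> i) h) + incr_sq \<phi>0 h))"
        by (rule mult_left_mono[OF \<phi>(4)]) simp
      also have "\<dots> = ennreal k * ((\<Sum>i\<in>UNIV. kern s h * incr_sq (\<phi> i) h) + kern s h * incr_sq \<phi>0 h)"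
        by (simp add: distrib_left sum_distrib_left mult.left_commute)
      finally show "kern s h * ennreal (min 1 ((norm h)\<^sup>2)) \<le> ennreal k * ((\<Sum>i\<in>UNIV. kern s h * incr_sq (\<phi> i) h) + kern s h * incr_sq \<phi>0 h)" .
    qed
    also have "\<dots> = ennreal k * ((\<Sum>i\<in>UNIV. \<integral>\<^sup>+h. kern s h * incr_sq (\<phi> i) h \<partial>lborel) + (\<integral>\<^sup>+h. kern s h * incr_sq \<phi>0 h \<partial>lborel))"
      by (simp add: nn_integral_cmult nn_integral_add nn_integral_sum)
    finally have "ennreal (C s / 2) * (\<integral>\<^sup>+h. kern s h * ennreal (min 1 ((norm (h :: real ^ 'n))\<^sup>2)) \<partial>lborel)
        \<le> ennreal (C s / 2) * (ennreal k * ((\<Sum>i\<in>UNIV. \<integral>\<^sup>+h. kern s h * incr_sq (\<phi> i) h \<partial>lborel) + (\<integral>\<^sup>+h. kern s h * incr_sq \<phi>0 h \<partial>lborel)))"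
      by (rule mult_left_mono) simp
    also have "\<dots> = ennreal k * ((\<Sum>i\<in>UNIV. energy C s (\<phi> i)) + energy C s \<phi>0)"
      by (simp add: energy_def distrib_left sum_distrib_left mult.left_commute)
    also have "\<dots> \<le> ennreal k * ((\<Sum>i\<in>UNIV. ennreal (dirichlet (\<phi> i) + 1)) + ennreal (dirichlet \<phi>0 + 1))"
      using elim by (intro mult_left_mono add_mono sum_mono) auto
    also have "\<dots> = ennreal A"
      using \<phi>(3) sum_nn by (simp add: A_def dirichlet_nonneg ennreal_mult add_nonneg_nonneg sum_nonneg flip: ennreal_plus)
    finally show ?case .
  qed
  moreover have "A \<ge> 0"
    using \<phi>(3) sum_nn dirichlet_nonneg[of \<phi>0] by (simp add: A_def)
  ultimately show thesis
    by (intro that[of A])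
qed

subsection \<open>The lower bound for mollifications\<close>

text \<open>Young's inequality for products with a free weight \<open>d\<close>. The factor in front
  of \<open>f\<close> can be brought arbitrarily close to 1, so that the lower bound loses no
  constant.\<close>

lemma incr_sq_add_le:
  assumes [measurable]: "f \<in> borel_measurable borel" "g \<in> borel_measurable borel" and d: "d > 0"
  shows "incr_sq (\<lambda>x. f x + g x) h \<le> ennreal (1 + d) * incr_sq f h + ennreal (1 + 1 / d) * incr_sq g h"
proof -
  have ineq: "(a + b)\<^sup>2 \<le> (1 + d) * a\<^sup>2 + (1 + 1 / d) * b\<^sup>2" for a b :: real
  proof -
    have "0 \<le> (d * a - b)\<^sup>2 / d"
      using d by simp
    also have "\<dots> = d * a\<^sup>2 - 2 * a * b + b\<^sup>2 / d"
      using d by (simp add: power2_diff power_mult_distrib power2_eq_square field_simps)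
    finally show ?thesis
      by (simp add: power2_sum algebra_simps)
  qed
  have "incr_sq (\<lambda>x. f x + g x) h
      \<le> (\<integral>\<^sup>+x. ennreal (1 + d) * ennreal ((f (x + h) - f x)\<^sup>2) + ennreal (1 + 1 / d) * ennreal ((g (x + h) - g x)\<^sup>2) \<partial>lborel)"
    unfolding incr_sq_def
  proof (rule nn_integral_mono)
    fix x
    have "(f (x + h) + g (x + h) - (f x + g x))\<^sup>2 \<le> (1 + d) * (f (x + h) - f x)\<^sup>2 + (1 + 1 / d) * (g (x + h) - g x)\<^sup>2"
      using ineq[of "f (x + h) - f x" "g (x + h) - g x"] by (simp add: algebra_simps)
    then have "ennreal ((f (x + h) + g (x + h) - (f x + g x))\<^sup>2)
        \<le> ennreal ((1 + d) * (f (x + h) - f x)\<^sup>2 + (1 + 1 / d) * (g (x + h) - g x)\<^sup>2)"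
      by (rule ennreal_leI)
    also have "\<dots> = ennreal (1 + d) * ennreal ((f (x + h) - f x)\<^sup>2) + ennreal (1 + 1 / d) * ennreal ((g (x + h) - g x)\<^sup>2)"
      using d by (simp only: ennreal_plus ennreal_mult mult_nonneg_nonneg add_nonneg_nonneg zero_le_power2
          less_imp_le zero_le_one zero_le_divide_1_iff)
    finally show "ennreal ((f (x + h) + g (x + h) - (f x + g x))\<^sup>2)
        \<le> ennreal (1 + d) * ennreal ((f (x + h) - f x)\<^sup>2) + ennreal (1 + 1 / d) * ennreal ((g (x + h) - g x)\<^sup>2)" .
  qed
  also have "\<dots> = ennreal (1 + d) * incr_sq f h + ennreal (1 + 1 / d) * incr_sq g h"
    unfolding incr_sq_def by (subst nn_integral_add) (measurable, simp add: nn_integral_cmult)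
  finally show ?thesis .
qed

lemma energy_mono:
  assumes "\<And>h. incr_sq v h \<le> incr_sq w h"
  shows "energy C s v \<le> energy C s w"
  unfolding energy_def by (intro mult_left_mono nn_integral_mono assms) auto

lemma energy_add_le:
  assumes [measurable]: "f \<in> borel_measurable borel" "g \<in> borel_measurable borel" and d: "d > 0"
  shows "energy C s (\<lambda>x. f x + g x) \<le> ennreal (1 + d) * energy C s f + ennreal (1 + 1 / d) * energy C s g"
proof -
  have "(\<integral>\<^sup>+h. kern s h * incr_sq (\<lambda>x. f x + g x) h \<partial>lborel)
      \<le> (\<integral>\<^sup>+h. ennreal (1 + d) * (kern s h * incr_sq f h) + ennreal (1 + 1 / d) * (kern s h * incr_sq g h) \<partial>lborel)"
  proof (rule nn_integral_mono)
    fix h :: "real ^ 'a"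
    have "kern s h * incr_sq (\<lambda>x. f x + g x) h \<le> kern s h * (ennreal (1 + d) * incr_sq f h + ennreal (1 + 1 / d) * incr_sq g h)"
      by (rule mult_left_mono[OF incr_sq_add_le[OF assms]]) simp
    also have "\<dots> = ennreal (1 + d) * (kern s h * incr_sq f h) + ennreal (1 + 1 / d) * (kern s h * incr_sq g h)"
      by (simp add: distrib_left mult.left_commute)
    finally show "kern s h * incr_sq (\<lambda>x. f x + g x) h
        \<le> ennreal (1 + d) * (kern s h * incr_sq f h) + ennreal (1 + 1 / d) * (kern s h * incr_sq g h)" .
  qed
  also have "\<dots> = ennreal (1 + d) * (\<integral>\<^sup>+h. kern s h * incr_sq f h \<partial>lborel) + ennreal (1 + 1 / d) * (\<integral>\<^sup>+h. kern s h * incr_sq g h \<partial>lborel)"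
    by (subst nn_integral_add) (measurable, simp add: nn_integral_cmult)
  finally have "energy C s (\<lambda>x. f x + g x) \<le> ennreal (C s / 2) *
      (ennreal (1 + d) * (\<integral>\<^sup>+h. kern s h * incr_sq f h \<partial>lborel) + ennreal (1 + 1 / d) * (\<integral>\<^sup>+h. kern s h * incr_sq g h \<partial>lborel))"
    unfolding energy_def by (rule mult_left_mono) simp
  then show ?thesis
    by (simp add: energy_def distrib_left mult.left_commute)
qed

text \<open>The mollifier and the weight d stay fixed while n tends to infinity: the energy of the
  mollified error is then at most a constant times the squared L^2 distance of \<open>V n\<close>
  and \<open>U\<close>. Only afterwards d tends to 0.\<close>

lemma dirichlet_mollify_le:
  fixes \<Omega> :: "(real ^ 'n) set" and V :: "nat \<Rightarrow> real ^ 'n \<Rightarrow> real"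
  assumes \<Omega>: "open \<Omega>" "bounded \<Omega>" "\<Omega> \<noteq> {}" and bbm: "bbm_normalization \<Omega> C"
    and s: "\<And>n. s n < 1" "s \<longlonglongrightarrow> 1"
    and V: "\<And>n. V n \<in> SqInt lborel" and U: "U \<in> SqInt lborel" "\<And>x. x \<notin> \<Omega> \<Longrightarrow> U x = 0"
    and VU: "(\<lambda>n. nrm lborel (\<lambda>x. V n x - U x)) \<longlonglongrightarrow> 0"
    and M: "\<And>n. energy C (s n) (V n) \<le> ennreal (M n)" "\<And>n. 0 \<le> M n" "M \<longlonglongrightarrow> m"
    and \<rho>: "mollifier \<rho>"
  shows "conv \<rho> U \<in> test_functions UNIV" "dirichlet (conv \<rho> U) \<le> m"
proof -
  have \<rho>_test: "\<rho> \<in> test_functions UNIV"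
    using \<rho> by (simp add: mollifier_def)
  obtain B where B: "compact B" "B \<subseteq> UNIV" "\<And>x. x \<notin> B \<Longrightarrow> \<rho> x = 0"
    using test_functionsE[OF \<rho>_test] by blast
  have "compact (closure \<Omega>)"
    using \<Omega>(2) by simp
  moreover have "U x = 0" if "x \<notin> closure \<Omega>" for x
    using that closure_subset[of \<Omega>] U(2) by blast
  ultimately show w: "conv \<rho> U \<in> test_functions UNIV"
    using conv_test_functions[OF \<rho>_test B(3,1) U(1), of "closure \<Omega>" UNIV] by blast
  obtain A where A: "A \<ge> 0"
    "\<forall>\<^sub>F s in at_left 1. ennreal (C s / 2) * (\<integral>\<^sup>+h. kern s h * ennreal (min 1 ((norm (h :: real ^ 'n))\<^sup>2)) \<partial>lborel) \<le> ennreal A"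
    using min_kernel_bounded[OF \<Omega> bbm] by blast
  obtain c where c: "c \<ge> 0" "\<And>f h. f \<in> SqInt lborel \<Longrightarrow>
      incr_sq (conv \<rho> f) h \<le> ennreal (c * (nrm lborel f)\<^sup>2) * ennreal (min 1 ((norm h)\<^sup>2))"
    using incr_sq_conv_le[OF \<rho>_test] by blast
  have s_left: "filterlim s (at_left 1) sequentially"
    using s by (auto simp: filterlim_at less_imp_neq)
  let ?w = "conv \<rho> U"
  have [measurable]: "U \<in> borel_measurable borel" "V n \<in> borel_measurable borel" "\<rho> \<in> borel_measurable borel" for n
    using SqInt_measurable[OF U(1)] SqInt_measurable[OF V] test_functions_measurable[OF \<rho>_test] by simp_all
  have lim: "(\<lambda>n. energy C (s n) ?w) \<longlonglongrightarrow> ennreal (dirichlet ?w)"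
    by (rule filterlim_compose[OF bbm_test_function_UNIV[OF \<Omega> bbm w] s_left])
  have le: "dirichlet ?w \<le> (1 + d) * m" if d: "d > 0" for d
  proof -
    \<comment> \<open>The first term converges to (1 + d) m. The second is the energy of the
      mollified error, with the smoothing constant \<open>c\<close> and the kernel bound
      \<open>A\<close>, and converges to 0.\<close>
    define b where "b n = (1 + d) * M n + (1 + 1 / d) * (c * (nrm lborel (\<lambda>x. V n x - U x))\<^sup>2 * A)" for n
    have b_nonneg: "0 \<le> b n" for n
      using d M(2)[of n] c(1) A(1) by (simp add: b_def)
    have "\<forall>\<^sub>F n in sequentially. energy C (s n) ?w \<le> ennreal (b n)"
      using filterlim_iff[THEN iffD1, OF s_left, rule_format, OF A(2)]
    proof eventually_elim
      case (elim n)
      have diff: "(\<lambda>x. U x - V n x) \<in> SqInt lborel"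
        by (rule SqInt_diff[OF U(1) V])
      have "?w x = conv \<rho> (V n) x + conv \<rho> (\<lambda>x. U x - V n x) x" for x
        using conv_diff_right[OF test_functions_SqInt[OF \<rho>_test] U(1) V, of x n] by simp
      then have "energy C (s n) ?w = energy C (s n) (\<lambda>x. conv \<rho> (V n) x + conv \<rho> (\<lambda>x. U x - V n x) x)"
        by (rule arg_cong[OF ext])
      also have "\<dots> \<le> ennreal (1 + d) * energy C (s n) (conv \<rho> (V n)) + ennreal (1 + 1 / d) * energy C (s n) (conv \<rho> (\<lambda>x. U x - V n x))"
        by (rule energy_add_le[OF _ _ d]) measurable
      also have "\<dots> \<le> ennreal (1 + d) * ennreal (M n) + ennreal (1 + 1 / d) * ennreal (c * (nrm lborel (\<lambda>x. V n x - U x))\<^sup>2 * A)"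
      proof (intro add_mono mult_left_mono)
        show "energy C (s n) (conv \<rho> (V n)) \<le> ennreal (M n)"
          using energy_mono[OF incr_sq_mollify_le[OF \<rho> V]] M(1) by (rule order_trans)
        let ?q = "c * (nrm lborel (\<lambda>x. V n x - U x))\<^sup>2"
        have "(\<integral>\<^sup>+h. kern (s n) h * incr_sq (conv \<rho> (\<lambda>x. U x - V n x)) h \<partial>lborel)
            \<le> (\<integral>\<^sup>+h. ennreal ?q * (kern (s n) h * ennreal (min 1 ((norm (h :: real ^ 'n))\<^sup>2))) \<partial>lborel)"
        proof (rule nn_integral_mono)
          fix h :: "real ^ 'n"
          have "kern (s n) h * incr_sq (conv \<rho> (\<lambda>x. U x - V n x)) h
              \<le> kern (s n) h * (ennreal ?q * ennreal (min 1 ((norm h)\<^sup>2)))"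
            using c(2)[OF diff, of h] by (intro mult_left_mono) (simp_all add: nrm_minus_commute[of lborel U])
          then show "kern (s n) h * incr_sq (conv \<rho> (\<lambda>x. U x - V n x)) h
              \<le> ennreal ?q * (kern (s n) h * ennreal (min 1 ((norm h)\<^sup>2)))"
            by (simp add: mult.left_commute)
        qed
        also have "\<dots> = ennreal ?q * (\<integral>\<^sup>+h. kern (s n) h * ennreal (min 1 ((norm (h :: real ^ 'n))\<^sup>2)) \<partial>lborel)"
          by (rule nn_integral_cmult) measurable
        finally have "energy C (s n) (conv \<rho> (\<lambda>x. U x - V n x)) \<le> ennreal (C (s n) / 2) *
            (ennreal ?q * (\<integral>\<^sup>+h. kern (s n) h * ennreal (min 1 ((norm (h :: real ^ 'n))\<^sup>2)) \<partial>lborel))"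
          unfolding energy_def by (rule mult_left_mono) simp
        also have "\<dots> = ennreal ?q * (ennreal (C (s n) / 2) * (\<integral>\<^sup>+h. kern (s n) h * ennreal (min 1 ((norm (h :: real ^ 'n))\<^sup>2)) \<partial>lborel))"
          by (simp add: mult.left_commute)
        also have "\<dots> \<le> ennreal ?q * ennreal A"
          by (rule mult_left_mono[OF elim]) simp
        also have "\<dots> = ennreal (?q * A)"
          using c(1) A(1) by (intro ennreal_mult[symmetric]) auto
        finally show "energy C (s n) (conv \<rho> (\<lambda>x. U x - V n x)) \<le> ennreal (?q * A)" .
      qed auto
      also have "\<dots> = ennreal (b n)"
        unfolding b_def using d M(2)[of n] c(1) A(1)
        by (simp only: ennreal_plus ennreal_mult mult_nonneg_nonneg add_nonneg_nonneg zero_le_power2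
            less_imp_le zero_le_one zero_le_divide_1_iff)
      finally show ?case .
    qed
    moreover have "(\<lambda>n. ennreal (b n)) \<longlonglongrightarrow> ennreal ((1 + d) * m + (1 + 1 / d) * (c * 0\<^sup>2 * A))"
      unfolding b_def by (intro tendsto_intros VU M(3))
    ultimately have "ennreal (dirichlet ?w) \<le> ennreal ((1 + d) * m + (1 + 1 / d) * (c * 0\<^sup>2 * A))"
      using lim by (intro tendsto_le[OF sequentially_bot]) auto
    moreover have "0 \<le> m"
      by (rule LIMSEQ_le_const[OF M(3)]) (use M(2) in auto)
    ultimately show ?thesis
      using d by (simp add: ennreal_le_iff)
  qed
  \<comment> \<open>The bound holds for every positive weight and its left side does not depend on
    the weight.\<close>
  show "dirichlet ?w \<le> m"
  proof (rule tendsto_le[OF _ _ tendsto_const])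
    show "((\<lambda>d. (1 + d) * m) \<longlongrightarrow> m) (at_right 0)"
      by (auto intro!: tendsto_eq_intros)
    show "\<forall>\<^sub>F d in at_right 0. dirichlet ?w \<le> (1 + d) * m"
      unfolding eventually_at_right_field using le by (intro exI[of _ 1]) auto
  qed simp
qed

text \<open>Mollifications converge to \<open>U\<close> because some \<open>V n\<close> is close to
  \<open>U\<close> and has finite fractional energy, which controls its own mollification error;
  contraction takes care of \<open>U - V n\<close>. This takes the place of density of continuous
  functions in L^2.\<close>

lemma mollify_close:
  fixes V :: "nat \<Rightarrow> real ^ 'n \<Rightarrow> real"
  assumes V: "\<And>n. V n \<in> SqInt lborel" and U: "U \<in> SqInt lborel"
    and VU: "(\<lambda>n. nrm lborel (\<lambda>x. V n x - U x)) \<longlonglongrightarrow> 0"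
    and s: "\<And>n. 0 < s n"
    and fin: "\<And>n. (\<integral>\<^sup>+h. kern (s n) h * incr_sq (V n) h \<partial>lborel) < \<infinity>"
    and e: "e > 0"
  obtains \<rho> where "mollifier \<rho>" "nrm lborel (\<lambda>x. conv \<rho> U x - U x) < e"
proof -
  have "\<forall>\<^sub>F n in sequentially. nrm lborel (\<lambda>x. V n x - U x) < e / 3"
    using order_tendstoD(2)[OF VU, of "e / 3"] e by simp
  then obtain n where n: "nrm lborel (\<lambda>x. V n x - U x) < e / 3"
    by (auto simp: eventually_sequentially)
  obtain I where I: "I \<ge> 0" "(\<integral>\<^sup>+h. kern (s n) h * incr_sq (V n) h \<partial>lborel) = ennreal I"
    using fin[of n] by (cases "\<integral>\<^sup>+h. kern (s n) h * incr_sq (V n) h \<partial>lborel") auto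
  define c where "c = 2 ^ CARD('n) / unit_ball_vol (real CARD('n))"
  have c: "c > 0"
    by (simp add: c_def)
  \<comment> \<open>The index n is already fixed, so the energy \<open>I\<close> is a constant, and
    the positive power of the radius tends to 0.\<close>
  have "((\<lambda>t. c * t powr (2 * s n) * I) \<longlongrightarrow> c * 0 * I) (at_right 0)"
  proof (intro tendsto_intros)
    have "((\<lambda>t::real. t powr (2 * s n)) \<longlongrightarrow> 0 powr (2 * s n)) (at_right 0)"
      using s[of n] by (intro tendsto_powr2 tendsto_intros) (auto simp: eventually_at_filter)
    then show "((\<lambda>t::real. t powr (2 * s n)) \<longlongrightarrow> 0) (at_right 0)"
      by simp
  qed
  then have "\<forall>\<^sub>F t in at_right 0. c * t powr (2 * s n) * I < (e / 6)\<^sup>2"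
    using e by (intro order_tendstoD) auto
  then obtain t where t: "t > 0" "c * t powr (2 * s n) * I < (e / 6)\<^sup>2"
    unfolding eventually_at_right_field using dense by blast
  obtain \<rho> where \<rho>: "mollifier \<rho>" "\<And>x. x \<notin> cball 0 t \<Longrightarrow> \<rho> x = 0"
    "\<And>x :: real ^ 'n. \<rho> x \<le> 1 / (unit_ball_vol (real CARD('n)) * (t / 2) ^ CARD('n))"
    using mollifier_exists[OF t(1), of 0] by blast
  have \<rho>S: "\<rho> \<in> SqInt lborel"
    using \<rho>(1) test_functions_SqInt by (auto simp: mollifier_def)
  have VU_S: "(\<lambda>x. U x - V n x) \<in> SqInt lborel" "conv \<rho> U \<in> SqInt lborel" "conv \<rho> (V n) \<in> SqInt lborel"
    by (rule SqInt_diff[OF U V], rule mollifier_Young[OF \<rho>(1) U], rule mollifier_Young[OF \<rho>(1) V])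
  have "(\<integral>\<^sup>+x. ennreal ((conv \<rho> (V n) x - V n x)\<^sup>2) \<partial>lborel) \<le> ennreal (c * t powr (2 * s n)) * ennreal I"
    using mollify_error_gagliardo[OF V[of n] t(1) \<rho> s[of n]] unfolding I(2) c_def .
  also have "\<dots> = ennreal (c * t powr (2 * s n) * I)"
    using c I(1) by (intro ennreal_mult[symmetric]) auto
  also have "\<dots> \<le> ennreal ((e / 6)\<^sup>2)"
    using t(2) by (intro ennreal_leI) simp
  finally have "nrm lborel (\<lambda>x. conv \<rho> (V n) x - V n x) \<le> e / 6"
    using e SqInt_measurable[OF VU_S(3)] SqInt_measurable[OF V[of n]] by (intro SqInt_bound) auto
  moreover have "nrm lborel (\<lambda>x. conv \<rho> U x - conv \<rho> (V n) x) < e / 3"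
  proof -
    have "(\<lambda>x. conv \<rho> U x - conv \<rho> (V n) x) = conv \<rho> (\<lambda>x. U x - V n x)"
      using conv_diff_right[OF \<rho>S U V] by blast
    then show ?thesis
      using mollifier_Young(2)[OF \<rho>(1) VU_S(1)] n by (simp add: nrm_minus_commute[of lborel U])
  qed
  moreover have "nrm lborel (\<lambda>x. conv \<rho> U x - U x) \<le> nrm lborel (\<lambda>x. conv \<rho> U x - conv \<rho> (V n) x)
      + nrm lborel (\<lambda>x. conv \<rho> (V n) x - U x)"
    by (rule nrm_triangle_diff[OF VU_S(2,3) U])
  moreover have "nrm lborel (\<lambda>x. conv \<rho> (V n) x - U x) \<le> nrm lborel (\<lambda>x. conv \<rho> (V n) x - V n x) + nrm lborel (\<lambda>x. V n x - U x)"
    by (rule nrm_triangle_diff[OF VU_S(3) V U])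
  \<comment> \<open>The three errors are bounded by e/3, e/6 and e/3.\<close>
  ultimately have "nrm lborel (\<lambda>x. conv \<rho> U x - U x) < e"
    using n e by linarith
  then show thesis
    using that \<rho>(1) by blast
qed

subsection \<open>Strong approximation from bounded approximation\<close>

text \<open>Approximation in L^2 with one bound \<open>m\<close> for all accuracies. No convergence
  of gradients is demanded; it is recovered in \<open>approximable_imp_strong\<close>.\<close>

definition approximable :: "(real ^ 'n) set \<Rightarrow> (real ^ 'n \<Rightarrow> real) \<Rightarrow> real \<Rightarrow> bool" where
  "approximable \<Omega> u m \<longleftrightarrow> (\<forall>e>0. \<exists>\<phi>\<in>test_functions \<Omega>. nrm lborel (\<lambda>x. \<phi> x - u x) < e \<and> dirichlet \<phi> \<le> m)"

text \<open>A weak gradient on the whole space, given by its components and tested with integrals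
  over \<open>lborel\<close>.\<close>

definition weak_pair :: "(real ^ 'n \<Rightarrow> real) \<Rightarrow> ('n \<Rightarrow> real ^ 'n \<Rightarrow> real) \<Rightarrow> bool" where
  "weak_pair u g \<longleftrightarrow> (\<forall>\<psi>\<in>test_functions UNIV. \<forall>i.
     (LINT x|lborel. u x * partial_deriv i \<psi> x) = - (LINT x|lborel. g i x * \<psi> x))"

lemma partial_deriv_test_SqInt: "\<phi> \<in> test_functions \<Omega> \<Longrightarrow> partial_deriv i \<phi> \<in> SqInt lborel"
  by (rule test_functions_SqInt[OF test_functions_partial_deriv])

lemma dirichlet_cmult:
  assumes "\<phi> \<in> test_functions \<Omega>"
  shows "dirichlet (\<lambda>x. c * \<phi> x) = c\<^sup>2 * dirichlet \<phi>"
proof -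
  have "partial_deriv i (\<lambda>x. c * \<phi> x) = (\<lambda>x. c * partial_deriv i \<phi> x)" for i
    by (rule ext, rule partial_deriv_cmult, rule test_functions_differentiable[OF assms])
  then show ?thesis
    by (simp add: dirichlet_def nrm_cmult power_mult_distrib sum_distrib_left)
qed

lemma nrm_parallelogram:
  assumes "f \<in> SqInt M" "g \<in> SqInt M"
  shows "(nrm M (\<lambda>x. f x + g x))\<^sup>2 + (nrm M (\<lambda>x. f x - g x))\<^sup>2 = 2 * (nrm M f)\<^sup>2 + 2 * (nrm M g)\<^sup>2"
  using nrm_sq_add[OF assms] nrm_sq_add[OF assms(1) SqInt_cmult[OF assms(2), of "-1"]] nrm_cmult[of M "-1" g]
  by simp

lemma dirichlet_parallelogram:
  assumes "\<phi> \<in> test_functions \<Omega>" "\<psi> \<in> test_functions \<Omega>"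
  shows "dirichlet (\<lambda>x. \<phi> x + \<psi> x) + dirichlet (\<lambda>x. \<phi> x - \<psi> x) = 2 * dirichlet \<phi> + 2 * dirichlet \<psi>"
proof -
  have "partial_deriv i (\<lambda>x. \<phi> x + \<psi> x) = (\<lambda>x. partial_deriv i \<phi> x + partial_deriv i \<psi> x)" for i
    by (rule ext, rule partial_deriv_add)
      (rule test_functions_differentiable[OF assms(1)], rule test_functions_differentiable[OF assms(2)])
  moreover have "partial_deriv i (\<lambda>x. \<phi> x - \<psi> x) = (\<lambda>x. partial_deriv i \<phi> x - partial_deriv i \<psi> x)" for i
    by (rule ext, rule partial_deriv_diff)
      (rule test_functions_differentiable[OF assms(1)], rule test_functions_differentiable[OF assms(2)])
  ultimately show ?thesis
    using nrm_parallelogram[OF partial_deriv_test_SqInt[OF assms(1)] partial_deriv_test_SqInt[OF assms(2)]]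
    by (simp add: dirichlet_def sum_distrib_left flip: sum.distrib)
qed

lemma weak_pair_limit:
  assumes \<phi>: "\<And>n. \<phi> n \<in> test_functions \<Omega>" and u: "u \<in> SqInt lborel" "\<And>i. g i \<in> SqInt lborel"
    and lim: "(\<lambda>n. nrm lborel (\<lambda>x. \<phi> n x - u x)) \<longlonglongrightarrow> 0"
      "\<And>i. (\<lambda>n. nrm lborel (\<lambda>x. partial_deriv i (\<phi> n) x - g i x)) \<longlonglongrightarrow> 0"
  shows "weak_pair u g"
  unfolding weak_pair_def
proof (intro ballI allI)
  fix \<psi> :: "real ^ 'a \<Rightarrow> real" and i assume \<psi>: "\<psi> \<in> test_functions UNIV"
  have "(\<lambda>n. LINT x|lborel. \<phi> n x * partial_deriv i \<psi> x) \<longlonglongrightarrow> (LINT x|lborel. u x * partial_deriv i \<psi> x)"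
    by (rule SqInt_inner_tendsto[OF test_functions_SqInt[OF \<phi>] u(1) partial_deriv_test_SqInt[OF \<psi>] lim(1)])
  moreover have "(\<lambda>n. LINT x|lborel. partial_deriv i (\<phi> n) x * \<psi> x) \<longlonglongrightarrow> (LINT x|lborel. g i x * \<psi> x)"
    by (rule SqInt_inner_tendsto[OF partial_deriv_test_SqInt[OF \<phi>] u(2) test_functions_SqInt[OF \<psi>] lim(2)])
  then have "(\<lambda>n. LINT x|lborel. \<phi> n x * partial_deriv i \<psi> x) \<longlonglongrightarrow> - (LINT x|lborel. g i x * \<psi> x)"
    unfolding integral_by_parts_test_functions[OF \<phi> \<psi>] by (rule tendsto_minus)
  ultimately show "(LINT x|lborel. u x * partial_deriv i \<psi> x) = - (LINT x|lborel. g i x * \<psi> x)"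
    by (rule LIMSEQ_unique)
qed

text \<open>
  Among all approximating sequences, one of asymptotically minimal Dirichlet energy has Cauchy
  gradients by the parallelogram law; this replaces weak compactness.
\<close>

lemma approximable_imp_strong:
  fixes \<Omega> :: "(real ^ 'n) set"
  assumes u: "u \<in> SqInt lborel" and approx: "approximable \<Omega> u m"
  obtains \<phi> g where "\<And>n. \<phi> n \<in> test_functions \<Omega>" "\<And>i. g i \<in> SqInt lborel"
    "(\<lambda>n. nrm lborel (\<lambda>x. \<phi> n x - u x)) \<longlonglongrightarrow> 0"
    "\<And>i. (\<lambda>n. nrm lborel (\<lambda>x. partial_deriv i (\<phi> n) x - g i x)) \<longlonglongrightarrow> 0"
    "(\<Sum>i\<in>UNIV. (nrm lborel (g i))\<^sup>2) \<le> m"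
proof -
  define \<epsilon> where "\<epsilon> n = inverse (real (Suc n))" for n
  have \<epsilon>: "\<epsilon> n > 0" for n
    by (simp add: \<epsilon>_def)
  have \<epsilon>_mono: "\<epsilon> k \<le> \<epsilon> n" if "n \<le> k" for n k
    using that by (simp add: \<epsilon>_def)
  have \<epsilon>0: "\<epsilon> \<longlonglongrightarrow> 0"
    unfolding \<epsilon>_def by (rule LIMSEQ_inverse_real_of_nat)
  \<comment> \<open>\<open>S n\<close> collects the energies of all test functions within
    \<open>\<epsilon> n\<close> of \<open>u\<close>. These sets shrink, so their infima
    \<open>a n\<close> increase, and being at most \<open>m\<close> they converge.\<close>
  define S where "S n = dirichlet ` {\<phi> \<in> test_functions \<Omega>. nrm lborel (\<lambda>x. \<phi> x - u x) < \<epsilon> n}" for n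
  define a where "a n = Inf (S n)" for n
  have bdd: "bdd_below (S n)" for n
    unfolding S_def by (rule bdd_belowI[of _ 0]) (auto simp: dirichlet_nonneg)
  have ne: "\<exists>x\<in>S n. x \<le> m" for n
    using approx \<epsilon>[of n] unfolding approximable_def S_def by blast
  have a_le: "a n \<le> m" for n
    using ne[of n] cInf_lower[OF _ bdd] unfolding a_def by fastforce
  have "incseq a"
    unfolding a_def
  proof (rule incseq_SucI, rule cInf_superset_mono)
    fix n
    show "S (Suc n) \<noteq> {}"
      using ne by blast
    show "S (Suc n) \<subseteq> S n"
      unfolding S_def using \<epsilon>_mono[of n "Suc n"] by (auto intro: less_le_trans)
  qed (rule bdd)
  obtain l where l: "a \<longlonglongrightarrow> l" "\<And>n. a n \<le> l"
    using incseq_convergent[OF \<open>incseq a\<close>, of m] a_le by blast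
  have "\<exists>\<phi>. \<phi> \<in> test_functions \<Omega> \<and> nrm lborel (\<lambda>x. \<phi> x - u x) < \<epsilon> n \<and> dirichlet \<phi> < a n + \<epsilon> n" for n
  proof -
    have "\<exists>x\<in>S n. x < a n + \<epsilon> n"
      using ne[of n] \<epsilon>[of n] cInf_lessD[of "S n" "a n + \<epsilon> n"] unfolding a_def by fastforce
    then show ?thesis
      unfolding S_def by blast
  qed
  then obtain \<phi> where \<phi>: "\<And>n. \<phi> n \<in> test_functions \<Omega>" "\<And>n. nrm lborel (\<lambda>x. \<phi> n x - u x) < \<epsilon> n"
    "\<And>n. dirichlet (\<phi> n) < a n + \<epsilon> n"
    by metis
  have \<phi>S: "\<phi> n \<in> SqInt lborel" for n
    by (rule test_functions_SqInt[OF \<phi>(1)])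
  have diff: "dirichlet (\<lambda>x. \<phi> n x - \<phi> k x) \<le> 2 * (l - a n) + 4 * \<epsilon> n" if "n \<le> k" for n k
  proof -
    \<comment> \<open>The midpoint is still within \<open>\<epsilon> n\<close> of \<open>u\<close>,
      so its energy is at least \<open>a n\<close>. Both endpoints have energy close to the infimum,
      and the parallelogram law leaves little for the difference.\<close>
    let ?\<psi> = "\<lambda>x. 1 / 2 * (\<phi> n x + \<phi> k x)"
    have sum: "(\<lambda>x. \<phi> n x + \<phi> k x) \<in> test_functions \<Omega>"
      by (rule test_functions_add[OF \<phi>(1) \<phi>(1)])
    have \<psi>: "?\<psi> \<in> test_functions \<Omega>"
      by (rule test_functions_cmult[OF sum])
    have "nrm lborel (\<lambda>x. ?\<psi> x - u x) = nrm lborel (\<lambda>x. 1 / 2 * ((\<phi> n x - u x) + (\<phi> k x - u x)))"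
      by (simp add: field_simps)
    also have "\<dots> \<le> 1 / 2 * (nrm lborel (\<lambda>x. \<phi> n x - u x) + nrm lborel (\<lambda>x. \<phi> k x - u x))"
      using nrm_triangle[OF SqInt_diff[OF \<phi>S u] SqInt_diff[OF \<phi>S u], of n k] by (simp only: nrm_cmult) simp
    also have "\<dots> < 1 / 2 * (\<epsilon> n + \<epsilon> n)"
      using add_strict_mono[OF \<phi>(2)[of n] less_le_trans[OF \<phi>(2)[of k] \<epsilon>_mono[OF that]]]
      by (rule mult_strict_left_mono) simp
    also have "\<dots> = \<epsilon> n"
      by simp
    finally have "dirichlet ?\<psi> \<in> S n"
      using \<psi> unfolding S_def by blast
    then have "a n \<le> dirichlet ?\<psi>"
      unfolding a_def by (rule cInf_lower[OF _ bdd])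
    also have "\<dots> = 1 / 4 * dirichlet (\<lambda>x. \<phi> n x + \<phi> k x)"
      using dirichlet_cmult[OF sum, of "1 / 2"] by (simp add: power2_eq_square)
    finally have "4 * a n \<le> dirichlet (\<lambda>x. \<phi> n x + \<phi> k x)"
      by simp
    note lower = this
    have arith: "d \<le> 2 * (b - p) + 4 * e" if "4 * p \<le> s" "s + d = 2 * x + 2 * y" "x < p + e" "y < q + f" "f \<le> e" "q \<le> b"
      for b d e f p q s x y :: real
      using that by (smt (verit))
    show ?thesis
      by (rule arith[OF lower dirichlet_parallelogram[OF \<phi>(1) \<phi>(1)] \<phi>(3) \<phi>(3) \<epsilon>_mono[OF that] l(2)])
  qed
  have pd_diff: "(nrm lborel (\<lambda>x. partial_deriv i (\<phi> n) x - partial_deriv i (\<phi> k) x))\<^sup>2 \<le> dirichlet (\<lambda>x. \<phi> n x - \<phi> k x)" for i n k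
  proof -
    have "partial_deriv i (\<lambda>x. \<phi> n x - \<phi> k x) = (\<lambda>x. partial_deriv i (\<phi> n) x - partial_deriv i (\<phi> k) x)"
      by (rule ext, rule partial_deriv_diff; rule test_functions_differentiable[OF \<phi>(1)])
    then show ?thesis
      using member_le_sum[of i UNIV "\<lambda>i. (nrm lborel (partial_deriv i (\<lambda>x. \<phi> n x - \<phi> k x)))\<^sup>2"]
      by (simp add: dirichlet_def)
  qed
  have "\<exists>g. g \<in> SqInt lborel \<and> (\<lambda>n. nrm lborel (\<lambda>x. partial_deriv i (\<phi> n) x - g x)) \<longlonglongrightarrow> 0" for i
  proof (rule SqInt_complete[of "\<lambda>n. partial_deriv i (\<phi> n)" lborel])
    show "partial_deriv i (\<phi> n) \<in> SqInt lborel" for n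
      by (rule partial_deriv_test_SqInt[OF \<phi>(1)])
    fix e :: real assume e: "e > 0"
    have "(\<lambda>n. 2 * (l - a n) + 4 * \<epsilon> n) \<longlonglongrightarrow> 2 * (l - l) + 4 * 0"
      by (intro tendsto_intros l(1) \<epsilon>0)
    then have "\<forall>\<^sub>F n in sequentially. 2 * (l - a n) + 4 * \<epsilon> n < e\<^sup>2"
      using e by (intro order_tendstoD) auto
    then obtain N where N: "\<And>n. n \<ge> N \<Longrightarrow> 2 * (l - a n) + 4 * \<epsilon> n < e\<^sup>2"
      by (auto simp: eventually_sequentially)
    have ordered: "nrm lborel (\<lambda>x. partial_deriv i (\<phi> n) x - partial_deriv i (\<phi> k) x) < e" if "n \<ge> N" "n \<le> k" for n k
    proof (rule power2_less_imp_less)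
      show "(nrm lborel (\<lambda>x. partial_deriv i (\<phi> n) x - partial_deriv i (\<phi> k) x))\<^sup>2 < e\<^sup>2"
        by (rule le_less_trans[OF order_trans[OF pd_diff diff[OF that(2)]] N[OF that(1)]])
    qed (use e in simp)
    have "nrm lborel (\<lambda>x. partial_deriv i (\<phi> n) x - partial_deriv i (\<phi> k) x) < e" if "n \<ge> N" "k \<ge> N" for n k
    proof (cases "n \<le> k")
      case True
      then show ?thesis
        by (rule ordered[OF that(1)])
    next
      case False
      then have "k \<le> n"
        by simp
      then show ?thesis
        by (subst nrm_minus_commute) (rule ordered[OF that(2)])
    qed
    then show "\<exists>N. \<forall>n\<ge>N. \<forall>k\<ge>N. nrm lborel (\<lambda>x. partial_deriv i (\<phi> n) x - partial_deriv i (\<phi> k) x) < e"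
      by blast
  qed (rule exI, rule conjI)
  from choice[OF allI[OF this]] obtain g where
    "\<forall>i. g i \<in> SqInt lborel \<and> (\<lambda>n. nrm lborel (\<lambda>x. partial_deriv i (\<phi> n) x - g i x)) \<longlonglongrightarrow> 0" ..
  then have g: "\<And>i. g i \<in> SqInt lborel"
    "\<And>i. (\<lambda>n. nrm lborel (\<lambda>x. partial_deriv i (\<phi> n) x - g i x)) \<longlonglongrightarrow> 0"
    by simp_all
  show thesis
  proof (rule that[OF \<phi>(1) g(1) _ g(2)])
    show "(\<lambda>n. nrm lborel (\<lambda>x. \<phi> n x - u x)) \<longlonglongrightarrow> 0"
    proof (rule tendsto_sandwich[OF _ _ tendsto_const \<epsilon>0])
      show "\<forall>\<^sub>F n in sequentially. 0 \<le> nrm lborel (\<lambda>x. \<phi> n x - u x)"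
        by (simp add: nrm_nonneg)
      show "\<forall>\<^sub>F n in sequentially. nrm lborel (\<lambda>x. \<phi> n x - u x) \<le> \<epsilon> n"
        using \<phi>(2) by (simp add: less_imp_le)
    qed
    have "(\<lambda>n. \<Sum>i\<in>UNIV. (nrm lborel (partial_deriv i (\<phi> n)))\<^sup>2) \<longlonglongrightarrow> (\<Sum>i\<in>UNIV. (nrm lborel (g i))\<^sup>2)"
      by (intro tendsto_sum tendsto_power nrm_tendsto[OF partial_deriv_test_SqInt[OF \<phi>(1)] g])
    then have "(\<lambda>n. dirichlet (\<phi> n)) \<longlonglongrightarrow> (\<Sum>i\<in>UNIV. (nrm lborel (g i))\<^sup>2)"
      by (simp add: dirichlet_def)
    moreover have "(\<lambda>n. m + \<epsilon> n) \<longlonglongrightarrow> m + 0"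
      by (intro tendsto_intros \<epsilon>0)
    moreover have "dirichlet (\<phi> n) \<le> m + \<epsilon> n" for n
      using \<phi>(3)[of n] a_le[of n] by linarith
    ultimately have "(\<Sum>i\<in>UNIV. (nrm lborel (g i))\<^sup>2) \<le> m + 0"
      by (intro LIMSEQ_le) auto
    then show "(\<Sum>i\<in>UNIV. (nrm lborel (g i))\<^sup>2) \<le> m"
      by simp
  qed
qed

subsection \<open>Localization near the boundary\<close>

text \<open>Continuity of translations in L^2, stated at 0. It is obtained from approximation by
  test functions and is preserved by cutoffs and sums.\<close>

definition shift_continuous :: "(real ^ 'n \<Rightarrow> real) \<Rightarrow> bool" where
  "shift_continuous u \<longleftrightarrow> (\<forall>e>0. \<exists>d>0. \<forall>h. norm h < d \<longrightarrow> incr_sq u h \<le> ennreal e)"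

text \<open>An H^1 function of the whole space that vanishes off \<Omega>. The zero boundary values
  are encoded in the fact that \<open>g\<close> is a weak gradient across the boundary, not only
  inside \<Omega>.\<close>

definition H1_supported :: "(real ^ 'n) set \<Rightarrow> (real ^ 'n \<Rightarrow> real) \<Rightarrow> ('n \<Rightarrow> real ^ 'n \<Rightarrow> real) \<Rightarrow> bool" where
  "H1_supported \<Omega> u g \<longleftrightarrow> u \<in> SqInt lborel \<and> (\<forall>i. g i \<in> SqInt lborel) \<and> weak_pair u g \<and>
     shift_continuous u \<and> (\<forall>x. x \<notin> \<Omega> \<longrightarrow> u x = 0)"

lemma shift_continuousE:
  assumes "shift_continuous u" "e > 0"
  obtains d where "d > 0" "\<And>h. norm h < d \<Longrightarrow> incr_sq u h \<le> ennreal e"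
  using assms unfolding shift_continuous_def by blast

lemma incr_sq_le_nrm:
  assumes u: "u \<in> SqInt lborel"
  shows "incr_sq u h \<le> ennreal (4 * (nrm lborel u)\<^sup>2)"
proof -
  have [measurable]: "u \<in> borel_measurable borel"
    using SqInt_measurable[OF u] by simp
  have "(\<lambda>x. u (x + h) - u x) \<in> SqInt lborel"
    by (rule SqInt_diff[OF SqInt_translate[OF u] u])
  then have "incr_sq u h = ennreal ((nrm lborel (\<lambda>x. u (x + h) - u x))\<^sup>2)"
    by (simp add: incr_sq_def nn_integral_sq)
  moreover have "nrm lborel (\<lambda>x. u (x + h) - u x) \<le> nrm lborel (\<lambda>x. u (x + h)) + nrm lborel u"
    using nrm_triangle[OF SqInt_translate[OF u, of h] SqInt_cmult[OF u, of "-1"]] nrm_cmult[of lborel "-1" u] by simp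
  moreover have "nrm lborel (\<lambda>x. u (x + h)) = nrm lborel u"
    using integral_translate[of "\<lambda>x. (u x)\<^sup>2" h] by (simp add: nrm_def)
  ultimately have "(nrm lborel (\<lambda>x. u (x + h) - u x))\<^sup>2 \<le> (2 * nrm lborel u)\<^sup>2"
    by (intro power_mono) (simp_all add: nrm_nonneg)
  then show ?thesis
    using \<open>incr_sq u h = _\<close> by (simp add: power_mult_distrib ennreal_leI)
qed

text \<open>One factor of the squared increment is bounded by twice the supremum, and the other one
  is estimated in L^1.\<close>

lemma shift_continuous_test_function:
  assumes \<phi>: "\<phi> \<in> test_functions \<Omega>"
  shows "shift_continuous \<phi>"
  unfolding shift_continuous_def
proof (intro allI impI)
  fix e :: real assume e: "e > 0"
  obtain B where B: "B \<ge> 0" "\<And>x. \<bar>\<phi> x\<bar> \<le> B"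
    using test_functions_bounded[OF \<phi>] by blast
  obtain c where c: "c \<ge> 0" "\<And>h. (\<integral>\<^sup>+z. ennreal \<bar>\<phi> (z + h) - \<phi> z\<bar> \<partial>lborel) \<le> ennreal (c * min 1 (norm h))"
    using test_functions_increment_L1[OF \<phi>] by blast
  have [measurable]: "\<phi> \<in> borel_measurable borel"
    by (rule test_functions_measurable[OF \<phi>])
  have le: "incr_sq \<phi> h \<le> ennreal (2 * B * c * norm h)" for h
  proof -
    have "incr_sq \<phi> h \<le> (\<integral>\<^sup>+x. ennreal (2 * B) * ennreal \<bar>\<phi> (x + h) - \<phi> x\<bar> \<partial>lborel)"
      unfolding incr_sq_def
    proof (rule nn_integral_mono)
      fix x
      have "\<bar>\<phi> (x + h) - \<phi> x\<bar> \<le> 2 * B"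
        using B(2)[of x] B(2)[of "x + h"] by linarith
      then have "\<bar>\<phi> (x + h) - \<phi> x\<bar> * \<bar>\<phi> (x + h) - \<phi> x\<bar> \<le> 2 * B * \<bar>\<phi> (x + h) - \<phi> x\<bar>"
        by (rule mult_right_mono) simp
      then show "ennreal ((\<phi> (x + h) - \<phi> x)\<^sup>2) \<le> ennreal (2 * B) * ennreal \<bar>\<phi> (x + h) - \<phi> x\<bar>"
        using B(1) by (simp add: power2_eq_square ennreal_leI flip: ennreal_mult)
    qed
    also have "\<dots> = ennreal (2 * B) * (\<integral>\<^sup>+x. ennreal \<bar>\<phi> (x + h) - \<phi> x\<bar> \<partial>lborel)"
      by (rule nn_integral_cmult) measurable
    also have "\<dots> \<le> ennreal (2 * B) * ennreal (c * min 1 (norm h))"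
      by (rule mult_left_mono[OF c(2)]) simp
    also have "\<dots> = ennreal (2 * B * (c * min 1 (norm h)))"
      using B(1) c(1) by (intro ennreal_mult[symmetric]) auto
    also have "\<dots> \<le> ennreal (2 * B * c * norm h)"
      using B(1) c(1) by (intro ennreal_leI) (simp add: mult.assoc mult_left_mono)
    finally show ?thesis .
  qed
  \<comment> \<open>The added 1 keeps the denominator below positive even if \<open>B\<close> or
    \<open>c\<close> is 0.\<close>
  define k where "k = 2 * B * c + 1"
  have k: "k > 0"
    using B(1) c(1) by (simp add: k_def add_nonneg_pos)
  show "\<exists>d>0. \<forall>h. norm h < d \<longrightarrow> incr_sq \<phi> h \<le> ennreal e"
  proof (intro exI[of _ "e / k"] conjI allI impI)
    show "e / k > 0"
      using e k by simp
    fix h :: "real ^ 'a" assume "norm h < e / k"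
    then have "k * norm h \<le> e"
      using k by (simp add: pos_less_divide_eq mult.commute)
    moreover have "2 * B * c * norm h \<le> k * norm h"
      by (simp add: k_def distrib_right)
    ultimately show "incr_sq \<phi> h \<le> ennreal e"
      by (intro order_trans[OF le ennreal_leI]) (rule order_trans)
  qed
qed

text \<open>The arithmetic behind splitting an increment into two summands with weight d = 1, each
  being allowed a quarter of the tolerance.\<close>

lemma ennreal_quarters:
  assumes "0 \<le> e"
  shows "ennreal (1 + 1) * ennreal (e / 4) + ennreal (1 + 1 / 1) * ennreal (e / 4) = ennreal e"
proof -
  have "ennreal (1 + 1) * ennreal (e / 4) = ennreal (e / 2)"
    using assms by (subst ennreal_mult[symmetric]) auto
  moreover have "ennreal (e / 2) + ennreal (e / 2) = ennreal e"
    using assms by (subst ennreal_plus[symmetric]) auto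
  ultimately show ?thesis
    by simp
qed

lemma shift_continuous_add:
  assumes "shift_continuous u" "shift_continuous v" "u \<in> borel_measurable borel" "v \<in> borel_measurable borel"
  shows "shift_continuous (\<lambda>x. u x + v x)"
  unfolding shift_continuous_def
proof (intro allI impI)
  fix e :: real assume "e > 0"
  then have "e / 4 > 0"
    by simp
  obtain d1 where d1: "d1 > 0" "\<And>h. norm h < d1 \<Longrightarrow> incr_sq u h \<le> ennreal (e / 4)"
    using shift_continuousE[OF assms(1) \<open>e / 4 > 0\<close>] by blast
  obtain d2 where d2: "d2 > 0" "\<And>h. norm h < d2 \<Longrightarrow> incr_sq v h \<le> ennreal (e / 4)"
    using shift_continuousE[OF assms(2) \<open>e / 4 > 0\<close>] by blast
  show "\<exists>d>0. \<forall>h. norm h < d \<longrightarrow> incr_sq (\<lambda>x. u x + v x) h \<le> ennreal e"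
  proof (intro exI[of _ "min d1 d2"] conjI allI impI)
    fix h :: "real ^ 'a" assume h: "norm h < min d1 d2"
    have "incr_sq (\<lambda>x. u x + v x) h \<le> ennreal (1 + 1) * incr_sq u h + ennreal (1 + 1 / 1) * incr_sq v h"
      by (rule incr_sq_add_le[OF assms(3,4)]) simp
    also have "\<dots> \<le> ennreal (1 + 1) * ennreal (e / 4) + ennreal (1 + 1 / 1) * ennreal (e / 4)"
      using h by (intro add_mono mult_left_mono d1 d2) auto
    also have "\<dots> = ennreal e"
      by (rule ennreal_quarters)  (use \<open>e > 0\<close> in simp)
    finally show "incr_sq (\<lambda>x. u x + v x) h \<le> ennreal e" .
  qed (use d1 d2 in simp)
qed

text \<open>A test function near \<open>u\<close> has small increments for short h, and the
  increments of the difference are at most twice its L^2 norm for every h.\<close>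

lemma shift_continuous_limit:
  assumes u: "u \<in> SqInt lborel" and approx: "approximable \<Omega> u m"
  shows "shift_continuous u"
  unfolding shift_continuous_def
proof (intro allI impI)
  fix e :: real assume e: "e > 0"
  \<comment> \<open>Four times \<open>q\<close> squared is e/4, the share allotted to the
    difference.\<close>
  define q where "q = sqrt (e / 16)"
  have q: "q > 0" "q\<^sup>2 = e / 16"
    using e by (simp_all add: q_def)
  obtain \<phi> where \<phi>: "\<phi> \<in> test_functions \<Omega>" "nrm lborel (\<lambda>x. \<phi> x - u x) < q"
    using approx q(1) unfolding approximable_def by blast
  obtain d where d: "d > 0" "\<And>h. norm h < d \<Longrightarrow> incr_sq \<phi> h \<le> ennreal (e / 4)"
    using shift_continuousE[OF shift_continuous_test_function[OF \<phi>(1)], of "e / 4"] e by auto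
  have diff: "(\<lambda>x. u x - \<phi> x) \<in> SqInt lborel"
    by (rule SqInt_diff[OF u test_functions_SqInt[OF \<phi>(1)]])
  have "(nrm lborel (\<lambda>x. u x - \<phi> x))\<^sup>2 \<le> q\<^sup>2"
    using \<phi>(2) by (intro power_mono) (simp_all add: nrm_minus_commute[of lborel u] nrm_nonneg)
  note small = this
  have diff_le: "incr_sq (\<lambda>x. u x - \<phi> x) h \<le> ennreal (e / 4)" for h
    by (rule order_trans[OF incr_sq_le_nrm[OF diff]], rule ennreal_leI) (use small q(2) in simp)
  show "\<exists>d>0. \<forall>h. norm h < d \<longrightarrow> incr_sq u h \<le> ennreal e"
  proof (intro exI[of _ d] conjI allI impI)
    fix h :: "real ^ 'a" assume h: "norm h < d"
    have "incr_sq (\<lambda>x. \<phi> x + (u x - \<phi> x)) h \<le> ennreal (1 + 1) * incr_sq \<phi> h + ennreal (1 + 1 / 1) * incr_sq (\<lambda>x. u x - \<phi> x) h"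
      by (rule incr_sq_add_le) (use test_functions_measurable[OF \<phi>(1)] SqInt_measurable[OF diff] in simp_all)
    also have "\<dots> \<le> ennreal (1 + 1) * ennreal (e / 4) + ennreal (1 + 1 / 1) * ennreal (e / 4)"
      using h by (intro add_mono mult_left_mono d diff_le) auto
    also have "\<dots> = ennreal e"
      by (rule ennreal_quarters) (use e in simp)
    finally show "incr_sq u h \<le> ennreal e"
      by simp
  qed (rule d(1))
qed

lemma H1_supportedD:
  assumes "H1_supported \<Omega> u g"
  shows "u \<in> SqInt lborel" "g i \<in> SqInt lborel" "weak_pair u g" "shift_continuous u" "x \<notin> \<Omega> \<Longrightarrow> u x = 0"
    "u \<in> borel_measurable borel"
  using assms SqInt_measurable[of u lborel] by (auto simp: H1_supported_def)

lemma weak_pairD: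
  "weak_pair u g \<Longrightarrow> \<psi> \<in> test_functions UNIV \<Longrightarrow>
    (LINT x|lborel. u x * partial_deriv i \<psi> x) = - (LINT x|lborel. g i x * \<psi> x)"
  unfolding weak_pair_def by blast

section \<open>Multiplication by smooth cutoffs\<close>

lemma SqInt_mult_bounded:
  assumes f: "f \<in> SqInt M" and b: "b \<in> borel_measurable M" "\<And>x. \<bar>b x\<bar> \<le> B" and B: "0 \<le> B"
  shows "(\<lambda>x. b x * f x) \<in> SqInt M"
proof (rule SqInt_bound(1))
  show "(\<lambda>x. b x * f x) \<in> borel_measurable M"
    using b(1) SqInt_measurable[OF f] by (rule borel_measurable_times)
  have "(\<integral>\<^sup>+x. ennreal ((b x * f x)\<^sup>2) \<partial>M) \<le> (\<integral>\<^sup>+x. ennreal ((B * f x)\<^sup>2) \<partial>M)"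
  proof (rule nn_integral_mono, rule ennreal_leI)
    fix x
    have "\<bar>b x * f x\<bar> \<le> \<bar>B * f x\<bar>"
      using b(2)[of x] B by (simp add: abs_mult mult_right_mono)
    then show "(b x * f x)\<^sup>2 \<le> (B * f x)\<^sup>2"
      by (simp only: abs_le_square_iff)
  qed
  also have "\<dots> = ennreal ((nrm M (\<lambda>x. B * f x))\<^sup>2)"
    by (rule nn_integral_sq[OF SqInt_cmult[OF f]])
  finally show "(\<integral>\<^sup>+x. ennreal ((b x * f x)\<^sup>2) \<partial>M) \<le> ennreal ((nrm M (\<lambda>x. B * f x))\<^sup>2)" .
qed (rule nrm_nonneg)

lemma test_mult_SqInt:
  assumes "\<eta> \<in> test_functions UNIV" "f \<in> SqInt lborel"
  shows "(\<lambda>x. \<eta> x * f x) \<in> SqInt lborel"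
proof -
  obtain B where B: "B \<ge> 0" "\<And>x. \<bar>\<eta> x\<bar> \<le> B"
    using test_functions_bounded[OF assms(1)] by blast
  have "\<eta> \<in> borel_measurable lborel"
    using test_functions_measurable[OF assms(1)] by simp
  then show ?thesis
    by (rule SqInt_mult_bounded[OF assms(2) _ B(2,1)])
qed

text \<open>The increment of the product is \<eta>(x+h) (u(x+h) - u(x)) + (\<eta>(x+h) - \<eta>(x))
  u(x): the first term is small by the continuity of translations of \<open>u\<close>, the second by
  the Lipschitz bound for \<eta>.\<close>

lemma shift_continuous_mult:
  assumes u: "u \<in> SqInt lborel" "shift_continuous u" and \<eta>: "\<eta> \<in> test_functions UNIV"
  shows "shift_continuous (\<lambda>x. \<eta> x * u x)"
  unfolding shift_continuous_def
proof (intro allI impI)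
  fix e :: real assume e: "e > 0"
  obtain B where B: "B \<ge> 0" "\<And>x. \<bar>\<eta> x\<bar> \<le> B"
    using test_functions_bounded[OF \<eta>] by blast
  obtain L where L: "L \<ge> 0" "\<And>x y. \<bar>\<eta> x - \<eta> y\<bar> \<le> L * norm (x - y)"
    using test_functions_Lipschitz[OF \<eta>] by blast
  have [measurable]: "u \<in> borel_measurable borel" "\<eta> \<in> borel_measurable borel"
    using SqInt_measurable[OF u(1)] test_functions_measurable[OF \<eta>] by simp_all
  define b where "b = 2 * B\<^sup>2"
  define c where "c = 2 * L\<^sup>2 * (nrm lborel u)\<^sup>2"
  have bc: "b \<ge> 0" "c \<ge> 0"
    by (simp_all add: b_def c_def)
  have le: "incr_sq (\<lambda>x. \<eta> x * u x) h \<le> ennreal b * incr_sq u h + ennreal (c * (norm h)\<^sup>2)" for h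
  proof -
    have "incr_sq (\<lambda>x. \<eta> x * u x) h
        \<le> (\<integral>\<^sup>+x. ennreal b * ennreal ((u (x + h) - u x)\<^sup>2) + ennreal (2 * L\<^sup>2 * (norm h)\<^sup>2) * ennreal ((u x)\<^sup>2) \<partial>lborel)"
      unfolding incr_sq_def
    proof (rule nn_integral_mono)
      fix x
      have sq: "(p + q)\<^sup>2 \<le> 2 * p\<^sup>2 + 2 * q\<^sup>2" for p q :: real
        using zero_le_power2[of "p - q"] by (simp add: power2_sum power2_diff)
      have "(\<eta> (x + h) * u (x + h) - \<eta> x * u x)\<^sup>2 = (\<eta> (x + h) * (u (x + h) - u x) + (\<eta> (x + h) - \<eta> x) * u x)\<^sup>2"
        by (simp add: algebra_simps)
      also have "\<dots> \<le> 2 * ((\<eta> (x + h))\<^sup>2 * (u (x + h) - u x)\<^sup>2) + 2 * ((\<eta> (x + h) - \<eta> x)\<^sup>2 * (u x)\<^sup>2)"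
        using sq[of "\<eta> (x + h) * (u (x + h) - u x)" "(\<eta> (x + h) - \<eta> x) * u x"] by (simp only: power_mult_distrib)
      also have "\<dots> \<le> 2 * (B\<^sup>2 * (u (x + h) - u x)\<^sup>2) + 2 * ((L\<^sup>2 * (norm h)\<^sup>2) * (u x)\<^sup>2)"
      proof (intro add_mono mult_left_mono mult_right_mono)
        show "(\<eta> (x + h))\<^sup>2 \<le> B\<^sup>2"
          using power_mono[OF B(2)[of "x + h"], of 2] by simp
        show "(\<eta> (x + h) - \<eta> x)\<^sup>2 \<le> L\<^sup>2 * (norm h)\<^sup>2"
          using power_mono[OF L(2)[of "x + h" x], of 2] by (simp add: power_mult_distrib)
      qed auto
      also have "\<dots> = b * (u (x + h) - u x)\<^sup>2 + (2 * L\<^sup>2 * (norm h)\<^sup>2) * (u x)\<^sup>2"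
        by (simp add: b_def)
      finally have "ennreal ((\<eta> (x + h) * u (x + h) - \<eta> x * u x)\<^sup>2)
          \<le> ennreal (b * (u (x + h) - u x)\<^sup>2 + (2 * L\<^sup>2 * (norm h)\<^sup>2) * (u x)\<^sup>2)"
        by (rule ennreal_leI)
      also have "\<dots> = ennreal b * ennreal ((u (x + h) - u x)\<^sup>2) + ennreal (2 * L\<^sup>2 * (norm h)\<^sup>2) * ennreal ((u x)\<^sup>2)"
        using bc(1) by (simp only: ennreal_plus ennreal_mult mult_nonneg_nonneg zero_le_power2 zero_le_numeral)
      finally show "ennreal ((\<eta> (x + h) * u (x + h) - \<eta> x * u x)\<^sup>2)
          \<le> ennreal b * ennreal ((u (x + h) - u x)\<^sup>2) + ennreal (2 * L\<^sup>2 * (norm h)\<^sup>2) * ennreal ((u x)\<^sup>2)" .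
    qed
    also have "\<dots> = ennreal b * incr_sq u h + ennreal (2 * L\<^sup>2 * (norm h)\<^sup>2) * ennreal ((nrm lborel u)\<^sup>2)"
      unfolding incr_sq_def by (subst nn_integral_add) (measurable, simp add: nn_integral_cmult nn_integral_sq[OF u(1)])
    also have "ennreal (2 * L\<^sup>2 * (norm h)\<^sup>2) * ennreal ((nrm lborel u)\<^sup>2) = ennreal (c * (norm h)\<^sup>2)"
      by (subst ennreal_mult[symmetric]) (simp_all add: c_def mult_ac)
    finally show ?thesis .
  qed
  \<comment> \<open>Dividing by \<open>b + 1\<close> and \<open>c + 1\<close> keeps both thresholds
    positive and well defined when \<open>b\<close> or \<open>c\<close> is 0.\<close>
  obtain d where d: "d > 0" "\<And>h. norm h < d \<Longrightarrow> incr_sq u h \<le> ennreal (e / (2 * (b + 1)))"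
    using shift_continuousE[OF u(2), of "e / (2 * (b + 1))"] e bc(1) by auto
  define q where "q = sqrt (e / (2 * (c + 1)))"
  have q: "q > 0" "q\<^sup>2 = e / (2 * (c + 1))"
    using e bc(2) by (simp_all add: q_def)
  show "\<exists>d>0. \<forall>h. norm h < d \<longrightarrow> incr_sq (\<lambda>x. \<eta> x * u x) h \<le> ennreal e"
  proof (intro exI[of _ "min d q"] conjI allI impI)
    fix h :: "real ^ 'a" assume h: "norm h < min d q"
    have "c * (norm h)\<^sup>2 \<le> c * q\<^sup>2"
      using h bc(2) by (intro mult_left_mono power_mono) auto
    also have "\<dots> \<le> e / 2"
      using e bc(2) by (simp add: q(2) field_simps)
    finally have 2: "c * (norm h)\<^sup>2 \<le> e / 2" .
    have 1: "b * (e / (2 * (b + 1))) \<le> e / 2"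
      using e bc(1) by (simp add: field_simps)
    have "incr_sq (\<lambda>x. \<eta> x * u x) h \<le> ennreal b * ennreal (e / (2 * (b + 1))) + ennreal (c * (norm h)\<^sup>2)"
      using h by (intro order_trans[OF le] add_mono mult_left_mono d) auto
    also have "ennreal b * ennreal (e / (2 * (b + 1))) = ennreal (b * (e / (2 * (b + 1))))"
      using e bc(1) by (intro ennreal_mult[symmetric]) auto
    also have "ennreal (b * (e / (2 * (b + 1)))) + ennreal (c * (norm h)\<^sup>2) = ennreal (b * (e / (2 * (b + 1))) + c * (norm h)\<^sup>2)"
      using e bc by (intro ennreal_plus[symmetric]) auto
    also have "\<dots> \<le> ennreal (e / 2 + e / 2)"
      by (rule ennreal_leI, rule add_mono[OF 1 2])
    also have "ennreal (e / 2 + e / 2) = ennreal e"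
      by simp
    finally show "incr_sq (\<lambda>x. \<eta> x * u x) h \<le> ennreal e" .
  qed (use d q in simp)
qed

text \<open>The Leibniz rule, from testing the weak gradient of \<open>u\<close> with the product of
  \<eta> and \<psi>.\<close>

lemma H1_supported_mult:
  assumes u: "H1_supported \<Omega> u g" and \<eta>: "\<eta> \<in> test_functions UNIV"
  shows "H1_supported \<Omega> (\<lambda>x. \<eta> x * u x) (\<lambda>i x. \<eta> x * g i x + partial_deriv i \<eta> x * u x)"
  unfolding H1_supported_def
proof (intro conjI allI impI)
  note D = H1_supportedD[OF u]
  have pd\<eta>: "partial_deriv i \<eta> \<in> test_functions UNIV" for i
    by (rule test_functions_partial_deriv[OF \<eta>])
  show "(\<lambda>x. \<eta> x * u x) \<in> SqInt lborel"
    by (rule test_mult_SqInt[OF \<eta> D(1)])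
  show "(\<lambda>x. \<eta> x * g i x + partial_deriv i \<eta> x * u x) \<in> SqInt lborel" for i
    by (rule SqInt_add[OF test_mult_SqInt[OF \<eta> D(2)] test_mult_SqInt[OF pd\<eta> D(1)]])
  show "shift_continuous (\<lambda>x. \<eta> x * u x)"
    by (rule shift_continuous_mult[OF D(1,4) \<eta>])
  show "\<eta> x * u x = 0" if "x \<notin> \<Omega>" for x
    using D(5)[OF that] by simp
  show "weak_pair (\<lambda>x. \<eta> x * u x) (\<lambda>i x. \<eta> x * g i x + partial_deriv i \<eta> x * u x)"
    unfolding weak_pair_def
  proof (intro ballI allI)
    fix \<psi> :: "real ^ 'a \<Rightarrow> real" and i assume \<psi>: "\<psi> \<in> test_functions UNIV"
    have prod: "(\<lambda>x. \<eta> x * \<psi> x) \<in> test_functions UNIV"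
      by (rule test_functions_mult_smooth[OF \<psi> test_functions_smooth[OF \<eta>]])
    have pd: "partial_deriv i (\<lambda>x. \<eta> x * \<psi> x) x = \<eta> x * partial_deriv i \<psi> x + partial_deriv i \<eta> x * \<psi> x" for x
      by (rule partial_deriv_mult[OF test_functions_differentiable[OF \<eta>] test_functions_differentiable[OF \<psi>]])
    have int1: "integrable lborel (\<lambda>x. (\<eta> x * u x) * partial_deriv i \<psi> x)"
      by (rule SqInt_mult_integrable[OF test_mult_SqInt[OF \<eta> D(1)] partial_deriv_test_SqInt[OF \<psi>]])
    have int2: "integrable lborel (\<lambda>x. (partial_deriv i \<eta> x * u x) * \<psi> x)"
      by (rule SqInt_mult_integrable[OF test_mult_SqInt[OF pd\<eta> D(1)] test_functions_SqInt[OF \<psi>]])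
    have int3: "integrable lborel (\<lambda>x. (\<eta> x * g i x) * \<psi> x)"
      by (rule SqInt_mult_integrable[OF test_mult_SqInt[OF \<eta> D(2)] test_functions_SqInt[OF \<psi>]])
    have "(LINT x|lborel. (\<eta> x * u x) * partial_deriv i \<psi> x) + (LINT x|lborel. (partial_deriv i \<eta> x * u x) * \<psi> x)
        = (LINT x|lborel. u x * partial_deriv i (\<lambda>x. \<eta> x * \<psi> x) x)"
      unfolding pd Bochner_Integration.integral_add[OF int1 int2, symmetric]
      by (rule Bochner_Integration.integral_cong) (simp_all add: algebra_simps)
    also have "\<dots> = - (LINT x|lborel. g i x * (\<eta> x * \<psi> x))"
      by (rule weak_pairD[OF D(3) prod])
    also have "(LINT x|lborel. g i x * (\<eta> x * \<psi> x)) = (LINT x|lborel. (\<eta> x * g i x) * \<psi> x)"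
      by (rule Bochner_Integration.integral_cong) (simp_all add: algebra_simps)
    finally have "(LINT x|lborel. (\<eta> x * u x) * partial_deriv i \<psi> x)
        = - ((LINT x|lborel. (\<eta> x * g i x) * \<psi> x) + (LINT x|lborel. (partial_deriv i \<eta> x * u x) * \<psi> x))"
      by simp
    then show "(LINT x|lborel. (\<eta> x * u x) * partial_deriv i \<psi> x)
        = - (LINT x|lborel. (\<eta> x * g i x + partial_deriv i \<eta> x * u x) * \<psi> x)"
      unfolding distrib_right Bochner_Integration.integral_add[OF int3 int2] .
  qed
qed

lemma weak_pair_diff:
  assumes weak: "weak_pair u g" "weak_pair v h" and S: "u \<in> SqInt lborel" "v \<in> SqInt lborel"
    "\<And>i. g i \<in> SqInt lborel" "\<And>i. h i \<in> SqInt lborel"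
  shows "weak_pair (\<lambda>x. u x - v x) (\<lambda>i x. g i x - h i x)"
  unfolding weak_pair_def
proof (intro ballI allI)
  fix \<psi> :: "real ^ 'a \<Rightarrow> real" and i assume \<psi>: "\<psi> \<in> test_functions UNIV"
  have "(LINT x|lborel. (u x - v x) * partial_deriv i \<psi> x)
      = (LINT x|lborel. u x * partial_deriv i \<psi> x) - (LINT x|lborel. v x * partial_deriv i \<psi> x)"
    unfolding left_diff_distrib
    by (rule Bochner_Integration.integral_diff[OF SqInt_mult_integrable[OF S(1) partial_deriv_test_SqInt[OF \<psi>]]
          SqInt_mult_integrable[OF S(2) partial_deriv_test_SqInt[OF \<psi>]]])
  moreover have "(LINT x|lborel. (g i x - h i x) * \<psi> x) = (LINT x|lborel. g i x * \<psi> x) - (LINT x|lborel. h i x * \<psi> x)"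
    unfolding left_diff_distrib
    by (rule Bochner_Integration.integral_diff[OF SqInt_mult_integrable[OF S(3) test_functions_SqInt[OF \<psi>]]
          SqInt_mult_integrable[OF S(4) test_functions_SqInt[OF \<psi>]]])
  ultimately show "(LINT x|lborel. (u x - v x) * partial_deriv i \<psi> x) = - (LINT x|lborel. (g i x - h i x) * \<psi> x)"
    using weak_pairD[OF weak(1) \<psi>, of i] weak_pairD[OF weak(2) \<psi>, of i] by simp
qed

lemma H1_supported_diff:
  assumes u: "H1_supported \<Omega> u g" and v: "H1_supported \<Omega> v h"
  shows "H1_supported \<Omega> (\<lambda>x. u x - v x) (\<lambda>i x. g i x - h i x)"
  unfolding H1_supported_def
proof (intro conjI allI impI)
  note D = H1_supportedD[OF u] and E = H1_supportedD[OF v]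
  show "(\<lambda>x. u x - v x) \<in> SqInt lborel" "(\<lambda>x. g i x - h i x) \<in> SqInt lborel" for i
    by (rule SqInt_diff[OF D(1) E(1)], rule SqInt_diff[OF D(2) E(2)])
  show "u x - v x = 0" if "x \<notin> \<Omega>" for x
    using D(5)[OF that] E(5)[OF that] by simp
  have neg: "incr_sq (\<lambda>x. - v x) h = incr_sq v h" for h
    by (simp add: incr_sq_def power2_commute)
  have "shift_continuous (\<lambda>x. - v x)"
    using E(4) unfolding shift_continuous_def neg .
  from shift_continuous_add[OF D(4) this D(6)] show "shift_continuous (\<lambda>x. u x - v x)"
    using E(6) by simp
  show "weak_pair (\<lambda>x. u x - v x) (\<lambda>i x. g i x - h i x)"
    by (rule weak_pair_diff[OF D(3) E(3) D(1) E(1) D(2) E(2)])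
qed

text \<open>For fixed x the reflected kernel y \<mapsto> \<rho>(x - y) is a test function; the sign
  from the reflection cancels the sign in the weak formulation.\<close>

lemma conv_partial_deriv_weak_pair:
  assumes u: "weak_pair u g" and \<rho>: "\<rho> \<in> test_functions UNIV"
  shows "conv (partial_deriv i \<rho>) u = conv \<rho> (g i)"
proof
  fix x
  let ?\<psi> = "\<lambda>y. \<rho> (x + (-1) *\<^sub>R y)"
  obtain R where R: "R \<ge> 0" "\<And>z. norm z > R \<Longrightarrow> \<rho> z = 0"
    using test_functions_ball[OF \<rho>] by blast
  have \<psi>: "?\<psi> \<in> test_functions UNIV"
    by (rule test_functionsI[OF smooth_affine[OF test_functions_smooth[OF \<rho>]] compact_cball subset_UNIV, of x R])
      (use R(2) in \<open>simp add: dist_norm\<close>)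
  have "partial_deriv i ?\<psi> y = - partial_deriv i \<rho> (x - y)" for y
    using partial_deriv_affine[OF test_functions_differentiable[OF \<rho>], of i x "-1" y] by simp
  then have "(LINT y|lborel. u y * - partial_deriv i \<rho> (x - y)) = - (LINT y|lborel. g i y * \<rho> (x - y))"
    using weak_pairD[OF u \<psi>, of i] by simp
  then show "conv (partial_deriv i \<rho>) u x = conv \<rho> (g i) x"
    by (simp add: conv_def mult.commute)
qed

text \<open>Arbitrarily short vectors push \<open>K\<close> into \<Omega>. A whole ball of such
  vectors is required, because it must contain the support of a mollifier.\<close>

definition inward :: "(real ^ 'n) set \<Rightarrow> (real ^ 'n) set \<Rightarrow> bool" where
  "inward \<Omega> K \<longleftrightarrow> (\<forall>e>0. \<exists>z r. r > 0 \<and> (\<forall>x\<in>cball z r. norm x < e) \<and> (\<forall>x\<in>cball z r. \<forall>y\<in>K. x + y \<in> \<Omega>))"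

text \<open>
  A mollifier concentrated near a small inward vector translates and regularizes at the same time.
\<close>

lemma approximable_inward:
  assumes u: "H1_supported \<Omega> u g" and K: "compact K" "\<And>x. x \<notin> K \<Longrightarrow> u x = 0" and inward: "inward \<Omega> K"
  shows "approximable \<Omega> u (\<Sum>i\<in>UNIV. (nrm lborel (g i))\<^sup>2)"
  unfolding approximable_def
proof (intro allI impI)
  note D = H1_supportedD[OF u]
  fix e :: real assume e: "e > 0"
  obtain d where d: "d > 0" "\<And>h. norm h < d \<Longrightarrow> incr_sq u h \<le> ennreal ((e / 2)\<^sup>2)"
    using shift_continuousE[OF D(4), of "(e / 2)\<^sup>2"] e by auto
  obtain z r where zr: "r > 0" "\<forall>x\<in>cball z r. norm x < d" "\<forall>x\<in>cball z r. \<forall>y\<in>K. x + y \<in> \<Omega>"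
    using inward[unfolded inward_def, rule_format, OF d(1)] by (elim exE conjE)
  have "\<exists>\<rho>. mollifier \<rho> \<and> (\<forall>x. x \<notin> cball z r \<longrightarrow> \<rho> x = 0)"
    by (rule mollifier_exists[OF zr(1), of z], rule exI, rule conjI, assumption, simp)
  then obtain \<rho> where \<rho>: "mollifier \<rho>" "\<And>x. x \<notin> cball z r \<Longrightarrow> \<rho> x = 0"
    by blast
  have \<rho>_test: "\<rho> \<in> test_functions UNIV" and \<rho>_nonneg: "0 \<le> \<rho> x" for x
    using \<rho>(1) by (simp_all add: mollifier_def)
  have [measurable]: "\<rho> \<in> borel_measurable borel" "u \<in> borel_measurable borel"
    by (rule test_functions_measurable[OF \<rho>_test], rule D(6))
  have test: "conv \<rho> u \<in> test_functions \<Omega>"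
    by (rule conv_test_functions[OF \<rho>_test \<rho>(2) compact_cball D(1) K(2,1) zr(3)[rule_format]])
  have "(\<integral>\<^sup>+x. ennreal ((conv \<rho> u x - u x)\<^sup>2) \<partial>lborel) \<le> (\<integral>\<^sup>+h. ennreal (\<rho> h) * incr_sq u h \<partial>lborel)"
    by (rule mollify_error[OF \<rho>(1) D(1)])
  also have "\<dots> \<le> (\<integral>\<^sup>+h. ennreal \<bar>\<rho> h\<bar> * ennreal ((e / 2)\<^sup>2) \<partial>lborel)"
  proof (rule nn_integral_mono)
    fix h
    show "ennreal (\<rho> h) * incr_sq u h \<le> ennreal \<bar>\<rho> h\<bar> * ennreal ((e / 2)\<^sup>2)"
    proof (cases "h \<in> cball z r")
      case True
      then show ?thesis
        using \<rho>_nonneg[of h] d(2)[OF zr(2)[rule_format, OF True]] by (simp add: mult_left_mono)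
    qed (simp add: \<rho>(2))
  qed
  also have "\<dots> = (\<integral>\<^sup>+h. ennreal \<bar>\<rho> h\<bar> \<partial>lborel) * ennreal ((e / 2)\<^sup>2)"
    by (rule nn_integral_multc) measurable
  also have "\<dots> = ennreal ((e / 2)\<^sup>2)"
    by (simp add: mollifier_nn_integral[OF \<rho>(1)])
  finally have "nrm lborel (\<lambda>x. conv \<rho> u x - u x) \<le> e / 2"
    by (rule SqInt_bound(2)[rotated]) (use e in simp_all)
  \<comment> \<open>The derivatives of the convolution are the convolutions of the components
    \<open>g i\<close>, and a mollifier does not increase their norms wherever it is
    centred.\<close>
  moreover have "dirichlet (conv \<rho> u) \<le> (\<Sum>i\<in>UNIV. (nrm lborel (g i))\<^sup>2)"
    unfolding dirichlet_def partial_deriv_conv[OF \<rho>_test D(1)] conv_partial_deriv_weak_pair[OF D(3) \<rho>_test]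
    by (intro sum_mono power_mono mollifier_Young(2)[OF \<rho>(1) D(2)] nrm_nonneg)
  ultimately show "\<exists>\<phi>\<in>test_functions \<Omega>. nrm lborel (\<lambda>x. \<phi> x - u x) < e \<and> dirichlet \<phi> \<le> (\<Sum>i\<in>UNIV. (nrm lborel (g i))\<^sup>2)"
    using e by (intro bexI[OF _ test] conjI) simp_all
qed

text \<open>The factor 2 comes from dropping the energy of the difference in the parallelogram law.
  Such bounds serve only to show membership in \<open>H01\<close>, where finiteness is what
  counts.\<close>

lemma approximable_add:
  assumes u: "approximable \<Omega> u m" "u \<in> SqInt lborel" and v: "approximable \<Omega> v k" "v \<in> SqInt lborel"
  shows "approximable \<Omega> (\<lambda>x. u x + v x) (2 * m + 2 * k)"
  unfolding approximable_def
proof (intro allI impI)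
  fix e :: real assume "e > 0"
  then have e: "e / 2 > 0"
    by simp
  obtain \<phi> where \<phi>: "\<phi> \<in> test_functions \<Omega>" "nrm lborel (\<lambda>x. \<phi> x - u x) < e / 2" "dirichlet \<phi> \<le> m"
    using u(1) e unfolding approximable_def by blast
  obtain \<psi> where \<psi>: "\<psi> \<in> test_functions \<Omega>" "nrm lborel (\<lambda>x. \<psi> x - v x) < e / 2" "dirichlet \<psi> \<le> k"
    using v(1) e unfolding approximable_def by blast
  have "(\<lambda>x. \<phi> x + \<psi> x - (u x + v x)) = (\<lambda>x. (\<phi> x - u x) + (\<psi> x - v x))"
    by (simp add: fun_eq_iff)
  then have "nrm lborel (\<lambda>x. \<phi> x + \<psi> x - (u x + v x)) \<le> nrm lborel (\<lambda>x. \<phi> x - u x) + nrm lborel (\<lambda>x. \<psi> x - v x)"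
    using nrm_triangle[OF SqInt_diff[OF test_functions_SqInt[OF \<phi>(1)] u(2)] SqInt_diff[OF test_functions_SqInt[OF \<psi>(1)] v(2)]]
    by simp
  then have "nrm lborel (\<lambda>x. \<phi> x + \<psi> x - (u x + v x)) < e"
    using \<phi>(2) \<psi>(2) by simp
  moreover have "dirichlet (\<lambda>x. \<phi> x + \<psi> x) \<le> 2 * m + 2 * k"
    using dirichlet_parallelogram[OF \<phi>(1) \<psi>(1)] dirichlet_nonneg[of "\<lambda>x. \<phi> x - \<psi> x"] \<phi>(3) \<psi>(3) by simp
  ultimately show "\<exists>\<phi>\<in>test_functions \<Omega>. nrm lborel (\<lambda>x. \<phi> x - (u x + v x)) < e \<and> dirichlet \<phi> \<le> 2 * m + 2 * k"
    by (intro bexI[OF _ test_functions_add[OF \<phi>(1) \<psi>(1)]]) simp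
qed

section \<open>Inward shifts at interior and boundary points\<close>

lemma inward_interior:
  fixes \<Omega> :: "(real ^ 'n) set"
  assumes "open \<Omega>" "p \<in> \<Omega>"
  obtains r where "r > 0" "inward \<Omega> (closure \<Omega> \<inter> cball p (2 * r))"
proof -
  obtain R where R: "R > 0" "cball p R \<subseteq> \<Omega>"
    using assms open_contains_cball by blast
  have "inward \<Omega> (closure \<Omega> \<inter> cball p (2 * (R / 4)))"
    unfolding inward_def
  proof (intro allI impI)
    fix e :: real assume e: "e > 0"
    define t where "t = min (R / 2) (e / 2)"
    have t: "t > 0" "t \<le> R / 2" "t < e"
      using R(1) e by (auto simp: t_def)
    have "x + y \<in> \<Omega>" if "x \<in> cball 0 t" "y \<in> closure \<Omega> \<inter> cball p (2 * (R / 4))" for x y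
    proof -
      have "dist p (x + y) \<le> R"
        using that t(2) norm_triangle_ineq4[of "p - y" x] by (simp add: dist_norm algebra_simps)
      then show ?thesis
        using R(2) by auto
    qed
    then show "\<exists>z r. r > 0 \<and> (\<forall>x\<in>cball z r. norm x < e) \<and> (\<forall>x\<in>cball z r. \<forall>y\<in>closure \<Omega> \<inter> cball p (2 * (R / 4)). x + y \<in> \<Omega>)"
      using t by (intro exI[of _ 0] exI[of _ t] conjI ballI) simp_all
  qed
  then show thesis
    using R(1) by (intro that[of "R / 4"]) auto
qed

text \<open>In the graph direction \<open>v\<close> every shift raises the height above the graph by
  its length. The closure of \<Omega> has nonnegative height near p, so a shifted piece of it lies
  in \<Omega>; compactness then allows a small ball around the shift vector.\<close>

lemma inward_boundary:
  fixes \<Omega> :: "(real ^ 'n) set"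
  assumes \<Omega>: "open \<Omega>" "lipschitz_boundary \<Omega>" "p \<in> frontier \<Omega>"
  obtains r where "r > 0" "inward \<Omega> (closure \<Omega> \<inter> cball p (2 * r))"
proof -
  from bspec[OF \<Omega>(2)[unfolded lipschitz_boundary_def] \<Omega>(3)] obtain v R L \<gamma> where
    *: "norm v = 1 \<and> R > 0 \<and> L-lipschitz_on {z. z \<bullet> v = 0} \<gamma> \<and>
      \<Omega> \<inter> ball p R = {x \<in> ball p R. \<gamma> (x - (x \<bullet> v) *\<^sub>R v) < x \<bullet> v}"
    by (elim exE)
  note v = conjunct1[OF *] and R = conjunct1[OF conjunct2[OF *]]
    and \<gamma> = conjunct1[OF conjunct2[OF conjunct2[OF *]]] and epi = conjunct2[OF conjunct2[OF conjunct2[OF *]]]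
  \<comment> \<open>The height of a point above the graph, measured along \<open>v\<close>; inside
    the ball around p, \<Omega> is the set where it is positive.\<close>
  define F where "F x = x \<bullet> v - \<gamma> (x - (x \<bullet> v) *\<^sub>R v)" for x
  have vv: "v \<bullet> v = 1"
    using v by (simp add: norm_eq_1)
  have "continuous_on UNIV (\<lambda>x. \<gamma> (x - (x \<bullet> v) *\<^sub>R v))"
  proof (rule continuous_on_compose2[OF lipschitz_on_continuous_on[OF \<gamma>]])
    show "continuous_on UNIV (\<lambda>x. x - (x \<bullet> v) *\<^sub>R v)"
      by (intro continuous_intros)
    show "range (\<lambda>x. x - (x \<bullet> v) *\<^sub>R v) \<subseteq> {z. z \<bullet> v = 0}"
      by (auto simp: inner_diff_left vv)
  qed
  then have F_cont: "continuous_on UNIV F"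
    unfolding F_def by (rule continuous_on_diff[rotated]) (intro continuous_intros)
  have F_shift: "F (x + t *\<^sub>R v) = F x + t" for x t
  proof -
    have inner: "(x + t *\<^sub>R v) \<bullet> v = x \<bullet> v + t"
      by (simp add: inner_add_left vv)
    have arg: "x + t *\<^sub>R v - (x \<bullet> v + t) *\<^sub>R v = x - (x \<bullet> v) *\<^sub>R v"
      unfolding scaleR_add_left by (rule add_diff_cancel_right)
    then show ?thesis
      unfolding F_def inner arg by simp
  qed
  have F_pos: "x \<in> \<Omega> \<longleftrightarrow> F x > 0" if "x \<in> ball p R" for x
  proof -
    have "x \<in> \<Omega> \<longleftrightarrow> x \<in> \<Omega> \<inter> ball p R"
      using that by simp
    also have "\<dots> \<longleftrightarrow> F x > 0"
      unfolding epi F_def using that by simp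
    finally show ?thesis .
  qed
  have F_nonneg: "F x \<ge> 0" if "x \<in> closure \<Omega>" "x \<in> ball p R" for x
  proof -
    have "closed {x. 0 \<le> F x}"
      using continuous_on_closed_Collect_le[OF continuous_on_const F_cont] by simp
    moreover have "ball p R \<inter> \<Omega> \<subseteq> {x. 0 \<le> F x}"
      using F_pos by (auto intro: less_imp_le)
    ultimately have "closure (ball p R \<inter> \<Omega>) \<subseteq> {x. 0 \<le> F x}"
      by (rule closure_minimal[rotated])
    \<comment> \<open>As the ball is open, a limit of points of \<Omega> that lies in the ball is a
      limit of points of \<Omega> in the ball, where the local description is valid.\<close>
    moreover have "x \<in> closure (ball p R \<inter> \<Omega>)"
      using open_Int_closure_subset[OF open_ball, of p R \<Omega>] that by blast
    ultimately show ?thesis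
      by blast
  qed
  let ?K = "closure \<Omega> \<inter> cball p (2 * (R / 4))"
  have K: "compact ?K"
    by (rule closed_Int_compact) auto
  have "inward \<Omega> ?K"
    unfolding inward_def
  proof (intro allI impI)
    fix e :: real assume e: "e > 0"
    \<comment> \<open>Points of the piece are within \<open>R / 2\<close> of p, so a shift of length
      at most \<open>R / 4\<close> does not leave the ball on which the description of \<Omega>
      holds.\<close>
    define t where "t = min (R / 4) (e / 4)"
    have t: "t > 0" "t \<le> R / 4" "t \<le> e / 4"
      using R e by (auto simp: t_def)
    have sub: "(+) (t *\<^sub>R v) ` ?K \<subseteq> \<Omega>"
    proof
      fix w assume "w \<in> (+) (t *\<^sub>R v) ` ?K"
      then obtain y where y: "w = y + t *\<^sub>R v" "y \<in> closure \<Omega>" "dist p y \<le> R / 2"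
        by (auto simp: add.commute)
      have "y \<in> ball p R"
        using y(3) R by simp
      have "dist y w = t"
        using t(1) v by (simp add: y(1) dist_norm)
      then have "w \<in> ball p R"
        using y(3) t(2) R dist_triangle[of p w y] by simp
      moreover have "F w > 0"
        using F_nonneg[OF y(2) \<open>y \<in> ball p R\<close>] t(1) by (simp add: y(1) F_shift)
      ultimately show "w \<in> \<Omega>"
        using F_pos by blast
    qed
    have "compact ((+) (t *\<^sub>R v) ` ?K)"
      by (rule compact_translation[OF K])
    \<comment> \<open>The shifted piece is a compact subset of the open set \<Omega> and so has a
      uniform margin, which becomes the radius of the ball of admissible vectors.\<close>
    then obtain q where q: "q > 0" "(\<Union>x\<in>(+) (t *\<^sub>R v) ` ?K. cball x q) \<subseteq> \<Omega>"
      using compact_subset_open_imp_cball_epsilon_subset[OF _ \<Omega>(1) sub] by blast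
    define r where "r = min q (e / 4)"
    have r: "r > 0" "r \<le> q" "r \<le> e / 4"
      using q(1) e by (auto simp: r_def)
    have small: "norm x < e" if "x \<in> cball (t *\<^sub>R v) r" for x
    proof -
      have "norm x \<le> norm (t *\<^sub>R v) + norm (t *\<^sub>R v - x)"
        using norm_triangle_ineq4[of "t *\<^sub>R v" "t *\<^sub>R v - x"] by simp
      also have "\<dots> \<le> e / 4 + e / 4"
        using that t r v by (intro add_mono) (auto simp: dist_norm)
      finally show ?thesis
        using e by simp
    qed
    have mem: "x + y \<in> \<Omega>" if "x \<in> cball (t *\<^sub>R v) r" "y \<in> ?K" for x y
    proof -
      have "dist (t *\<^sub>R v + y) (x + y) \<le> q"
        using that(1) r(2) by (simp add: dist_norm)
      moreover have "t *\<^sub>R v + y \<in> (+) (t *\<^sub>R v) ` ?K"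
        using that(2) by (rule imageI)
      ultimately have "x + y \<in> (\<Union>x\<in>(+) (t *\<^sub>R v) ` ?K. cball x q)"
        by (intro UN_I) (simp_all only: mem_cball)
      then show ?thesis
        using q(2) by (rule subsetD[rotated])
    qed
    show "\<exists>z r. r > 0 \<and> (\<forall>x\<in>cball z r. norm x < e) \<and> (\<forall>x\<in>cball z r. \<forall>y\<in>?K. x + y \<in> \<Omega>)"
      by (intro exI[of _ "t *\<^sub>R v"] exI[of _ r] conjI ballI r(1) small mem)
  qed
  then show thesis
    using R by (intro that[of "R / 4"]) auto
qed

text \<open>Induction over the centres in place of a partition of unity: each step splits off \<eta>
  u, supported where an inward shift exists, and leaves (1 - \<eta>) u. The vanishing product
  records that nothing remains once all centres are used.\<close>

lemma approximable_partition:
  fixes \<Omega> :: "(real ^ 'n) set"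
  assumes "finite F" "\<And>c. c \<in> F \<Longrightarrow> r c > 0" "\<And>c. c \<in> F \<Longrightarrow> inward \<Omega> (closure \<Omega> \<inter> cball c (2 * r c))"
    and "bounded \<Omega>" "H1_supported \<Omega> u g" "\<And>x. (\<Prod>c\<in>F. 1 - cutoff c (r c) x) * u x = 0"
  shows "\<exists>m. approximable \<Omega> u m"
  using assms
proof (induction F arbitrary: u g rule: finite_induct)
  case empty
  then have "u = (\<lambda>x. 0)"
    by (simp add: fun_eq_iff)
  then show ?case
    unfolding approximable_def
    by (intro exI[of _ "dirichlet (\<lambda>x :: real ^ 'n. 0)"] allI impI bexI[OF _ test_functions_zero]) (simp add: nrm_def)
next
  case (insert c F)
  let ?\<eta> = "cutoff c (r c)"
  have \<eta>: "?\<eta> \<in> test_functions UNIV"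
    by (rule cutoff_test_function) (use insert.prems in auto)
  have w: "H1_supported \<Omega> (\<lambda>x. ?\<eta> x * u x) (\<lambda>i x. ?\<eta> x * g i x + partial_deriv i ?\<eta> x * u x)"
    by (rule H1_supported_mult[OF insert.prems(4) \<eta>])
  have u': "H1_supported \<Omega> (\<lambda>x. u x - ?\<eta> x * u x) (\<lambda>i x. g i x - (?\<eta> x * g i x + partial_deriv i ?\<eta> x * u x))"
    by (rule H1_supported_diff[OF insert.prems(4) w])
  \<comment> \<open>The factor taken out of the product is absorbed by the remaining function, so
    the hypothesis persists for the smaller set of centres.\<close>
  have "(\<Prod>c\<in>F. 1 - cutoff c (r c) x) * (u x - ?\<eta> x * u x) = 0" for x
    using insert.prems(5)[of x] insert.hyps by (simp add: algebra_simps)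
  then obtain m where m: "approximable \<Omega> (\<lambda>x. u x - ?\<eta> x * u x) m"
    using insert.IH[OF _ _ insert.prems(3) u'] insert.prems(1,2) by blast
  have "compact (closure \<Omega> \<inter> cball c (2 * r c))"
    by (rule closed_Int_compact) auto
  moreover have "?\<eta> x * u x = 0" if "x \<notin> closure \<Omega> \<inter> cball c (2 * r c)" for x
  proof (cases "x \<in> \<Omega>")
    case True
    then have "dist x c \<ge> 2 * r c"
      using that closure_subset[of \<Omega>] by (auto simp: dist_commute)
    then show ?thesis
      using cutoff_eq_0[of "r c" x c] insert.prems(1)[of c] by simp
  next
    case False
    then show ?thesis
      using H1_supportedD(5)[OF insert.prems(4)] by simp
  qed
  ultimately obtain k where k: "approximable \<Omega> (\<lambda>x. ?\<eta> x * u x) k"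
    using approximable_inward[OF w _ _ insert.prems(2)[OF insertI1]] by blast
  have "approximable \<Omega> (\<lambda>x. (u x - ?\<eta> x * u x) + ?\<eta> x * u x) (2 * m + 2 * k)"
    by (rule approximable_add[OF m H1_supportedD(1)[OF u'] k H1_supportedD(1)[OF w]])
  then show ?case
    by (intro exI[of _ "2 * m + 2 * k"]) simp
qed

text \<open>A finite subcover of the closure by balls on which the cutoffs are 1: at each point of
  \<Omega> some factor of the product vanishes, and off \<Omega> the function itself does.\<close>

lemma H1_supported_approximable:
  fixes \<Omega> :: "(real ^ 'n) set"
  assumes \<Omega>: "bounded_lipschitz_domain \<Omega>" and u: "H1_supported \<Omega> u g"
  shows "\<exists>m. approximable \<Omega> u m"
proof -
  have op: "open \<Omega>" and bd: "bounded \<Omega>" and lip: "lipschitz_boundary \<Omega>"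
    using \<Omega> by (auto simp: bounded_lipschitz_domain_def)
  have "\<exists>r>0. inward \<Omega> (closure \<Omega> \<inter> cball p (2 * r))" if "p \<in> closure \<Omega>" for p
  proof (cases "p \<in> \<Omega>")
    case True
    then show ?thesis
      using inward_interior[OF op True] by blast
  next
    case False
    then have "p \<in> frontier \<Omega>"
      using that op by (simp add: frontier_def interior_open)
    then show ?thesis
      using inward_boundary[OF op lip] by blast
  qed
  then obtain r where r: "\<And>p. p \<in> closure \<Omega> \<Longrightarrow> r p > 0"
    "\<And>p. p \<in> closure \<Omega> \<Longrightarrow> inward \<Omega> (closure \<Omega> \<inter> cball p (2 * r p))"
    by metis
  have "compact (closure \<Omega>)"
    using bd by simp
  then obtain F where F: "F \<subseteq> closure \<Omega>" "finite F" "closure \<Omega> \<subseteq> (\<Union>p\<in>F. ball p (r p))"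
    by (rule compactE_image[of _ "closure \<Omega>" "\<lambda>p. ball p (r p)"]) (use r(1) in auto)
  have "(\<Prod>c\<in>F. 1 - cutoff c (r c) x) * u x = 0" for x
  proof (cases "x \<in> \<Omega>")
    case True
    then obtain c where c: "c \<in> F" "dist x c < r c"
      using F(3) closure_subset[of \<Omega>] by (auto simp: dist_commute)
    then have "1 - cutoff c (r c) x = 0"
      using F(1) r(1) by (subst cutoff_eq_1) auto
    then have "(\<Prod>c\<in>F. 1 - cutoff c (r c) x) = 0"
      using c(1) F(2) by (intro prod_zero) auto
    then show ?thesis
      by simp
  next
    case False
    then show ?thesis
      using H1_supportedD(5)[OF u] by simp
  qed
  from approximable_partition[OF F(2) _ _ bd u this] show ?thesis
    using F(1) r by blast
qed

subsection \<open>Membership in \<open>H\<^sub>0\<^sup>1(\<Omega>)\<close>\<close>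

lemma weak_pair_has_weak_gradient:
  fixes \<Omega> :: "(real ^ 'n) set"
  assumes \<Omega>: "open \<Omega>" and u: "u \<in> SqInt lborel" and g: "\<And>i. g i \<in> SqInt lborel" and weak: "weak_pair u g"
  shows "has_weak_gradient \<Omega> u (\<lambda>x. vec_lambda (\<lambda>i. g i x))"
  unfolding has_weak_gradient_def
proof (intro ballI allI)
  fix \<psi> i assume \<psi>: "\<psi> \<in> test_functions \<Omega>"
  have pd: "partial_deriv i \<psi> \<in> test_functions \<Omega>"
    by (rule test_functions_partial_deriv[OF \<psi>])
  have [measurable]: "u \<in> borel_measurable borel" "g i \<in> borel_measurable borel"
    "\<psi> \<in> borel_measurable borel" "partial_deriv i \<psi> \<in> borel_measurable borel"
    using SqInt_measurable[OF u] SqInt_measurable[OF g[of i]] test_functions_measurable[OF \<psi>] test_functions_measurable[OF pd]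
    by simp_all
  have "(LINT x|lebesgue_on \<Omega>. u x * partial_deriv i \<psi> x) = (LINT x|lborel. u x * partial_deriv i \<psi> x)"
    by (rule integral_lebesgue_on_eq_lborel) (use \<Omega> test_functions_eq_0[OF pd] in simp_all)
  moreover have "(LINT x|lebesgue_on \<Omega>. g i x * \<psi> x) = (LINT x|lborel. g i x * \<psi> x)"
    by (rule integral_lebesgue_on_eq_lborel) (use \<Omega> test_functions_eq_0[OF \<psi>] in simp_all)
  ultimately show "(LINT x|lebesgue_on \<Omega>. u x * partial_deriv i \<psi> x)
      = - (LINT x|lebesgue_on \<Omega>. vec_lambda (\<lambda>i. g i x) $ i * \<psi> x)"
    using weak_pairD[OF weak test_functions_mono[OF \<psi> subset_UNIV], of i] by simp
qed

lemma weak_pair_test_function: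
  assumes "\<phi> \<in> test_functions \<Omega>"
  shows "weak_pair \<phi> (\<lambda>i. partial_deriv i \<phi>)"
  unfolding weak_pair_def
  by (intro ballI allI) (rule integral_by_parts_test_functions[OF assms])

text \<open>An inequality, because the pair lives on the whole space while \<open>grad_norm\<close>
  integrates over \<Omega> only.\<close>

lemma grad_norm_weak_pair:
  fixes \<Omega> :: "(real ^ 'n) set"
  assumes \<Omega>: "open \<Omega>" "bounded \<Omega>" and u: "u \<in> SqInt lborel" and g: "\<And>i. g i \<in> SqInt lborel" and weak: "weak_pair u g"
  shows "(grad_norm \<Omega> u)\<^sup>2 \<le> (\<Sum>i\<in>UNIV. (nrm lborel (g i))\<^sup>2)"
proof -
  have \<Omega>b: "\<Omega> \<in> sets borel"
    using \<Omega>(1) by simp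
  have "(grad_norm \<Omega> u)\<^sup>2 = (\<Sum>i\<in>UNIV. (nrm (lebesgue_on \<Omega>) (\<lambda>x. vec_lambda (\<lambda>i. g i x) $ i))\<^sup>2)"
    by (rule grad_norm_eq[OF \<Omega> _ weak_pair_has_weak_gradient[OF \<Omega>(1) u g weak]])
      (use SqInt_lborel_restrict(1)[OF g \<Omega>b] in simp)
  also have "\<dots> \<le> (\<Sum>i\<in>UNIV. (nrm lborel (g i))\<^sup>2)"
    using SqInt_lborel_restrict(2)[OF g \<Omega>b] by (intro sum_mono power_mono) (simp_all add: nrm_nonneg)
  finally show ?thesis .
qed

text \<open>The bounded approximations supported in \<Omega> are upgraded to approximations with
  convergent gradients. Their limit \<open>q\<close> is itself a weak gradient of \<open>u\<close>
  and serves as such in place of \<open>g\<close>.\<close>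

lemma H1_supported_imp_H01:
  fixes \<Omega> :: "(real ^ 'n) set"
  assumes \<Omega>: "bounded_lipschitz_domain \<Omega>" and u: "H1_supported \<Omega> u g"
  shows "u \<in> H01 \<Omega>"
proof -
  have op: "open \<Omega>" and bd: "bounded \<Omega>"
    using \<Omega> by (auto simp: bounded_lipschitz_domain_def)
  have \<Omega>b: "\<Omega> \<in> sets borel"
    using op by simp
  note D = H1_supportedD[OF u]
  obtain m where m: "approximable \<Omega> u m"
    using H1_supported_approximable[OF \<Omega> u] by blast
  obtain \<phi> q where \<phi>: "\<And>n. \<phi> n \<in> test_functions \<Omega>" and q: "\<And>i. q i \<in> SqInt lborel"
    and lim: "(\<lambda>n. nrm lborel (\<lambda>x. \<phi> n x - u x)) \<longlonglongrightarrow> 0"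
      "\<And>i. (\<lambda>n. nrm lborel (\<lambda>x. partial_deriv i (\<phi> n) x - q i x)) \<longlonglongrightarrow> 0"
    and "(\<Sum>i\<in>UNIV. (nrm lborel (q i))\<^sup>2) \<le> m"
    using approximable_imp_strong[OF D(1) m] by blast
  have weak: "weak_pair u q"
    by (rule weak_pair_limit[OF \<phi> D(1) q lim])
  have "u \<in> L2 \<Omega>"
    by (rule SqInt_lborel_restrict(1)[OF D(1) \<Omega>b])
  moreover have "(\<lambda>x. vec_lambda (\<lambda>i. q i x) $ i) \<in> L2 \<Omega>" for i
    using SqInt_lborel_restrict(1)[OF q \<Omega>b] by simp
  ultimately have H1: "u \<in> H1 \<Omega>"
    unfolding H1_def mem_Collect_eq
    by (intro conjI exI[of _ "\<lambda>x. vec_lambda (\<lambda>i. q i x)"] allI weak_pair_has_weak_gradient[OF op D(1) q weak])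
  have \<phi>S: "\<phi> n \<in> SqInt lborel" for n
    by (rule test_functions_SqInt[OF \<phi>])
  have bound: "h1_norm \<Omega> (\<lambda>x. \<phi> n x - u x) \<le> sqrt ((nrm lborel (\<lambda>x. \<phi> n x - u x))\<^sup>2
      + (\<Sum>i\<in>UNIV. (nrm lborel (\<lambda>x. partial_deriv i (\<phi> n) x - q i x))\<^sup>2))" for n
  proof -
    have diff: "weak_pair (\<lambda>x. \<phi> n x - u x) (\<lambda>i x. partial_deriv i (\<phi> n) x - q i x)"
      by (rule weak_pair_diff[OF weak_pair_test_function[OF \<phi>] weak \<phi>S D(1) partial_deriv_test_SqInt[OF \<phi>] q])
    have "(grad_norm \<Omega> (\<lambda>x. \<phi> n x - u x))\<^sup>2 \<le> (\<Sum>i\<in>UNIV. (nrm lborel (\<lambda>x. partial_deriv i (\<phi> n) x - q i x))\<^sup>2)"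
      by (rule grad_norm_weak_pair[OF op bd SqInt_diff[OF \<phi>S D(1)] SqInt_diff[OF partial_deriv_test_SqInt[OF \<phi>] q] diff])
    moreover have "(l2_norm \<Omega> (\<lambda>x. \<phi> n x - u x))\<^sup>2 \<le> (nrm lborel (\<lambda>x. \<phi> n x - u x))\<^sup>2"
      unfolding l2_norm_eq_nrm
      by (rule power_mono[OF SqInt_lborel_restrict(2)[OF SqInt_diff[OF \<phi>S D(1)] \<Omega>b] nrm_nonneg])
    ultimately show ?thesis
      unfolding h1_norm_def by (intro real_sqrt_le_mono add_mono)
  qed
  have "(\<lambda>n. sqrt ((nrm lborel (\<lambda>x. \<phi> n x - u x))\<^sup>2
      + (\<Sum>i\<in>UNIV. (nrm lborel (\<lambda>x. partial_deriv i (\<phi> n) x - q i x))\<^sup>2))) \<longlonglongrightarrow> sqrt (0\<^sup>2 + (\<Sum>i\<in>(UNIV :: 'n set). 0\<^sup>2))"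
    by (intro tendsto_real_sqrt tendsto_add tendsto_sum tendsto_power lim)
  then have lim0: "(\<lambda>n. sqrt ((nrm lborel (\<lambda>x. \<phi> n x - u x))\<^sup>2
      + (\<Sum>i\<in>UNIV. (nrm lborel (\<lambda>x. partial_deriv i (\<phi> n) x - q i x))\<^sup>2))) \<longlonglongrightarrow> 0"
    by simp
  have "norm (h1_norm \<Omega> (\<lambda>x. \<phi> n x - u x)) \<le> sqrt ((nrm lborel (\<lambda>x. \<phi> n x - u x))\<^sup>2
      + (\<Sum>i\<in>UNIV. (nrm lborel (\<lambda>x. partial_deriv i (\<phi> n) x - q i x))\<^sup>2))" for n
    using bound[of n] by (simp add: h1_norm_def)
  from Lim_null_comparison[OF always_eventually[OF allI[OF this]] lim0]
  have "(\<lambda>n. h1_norm \<Omega> (\<lambda>x. \<phi> n x - u x)) \<longlonglongrightarrow> 0" .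
  then show ?thesis
    unfolding H01_def mem_Collect_eq using H1 \<phi> by (intro conjI exI[of _ \<phi>] allI)
qed

text \<open>Stated as an equality of predicates, so that the choice in \<open>weak_grad\<close>
  returns the same function for both arguments.\<close>

lemma has_weak_gradient_cong:
  fixes u w :: "real ^ 'n \<Rightarrow> real"
  assumes "AE x in lebesgue_on \<Omega>. u x = w x" "u \<in> borel_measurable (lebesgue_on \<Omega>)" "w \<in> borel_measurable (lebesgue_on \<Omega>)"
  shows "has_weak_gradient \<Omega> u = has_weak_gradient \<Omega> w"
proof
  fix g
  have "(LINT x|lebesgue_on \<Omega>. u x * partial_deriv i \<psi> x) = (LINT x|lebesgue_on \<Omega>. w x * partial_deriv i \<psi> x)"
    if \<psi>: "\<psi> \<in> test_functions \<Omega>" for \<psi> i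
  proof (rule integral_cong_AE)
    have pd: "partial_deriv i \<psi> \<in> borel_measurable (lebesgue_on \<Omega>)"
      by (rule borel_measurable_lebesgue_on[OF test_functions_measurable[OF test_functions_partial_deriv[OF \<psi>]]])
    show "(\<lambda>x. u x * partial_deriv i \<psi> x) \<in> borel_measurable (lebesgue_on \<Omega>)"
      "(\<lambda>x. w x * partial_deriv i \<psi> x) \<in> borel_measurable (lebesgue_on \<Omega>)"
      by (rule borel_measurable_times[OF assms(2) pd], rule borel_measurable_times[OF assms(3) pd])
    show "AE x in lebesgue_on \<Omega>. u x * partial_deriv i \<psi> x = w x * partial_deriv i \<psi> x"
      using assms(1) by (rule AE_mp) simp
  qed
  then show "has_weak_gradient \<Omega> u g = has_weak_gradient \<Omega> w g"
    by (simp add: has_weak_gradient_def)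
qed

lemma grad_norm_cong:
  assumes "AE x in lebesgue_on \<Omega>. u x = w x" "u \<in> borel_measurable (lebesgue_on \<Omega>)" "w \<in> borel_measurable (lebesgue_on \<Omega>)"
  shows "grad_norm \<Omega> u = grad_norm \<Omega> w"
  by (simp add: grad_norm_def weak_grad_def has_weak_gradient_cong[OF assms])

lemma H01_cong:
  fixes \<Omega> :: "(real ^ 'n) set"
  assumes AE: "AE x in lebesgue_on \<Omega>. u x = w x" and u: "u \<in> L2 \<Omega>" and w: "w \<in> H01 \<Omega>"
  shows "u \<in> H01 \<Omega>"
proof -
  have um: "u \<in> borel_measurable (lebesgue_on \<Omega>)" and wm: "w \<in> borel_measurable (lebesgue_on \<Omega>)"
    using u w by (simp_all add: L2_def H01_def H1_def)
  have "u \<in> H1 \<Omega>"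
    using w u by (simp add: H01_def H1_def has_weak_gradient_cong[OF AE um wm])
  moreover obtain \<phi> where \<phi>: "\<And>n. \<phi> n \<in> test_functions \<Omega>" "(\<lambda>n. h1_norm \<Omega> (\<lambda>x. \<phi> n x - w x)) \<longlonglongrightarrow> 0"
    using w unfolding H01_def by blast
  have "h1_norm \<Omega> (\<lambda>x. \<phi> n x - u x) = h1_norm \<Omega> (\<lambda>x. \<phi> n x - w x)" for n
  proof -
    have \<phi>m: "\<phi> n \<in> borel_measurable (lebesgue_on \<Omega>)"
      by (rule borel_measurable_lebesgue_on[OF test_functions_measurable[OF \<phi>(1)]])
    have AE': "AE x in lebesgue_on \<Omega>. \<phi> n x - u x = \<phi> n x - w x"
      using AE by (rule AE_mp) simp
    note m = borel_measurable_diff[OF \<phi>m um] borel_measurable_diff[OF \<phi>m wm]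
    show ?thesis
      unfolding h1_norm_def l2_norm_eq_nrm grad_norm_cong[OF AE' m] nrm_cong_AE[OF AE' m] ..
  qed
  with \<phi> have "\<exists>\<phi>. (\<forall>n. \<phi> n \<in> test_functions \<Omega>) \<and> (\<lambda>n. h1_norm \<Omega> (\<lambda>x. \<phi> n x - u x)) \<longlonglongrightarrow> 0"
    by (intro exI[of _ \<phi>]) simp
  ultimately show ?thesis
    by (simp add: H01_def)
qed

subsection \<open>Borel representatives\<close>

text \<open>Convolution and changes of variables are carried out for Borel functions on the whole
  space; this is the passage from an element of L^2 over \<Omega> to such a function.\<close>

lemma Borel_representative:
  fixes \<Omega> :: "(real ^ 'n) set"
  assumes \<Omega>: "open \<Omega>" and v: "v \<in> L2 \<Omega>"
  obtains w where "w \<in> SqInt lborel" "\<And>x. x \<notin> \<Omega> \<Longrightarrow> w x = 0" "AE x in lebesgue_on \<Omega>. v x = w x"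
    "AE x in lebesgue. zero_ext \<Omega> v x = w x" "zero_ext \<Omega> v \<in> borel_measurable lebesgue"
proof -
  have \<Omega>b: "\<Omega> \<in> sets borel" and \<Omega>l: "\<Omega> \<in> sets lebesgue"
    using \<Omega> by simp_all
  have vm: "v \<in> borel_measurable (lebesgue_on \<Omega>)"
    using v by (simp add: L2_def)
  then have zm: "zero_ext \<Omega> v \<in> borel_measurable lebesgue"
    unfolding zero_ext_def using borel_measurable_if[OF \<Omega>l] by blast
  obtain w' where w': "w' \<in> borel_measurable lborel" "AE x in lborel. zero_ext \<Omega> v x = w' x"
    using completion_ex_borel_measurable_real[OF zm] by blast
  \<comment> \<open>Multiplying by the indicator makes the representative vanish at every point off
    \<Omega>, not only almost everywhere, and keeps it Borel.\<close>
  define w where "w x = indicator \<Omega> x * w' x" for x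
  have wm: "w \<in> borel_measurable borel"
    unfolding w_def using w'(1) \<Omega>b by (intro borel_measurable_times borel_measurable_indicator) simp_all
  have w0: "x \<notin> \<Omega> \<Longrightarrow> w x = 0" for x
    by (simp add: w_def)
  have "AE x in lebesgue. zero_ext \<Omega> v x = w' x"
    using w'(2) by (rule AE_completion)
  then have AE1: "AE x in lebesgue. zero_ext \<Omega> v x = w x"
    by (rule AE_mp) (auto simp: w_def zero_ext_def intro!: AE_I2)
  then have "AE x in lebesgue. x \<in> \<Omega> \<longrightarrow> v x = w x"
    by (rule AE_mp) (auto simp: zero_ext_def intro!: AE_I2)
  then have AE2: "AE x in lebesgue_on \<Omega>. v x = w x"
    using \<Omega>l by (simp add: AE_restrict_space_iff)
  have wm': "w \<in> borel_measurable (lebesgue_on \<Omega>)"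
    by (rule borel_measurable_lebesgue_on[OF wm])
  have "integrable (lebesgue_on \<Omega>) (\<lambda>x. (w x)\<^sup>2)"
  proof (rule integrable_cong_AE_imp)
    show "integrable (lebesgue_on \<Omega>) (\<lambda>x. (v x)\<^sup>2)"
      using v by (simp add: L2_def)
    show "AE x in lebesgue_on \<Omega>. (v x)\<^sup>2 = (w x)\<^sup>2"
      using AE2 by (rule AE_mp) simp
  qed (use wm' in simp)
  then have "w \<in> L2 \<Omega>"
    using wm' by (simp add: L2_def)
  then have "w \<in> SqInt lborel"
    using L2_iff_SqInt_lborel[OF wm \<Omega>b w0] by simp
  then show thesis
    using that w0 AE2 AE1 zm by blast
qed

lemma l2_norm_diff_representatives:
  fixes \<Omega> :: "(real ^ 'n) set"
  assumes \<Omega>: "open \<Omega>" and v: "v \<in> L2 \<Omega>" "w \<in> SqInt lborel" "\<And>x. x \<notin> \<Omega> \<Longrightarrow> w x = 0" "AE x in lebesgue_on \<Omega>. v x = w x"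
    and v': "v' \<in> L2 \<Omega>" "w' \<in> SqInt lborel" "\<And>x. x \<notin> \<Omega> \<Longrightarrow> w' x = 0" "AE x in lebesgue_on \<Omega>. v' x = w' x"
  shows "l2_norm \<Omega> (\<lambda>x. v x - v' x) = nrm lborel (\<lambda>x. w x - w' x)"
proof -
  have \<Omega>b: "\<Omega> \<in> sets borel"
    using \<Omega> by simp
  have m: "v \<in> borel_measurable (lebesgue_on \<Omega>)" "v' \<in> borel_measurable (lebesgue_on \<Omega>)"
    using v(1) v'(1) by (simp_all add: L2_def)
  have wm: "(\<lambda>x. w x - w' x) \<in> borel_measurable borel"
    using SqInt_measurable[OF SqInt_diff[OF v(2) v'(2)]] by simp
  have "AE x in lebesgue_on \<Omega>. v x - v' x = w x - w' x"
    using v(4) v'(4) by eventually_elim simp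
  then have "l2_norm \<Omega> (\<lambda>x. v x - v' x) = nrm (lebesgue_on \<Omega>) (\<lambda>x. w x - w' x)"
    unfolding l2_norm_eq_nrm by (rule nrm_cong_AE[OF _ borel_measurable_diff[OF m] borel_measurable_lebesgue_on[OF wm]])
  also have "\<dots> = nrm lborel (\<lambda>x. w x - w' x)"
    by (rule nrm_lebesgue_on_eq_lborel[OF wm \<Omega>b]) (simp add: v(3) v'(3))
  finally show ?thesis .
qed

lemma gagliardo_finite_iff:
  assumes "C s > 0"
  shows "frac_energy C s u < \<infinity> \<longleftrightarrow> gagliardo s u < \<infinity>"
  using assms by (auto simp: frac_energy_def ennreal_mult_less_top ennreal_eq_0_iff)

text \<open>The energies are taken finite and convergent, which a passage to a subsequence arranges
  later. The mollifications of the limit then approximate it with Dirichlet energy at most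
  \<open>m\<close>.\<close>

lemma fractional_lower_bound:
  fixes \<Omega> :: "(real ^ 'n) set"
  assumes \<Omega>: "bounded_lipschitz_domain \<Omega>" and bbm: "bbm_normalization \<Omega> C"
    and s: "\<And>n. 0 < s n" "\<And>n. s n < 1" "s \<longlonglongrightarrow> 1"
    and v: "\<And>n. v n \<in> L2 \<Omega>" and u: "u \<in> L2 \<Omega>"
    and lim: "(\<lambda>n. l2_norm \<Omega> (\<lambda>x. v n x - u x)) \<longlonglongrightarrow> 0"
    and M: "\<And>n. frac_energy C (s n) (zero_ext \<Omega> (v n)) = ennreal (M n)" "\<And>n. 0 \<le> M n" "M \<longlonglongrightarrow> m"
  shows "u \<in> H01 \<Omega>" "(grad_norm \<Omega> u)\<^sup>2 \<le> m"
proof -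
  have op: "open \<Omega>" and bd: "bounded \<Omega>" and ne: "\<Omega> \<noteq> {}"
    using \<Omega> by (auto simp: bounded_lipschitz_domain_def)
  obtain U where U: "U \<in> SqInt lborel" "\<And>x. x \<notin> \<Omega> \<Longrightarrow> U x = 0" "AE x in lebesgue_on \<Omega>. u x = U x"
    using Borel_representative[OF op u] by blast
  have "\<forall>n. \<exists>w. w \<in> SqInt lborel \<and> (\<forall>x. x \<notin> \<Omega> \<longrightarrow> w x = 0) \<and> (AE x in lebesgue_on \<Omega>. v n x = w x) \<and>
      frac_energy C (s n) (zero_ext \<Omega> (v n)) = energy C (s n) w \<and>
      gagliardo (s n) (zero_ext \<Omega> (v n)) = (\<integral>\<^sup>+h. kern (s n) h * incr_sq w h \<partial>lborel)"
  proof
    fix n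
    obtain w where w: "w \<in> SqInt lborel" "\<And>x. x \<notin> \<Omega> \<Longrightarrow> w x = 0" "AE x in lebesgue_on \<Omega>. v n x = w x"
      "AE x in lebesgue. zero_ext \<Omega> (v n) x = w x" "zero_ext \<Omega> (v n) \<in> borel_measurable lebesgue"
      using Borel_representative[OF op v] by blast
    have wm: "w \<in> borel_measurable borel"
      using SqInt_measurable[OF w(1)] by simp
    show "\<exists>w. w \<in> SqInt lborel \<and> (\<forall>x. x \<notin> \<Omega> \<longrightarrow> w x = 0) \<and> (AE x in lebesgue_on \<Omega>. v n x = w x) \<and>
        frac_energy C (s n) (zero_ext \<Omega> (v n)) = energy C (s n) w \<and>
        gagliardo (s n) (zero_ext \<Omega> (v n)) = (\<integral>\<^sup>+h. kern (s n) h * incr_sq w h \<partial>lborel)"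
      using w(1-3) frac_energy_eq[OF w(5) wm w(4)] gagliardo_eq[OF w(5) wm w(4)]
      by (intro exI[of _ w] conjI allI impI)
  qed
  from choice[OF this] obtain V where V_all: "\<forall>n. V n \<in> SqInt lborel \<and> (\<forall>x. x \<notin> \<Omega> \<longrightarrow> V n x = 0) \<and>
      (AE x in lebesgue_on \<Omega>. v n x = V n x) \<and>
      frac_energy C (s n) (zero_ext \<Omega> (v n)) = energy C (s n) (V n) \<and>
      gagliardo (s n) (zero_ext \<Omega> (v n)) = (\<integral>\<^sup>+h. kern (s n) h * incr_sq (V n) h \<partial>lborel)" ..
  have V: "V n \<in> SqInt lborel" "x \<notin> \<Omega> \<Longrightarrow> V n x = 0" "AE x in lebesgue_on \<Omega>. v n x = V n x"
    "frac_energy C (s n) (zero_ext \<Omega> (v n)) = energy C (s n) (V n)"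
    "gagliardo (s n) (zero_ext \<Omega> (v n)) = (\<integral>\<^sup>+h. kern (s n) h * incr_sq (V n) h \<partial>lborel)" for n x
    using spec[OF V_all, of n] by simp_all
  have VU: "(\<lambda>n. nrm lborel (\<lambda>x. V n x - U x)) \<longlonglongrightarrow> 0"
    using lim l2_norm_diff_representatives[OF op v V(1-3) u U] by simp
  have "gagliardo (s n) (zero_ext \<Omega> (v n)) < \<infinity>" for n
  proof -
    have "C (s n) > 0"
      using bbm s by (simp add: bbm_normalization_def)
    then show ?thesis
      using gagliardo_finite_iff[of C "s n" "zero_ext \<Omega> (v n)"] M(1)[of n] by simp
  qed
  then have fin: "(\<integral>\<^sup>+h. kern (s n) h * incr_sq (V n) h \<partial>lborel) < \<infinity>" for n
    unfolding V(5) .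
  have E: "energy C (s n) (V n) \<le> ennreal (M n)" for n
    using M(1)[of n] V(4)[of n] by simp
  \<comment> \<open>Approximation on the whole space provides the gradient together with the sharp
    bound \<open>m\<close>. Functions supported in \<Omega> enter only afterwards, for membership in
    \<open>H01\<close>, and with a cruder bound.\<close>
  have approx: "approximable UNIV U m"
    unfolding approximable_def
  proof (intro allI impI)
    fix e :: real assume e: "e > 0"
    obtain \<rho> where \<rho>: "mollifier \<rho>" "nrm lborel (\<lambda>x. conv \<rho> U x - U x) < e"
      using mollify_close[OF V(1) U(1) VU s(1) fin e] by blast
    note dirichlet_mollify_le[OF op bd ne bbm s(2,3) V(1) U(1,2) VU E M(2,3) \<rho>(1)]
    then show "\<exists>\<phi>\<in>test_functions UNIV. nrm lborel (\<lambda>x. \<phi> x - U x) < e \<and> dirichlet \<phi> \<le> m"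
      using \<rho>(2) by blast
  qed
  obtain \<phi> g where \<phi>: "\<And>n. \<phi> n \<in> test_functions (UNIV :: (real ^ 'n) set)" and g: "\<And>i. g i \<in> SqInt lborel"
    and lim': "(\<lambda>n. nrm lborel (\<lambda>x. \<phi> n x - U x)) \<longlonglongrightarrow> 0"
      "\<And>i. (\<lambda>n. nrm lborel (\<lambda>x. partial_deriv i (\<phi> n) x - g i x)) \<longlonglongrightarrow> 0"
    and gm: "(\<Sum>i\<in>UNIV. (nrm lborel (g i))\<^sup>2) \<le> m"
    using approximable_imp_strong[OF U(1) approx] by blast
  have weak: "weak_pair U g"
    by (rule weak_pair_limit[OF \<phi> U(1) g lim'])
  have "H1_supported \<Omega> U g"
    unfolding H1_supported_def using U(1,2) g weak shift_continuous_limit[OF U(1) approx] by simp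
  then have "U \<in> H01 \<Omega>"
    by (rule H1_supported_imp_H01[OF \<Omega>])
  then show "u \<in> H01 \<Omega>"
    by (rule H01_cong[OF U(3) u])
  have um: "u \<in> borel_measurable (lebesgue_on \<Omega>)"
    using u by (simp add: L2_def)
  have Um: "U \<in> borel_measurable (lebesgue_on \<Omega>)"
    using SqInt_measurable[OF U(1)] by (intro borel_measurable_lebesgue_on) simp
  have "(grad_norm \<Omega> u)\<^sup>2 = (grad_norm \<Omega> U)\<^sup>2"
    using grad_norm_cong[OF U(3) um Um] by simp
  also have "\<dots> \<le> m"
    using grad_norm_weak_pair[OF op bd U(1) g weak] gm by (rule order_trans)
  finally show "(grad_norm \<Omega> u)\<^sup>2 \<le> m" .
qed

subsection \<open>\<open>\<Gamma>\<close>-convergence\<close>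

lemma L2_bounded_linear_tendsto:
  assumes K: "L2_bounded_linear \<Omega> K" and y: "y \<in> L2 \<Omega>" and v: "\<And>n. v n \<in> L2 \<Omega>" and u: "u \<in> L2 \<Omega>"
    and lim: "(\<lambda>n. l2_norm \<Omega> (\<lambda>x. v n x - u x)) \<longlonglongrightarrow> 0"
  shows "(\<lambda>n. l2_norm \<Omega> (\<lambda>x. K (v n) x - y x)) \<longlonglongrightarrow> l2_norm \<Omega> (\<lambda>x. K u x - y x)"
proof -
  let ?M = "lebesgue_on \<Omega>"
  have KL2: "K w \<in> SqInt ?M" if "w \<in> L2 \<Omega>" for w
    using K that by (simp add: L2_bounded_linear_def L2_eq_SqInt)
  obtain B where B: "\<And>w. w \<in> L2 \<Omega> \<Longrightarrow> l2_norm \<Omega> (K w) \<le> B * l2_norm \<Omega> w"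
    using K unfolding L2_bounded_linear_def by blast
  have yS: "y \<in> SqInt ?M"
    using y by (simp add: L2_eq_SqInt)
  have bound: "norm (nrm ?M (\<lambda>x. (K (v n) x - y x) - (K u x - y x))) \<le> B * l2_norm \<Omega> (\<lambda>x. v n x - u x)" for n
  proof -
    \<comment> \<open>The difference is written as a sum with a scalar multiple, the two forms in
      which the linearity of \<open>K\<close> is given, each up to a null set.\<close>
    have neg: "(\<lambda>z. - 1 * u z) \<in> L2 \<Omega>"
      using u unfolding L2_eq_SqInt by (rule SqInt_cmult)
    have diff: "(\<lambda>z. v n z + - 1 * u z) \<in> L2 \<Omega>"
      using v neg unfolding L2_eq_SqInt by (rule SqInt_add)
    have 1: "AE x in ?M. K (\<lambda>z. v n z + - 1 * u z) x = K (v n) x + K (\<lambda>z. - 1 * u z) x"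
      by (rule K[unfolded L2_bounded_linear_def, THEN conjunct2, THEN conjunct1, rule_format, OF v neg])
    have 2: "AE x in ?M. K (\<lambda>z. - 1 * u z) x = - 1 * K u x"
      by (rule K[unfolded L2_bounded_linear_def, THEN conjunct2, THEN conjunct2, THEN conjunct1, rule_format, OF u])
    have "AE x in ?M. (K (v n) x - y x) - (K u x - y x) = K (\<lambda>z. v n z + - 1 * u z) x"
      using 1 2 by eventually_elim simp
    then have "nrm ?M (\<lambda>x. (K (v n) x - y x) - (K u x - y x)) = nrm ?M (K (\<lambda>z. v n z + - 1 * u z))"
      by (rule nrm_cong_AE[OF _ SqInt_measurable[OF SqInt_diff[OF SqInt_diff[OF KL2[OF v] yS] SqInt_diff[OF KL2[OF u] yS]]]
            SqInt_measurable[OF KL2[OF diff]]])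
    also have "\<dots> \<le> B * l2_norm \<Omega> (\<lambda>z. v n z + - 1 * u z)"
      using B[OF diff] by (simp only: l2_norm_eq_nrm)
    finally show ?thesis
      by (simp add: nrm_nonneg)
  qed
  have "(\<lambda>n. B * l2_norm \<Omega> (\<lambda>x. v n x - u x)) \<longlonglongrightarrow> 0"
    using lim by (rule tendsto_mult_right_zero)
  from Lim_null_comparison[OF always_eventually[OF allI[OF bound]] this]
  show ?thesis
    unfolding l2_norm_eq_nrm
    by (rule nrm_tendsto[OF SqInt_diff[OF KL2[OF v] yS] SqInt_diff[OF KL2[OF u] yS]])
qed

text \<open>The data and L^2 terms are continuous in L^2, so only the energy matters, along a
  subsequence that attains the lower limit with finite values.\<close>

lemma J_frac_liminf:
  fixes \<Omega> :: "(real ^ 'n) set"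
  assumes \<Omega>: "bounded_lipschitz_domain \<Omega>" and K: "L2_bounded_linear \<Omega> K" and y: "y \<in> L2 \<Omega>" and \<alpha>: "\<alpha> > 0"
    and bbm: "bbm_normalization \<Omega> C"
    and s: "\<And>n. 0 < s n" "\<And>n. s n < 1" "s \<longlonglongrightarrow> 1"
    and v: "\<And>n. v n \<in> L2 \<Omega>" and u: "u \<in> L2 \<Omega>"
    and lim: "(\<lambda>n. l2_norm \<Omega> (\<lambda>x. v n x - u x)) \<longlonglongrightarrow> 0"
  shows "J_one \<Omega> K y \<alpha> u \<le> liminf (\<lambda>n. J_frac \<Omega> K y C \<alpha> (s n) (v n))"
proof (cases "liminf (\<lambda>n. J_frac \<Omega> K y C \<alpha> (s n) (v n)) = \<infinity>")
  case True
  then show ?thesis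
    by simp
next
  case False
  define X where "X n = J_frac \<Omega> K y C \<alpha> (s n) (v n)" for n
  define fit where "fit w = 1 / 2 * (l2_norm \<Omega> (\<lambda>x. K w x - y x))\<^sup>2 + \<alpha> / 2 * (l2_norm \<Omega> w)\<^sup>2" for w
  define E where "E n = enn2real (frac_energy C (s n) (zero_ext \<Omega> (v n)))" for n
  have X_eq: "X n = (if zero_ext \<Omega> (v n) \<in> H0s \<Omega> (s n) then ereal (fit (v n) + \<alpha> / 2 * E n) else \<infinity>)" for n
    by (simp add: X_def J_frac_def fit_def E_def distrib_left)
  have nonneg: "0 \<le> fit w" "0 \<le> E n" for w n
    using \<alpha> by (simp_all add: fit_def E_def)
  have X0: "0 \<le> X n" for n
    using \<alpha> nonneg by (simp add: X_eq)
  \<comment> \<open>A subsequence along which the values converge to the lower limit; that limit is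
    real because the values are nonnegative and the infinite case is settled.\<close>
  obtain r where r: "strict_mono r" "(X \<circ> r) \<longlonglongrightarrow> liminf X"
    using liminf_subseq_lim[of X] by blast
  have "liminf X \<noteq> \<infinity>"
    using False by (simp add: X_def[abs_def])
  moreover have "0 \<le> liminf X"
    by (rule Liminf_bounded) (simp add: X0)
  ultimately obtain l where l: "liminf X = ereal l"
    by (cases "liminf X") auto
  have "\<forall>\<^sub>F n in sequentially. (X \<circ> r) n < \<infinity>"
    by (rule order_tendstoD(2)[OF r(2)]) (simp add: l)
  then obtain N where N: "\<And>n. n \<ge> N \<Longrightarrow> X (r n) < \<infinity>"
    by (auto simp: eventually_sequentially)
  \<comment> \<open>Dropping the first N members leaves only finite values, so that every remaining
    function lies in its fractional space.\<close>
  define k where "k n = r (n + N)" for n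
  have k: "filterlim k sequentially sequentially"
    unfolding k_def by (rule filterlim_compose[OF filterlim_subseq[OF r(1)] filterlim_add_const_nat_at_top])
  have H0s: "zero_ext \<Omega> (v (k n)) \<in> H0s \<Omega> (s (k n))" for n
    using N[of "n + N"] by (simp add: k_def X_eq split: if_splits)
  have "(\<lambda>n. X (k n)) \<longlonglongrightarrow> ereal l"
    using LIMSEQ_ignore_initial_segment[OF r(2), of N] by (simp add: k_def l)
  then have J: "(\<lambda>n. fit (v (k n)) + \<alpha> / 2 * E (k n)) \<longlonglongrightarrow> l"
    using H0s by (simp add: X_eq)
  have "(\<lambda>n. l2_norm \<Omega> (v n)) \<longlonglongrightarrow> l2_norm \<Omega> u"
    using v u lim unfolding l2_norm_eq_nrm L2_eq_SqInt by (rule nrm_tendsto)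
  then have "(\<lambda>n. fit (v n)) \<longlonglongrightarrow> fit u"
    unfolding fit_def by (intro tendsto_intros L2_bounded_linear_tendsto[OF K y v u lim])
  then have fit_lim: "(\<lambda>n. fit (v (k n))) \<longlonglongrightarrow> fit u"
    by (rule filterlim_compose[OF _ k])
  \<comment> \<open>The functional values and the data terms both converge, hence so do the
    energies; their limit is the solution of l = fit u + (\<alpha>/2) m.\<close>
  define m where "m = (l - fit u) * (2 / \<alpha>)"
  have "(\<lambda>n. (fit (v (k n)) + \<alpha> / 2 * E (k n) - fit (v (k n))) * (2 / \<alpha>)) \<longlonglongrightarrow> m"
    unfolding m_def by (intro tendsto_intros J fit_lim)
  then have E_lim: "(\<lambda>n. E (k n)) \<longlonglongrightarrow> m"
    using \<alpha> by simp
  have E_eq: "frac_energy C (s (k n)) (zero_ext \<Omega> (v (k n))) = ennreal (E (k n))" for n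
  proof -
    have "C (s (k n)) > 0"
      using bbm s by (simp add: bbm_normalization_def)
    moreover have "gagliardo (s (k n)) (zero_ext \<Omega> (v (k n))) < \<infinity>"
      using H0s[of n] by (simp add: H0s_def Hs_def)
    ultimately have "frac_energy C (s (k n)) (zero_ext \<Omega> (v (k n))) < \<infinity>"
      using gagliardo_finite_iff by blast
    then show ?thesis
      by (simp add: E_def)
  qed
  note lower = fractional_lower_bound[OF \<Omega> bbm s(1,2) filterlim_compose[OF s(3) k] v u
      filterlim_compose[OF lim k] E_eq nonneg(2) E_lim]
  have "\<alpha> / 2 * (grad_norm \<Omega> u)\<^sup>2 \<le> \<alpha> / 2 * m"
    using lower(2) \<alpha> by (intro mult_left_mono) auto
  also have "\<dots> = l - fit u"
    using \<alpha> by (simp add: m_def)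
  finally have "fit u + \<alpha> / 2 * (grad_norm \<Omega> u)\<^sup>2 \<le> l"
    by simp
  then have "J_one \<Omega> K y \<alpha> u \<le> ereal l"
    using lower(1) by (simp add: J_one_def fit_def distrib_left)
  then show ?thesis
    using l by (simp add: X_def[abs_def])
qed

text \<open>Besides convergence of the energies, the constant sequence must lie in the domain of the
  functionals: a finite limit makes the energies finite for s near 1, which puts the zero extension
  in \<open>H0s\<close>.\<close>

lemma J_frac_limsup:
  fixes \<Omega> :: "(real ^ 'n) set"
  assumes \<Omega>: "open \<Omega>" and bbm: "bbm_normalization \<Omega> C" and u: "u \<in> L2 \<Omega>"
  shows "Limsup (at_left 1) (\<lambda>s. J_frac \<Omega> K y C \<alpha> s u) \<le> J_one \<Omega> K y \<alpha> u"
proof (cases "u \<in> H01 \<Omega>")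
  case False
  then show ?thesis
    by (simp add: J_one_def)
next
  case True
  have lim: "((\<lambda>s. frac_energy C s (zero_ext \<Omega> u)) \<longlongrightarrow> ennreal ((grad_norm \<Omega> u)\<^sup>2)) (at_left 1)"
    using bbm True by (simp add: bbm_normalization_def)
  have real_lim: "((\<lambda>s. enn2real (frac_energy C s (zero_ext \<Omega> u))) \<longlongrightarrow> (grad_norm \<Omega> u)\<^sup>2) (at_left 1)"
    using tendsto_enn2real[OF lim] by simp
  have "((\<lambda>s. ereal (1 / 2 * (l2_norm \<Omega> (\<lambda>x. K u x - y x))\<^sup>2
      + \<alpha> / 2 * ((l2_norm \<Omega> u)\<^sup>2 + enn2real (frac_energy C s (zero_ext \<Omega> u)))))
      \<longlongrightarrow> ereal (1 / 2 * (l2_norm \<Omega> (\<lambda>x. K u x - y x))\<^sup>2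
      + \<alpha> / 2 * ((l2_norm \<Omega> u)\<^sup>2 + (grad_norm \<Omega> u)\<^sup>2))) (at_left 1)"
    by (intro tendsto_ereal tendsto_add tendsto_mult tendsto_const real_lim)
  then have lim': "((\<lambda>s. ereal (1 / 2 * (l2_norm \<Omega> (\<lambda>x. K u x - y x))\<^sup>2
      + \<alpha> / 2 * ((l2_norm \<Omega> u)\<^sup>2 + enn2real (frac_energy C s (zero_ext \<Omega> u))))) \<longlongrightarrow> J_one \<Omega> K y \<alpha> u) (at_left 1)"
    using True by (simp only: J_one_def if_True)
  obtain w where w: "w \<in> SqInt lborel" "\<And>x. x \<notin> \<Omega> \<Longrightarrow> w x = 0" "AE x in lebesgue_on \<Omega>. u x = w x"
      "AE x in lebesgue. zero_ext \<Omega> u x = w x" "zero_ext \<Omega> u \<in> borel_measurable lebesgue"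
    using Borel_representative[OF \<Omega> u] by blast
  have "w \<in> L2 UNIV"
    by (rule SqInt_lborel_restrict(1)[OF w(1)]) simp
  then have w2: "integrable lebesgue (\<lambda>x. (w x)\<^sup>2)"
    by (simp add: L2_def lebesgue_on_UNIV_eq)
  have "integrable lebesgue (\<lambda>x. (zero_ext \<Omega> u x)\<^sup>2)"
  proof (rule integrable_cong_AE_imp[OF w2])
    show "(\<lambda>x. (zero_ext \<Omega> u x)\<^sup>2) \<in> borel_measurable lebesgue"
      using w(5) by simp
    show "AE x in lebesgue. (w x)\<^sup>2 = (zero_ext \<Omega> u x)\<^sup>2"
      using w(4) by (rule AE_mp) simp
  qed
  then have L2: "zero_ext \<Omega> u \<in> L2 UNIV"
    using w(5) by (simp add: L2_def lebesgue_on_UNIV_eq)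
  \<comment> \<open>\<open>enn2real\<close> sends an infinite energy to 0, so convergence of the
    real values alone would not give membership; finiteness is read off from the extended
    limit.\<close>
  have "\<forall>\<^sub>F s in at_left 1. frac_energy C s (zero_ext \<Omega> u) < \<infinity>"
    by (rule order_tendstoD(2)[OF lim]) simp
  moreover have "\<forall>\<^sub>F s in at_left (1::real). s \<in> {0<..<1}"
    by (rule eventually_at_leftI[of 0]) auto
  ultimately have "\<forall>\<^sub>F s in at_left 1. J_frac \<Omega> K y C \<alpha> s u = ereal (1 / 2 * (l2_norm \<Omega> (\<lambda>x. K u x - y x))\<^sup>2
      + \<alpha> / 2 * ((l2_norm \<Omega> u)\<^sup>2 + enn2real (frac_energy C s (zero_ext \<Omega> u))))"
  proof eventually_elim
    case (elim s)
    then have "C s > 0"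
      using bbm by (simp add: bbm_normalization_def)
    then have "gagliardo s (zero_ext \<Omega> u) < \<infinity>"
      using elim(1) gagliardo_finite_iff by blast
    then have "zero_ext \<Omega> u \<in> H0s \<Omega> s"
      using L2 by (simp add: H0s_def Hs_def zero_ext_def)
    then show ?case
      by (simp add: J_frac_def)
  qed
  then have "((\<lambda>s. J_frac \<Omega> K y C \<alpha> s u) \<longlongrightarrow> J_one \<Omega> K y \<alpha> u) (at_left 1)"
    using lim' by (subst tendsto_cong)
  then have "Limsup (at_left 1) (\<lambda>s. J_frac \<Omega> K y C \<alpha> s u) = J_one \<Omega> K y \<alpha> u"
    by (intro lim_imp_Limsup) simp_all
  then show ?thesis
    by simp
qed

theorem theorem5p9:
  fixes \<Omega> :: "(real ^ 'n) set"
    and K :: "(real ^ 'n \<Rightarrow> real) \<Rightarrow> real ^ 'n \<Rightarrow> real"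
    and y :: "real ^ 'n \<Rightarrow> real"
    and \<alpha> :: real
    and C :: "real \<Rightarrow> real"
  assumes "bounded_lipschitz_domain \<Omega>"
    and "L2_bounded_linear \<Omega> K"
    and "y \<in> L2 \<Omega>"
    and "\<alpha> > 0"
    and "bbm_normalization \<Omega> C"
  shows "Gamma_converges_L2 \<Omega> (\<lambda>s. J_frac \<Omega> K y C \<alpha> s) (J_one \<Omega> K y \<alpha>)"
  unfolding Gamma_converges_L2_def
proof (intro conjI allI ballI impI)
  fix s :: "nat \<Rightarrow> real" and v :: "nat \<Rightarrow> real ^ 'n \<Rightarrow> real" and u :: "real ^ 'n \<Rightarrow> real"
  assume "u \<in> L2 \<Omega>" "\<forall>n. 0 < s n \<and> s n < 1" "s \<longlonglongrightarrow> 1" "\<forall>n. v n \<in> L2 \<Omega>"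
    "(\<lambda>n. l2_norm \<Omega> (\<lambda>x. v n x - u x)) \<longlonglongrightarrow> 0"
  then show "J_one \<Omega> K y \<alpha> u \<le> liminf (\<lambda>n. J_frac \<Omega> K y C \<alpha> (s n) (v n))"
    by (intro J_frac_liminf[OF assms]) auto
next
  fix u :: "real ^ 'n \<Rightarrow> real" assume u: "u \<in> L2 \<Omega>"
  have "open \<Omega>"
    using assms(1) by (simp add: bounded_lipschitz_domain_def)
  then have "Limsup (at_left 1) (\<lambda>s. J_frac \<Omega> K y C \<alpha> s u) \<le> J_one \<Omega> K y \<alpha> u"
    using assms(5) u by (rule J_frac_limsup)
  then show "\<exists>v. (\<forall>s. 0 < s \<and> s < 1 \<longrightarrow> v s \<in> L2 \<Omega>) \<and>
      ((\<lambda>s. l2_norm \<Omega> (\<lambda>x. v s x - u x)) \<longlongrightarrow> 0) (at_left 1) \<and>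
      Limsup (at_left 1) (\<lambda>s. J_frac \<Omega> K y C \<alpha> s (v s)) \<le> J_one \<Omega> K y \<alpha> u"
    using u by (intro exI[of _ "\<lambda>_. u"]) (simp add: l2_norm_def)
qed

end
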